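(* Let $\{\varepsilon_i : i \in \mathbb{Z}\}$ be independent and identically distributed real random variables on a probability space $(\Omega,\mathcal{F},\mathbb{P})$ with $\mathbb{E}\varepsilon_i = 0$ and finite variance $\sigma_\varepsilon^2$, having a common bounded probability density $f_\varepsilon$. Let $\{a_i\}_{i\ge 0}$ be real coefficients with $\sum_{i=0}^\infty |a_i| < \infty$ and $\sum_{i=0}^\infty a_i \neq 0$ (short memory), and let $X_n = \sum_{i=0}^\infty a_i \varepsilon_{n-i}$, $n \in \mathbb{N}$, be the one-sided linear process, with common marginal probability density $f$. Assume the Shannon entropy $S(f) = -\int_{\mathbb{R}} f(x)\log f(x)\,dx$ is finite. Let $K:\mathbb{R}\to\mathbb{R}$ be a kernel with $\int_{\mathbb{R}} K(u)\,du = 1$, let $\{h_n\}$ be positive bandwidths, and let $f_n(x) = \frac{1}{nh_n}\sum_{i=1}^n K\big(\frac{x-X_i}{h_n}\big)$ be the kernel density estimator. Assume: (B.1) $h_n \asymp (n^{-1}\log n)^{1/5}$; (K.1) $K$ is bounded, has bounded support, and is Hölder continuous of some order $\iota \in (0,1]$; (K.2) $\int u K(u)\,du = 0$; (D.1) $f_\varepsilon, f_\varepsilon', f_\varepsilon''$ are bounded (belong to $\mathcal{L}^\infty(\mathbb{R})$); (D.2) $f_\varepsilon, f_\varepsilon', f_\varepsilon'' \in \mathcal{L}^2(\mathbb{R})$; (D.3) $f''$ is bounded. Let $\{\gamma_n\}$ be a sequence of positive reals with $\gamma_n \to 0$ and $h_n = o(\gamma_n)$. Define the random sets $A_n = \{x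 \in \mathbb{R} : 0 < \gamma_n \le f_n(x)\}$ and the estimator $S_n(f) = -\int_{A_n} f_n(x)\log f_n(x)\,dx$. Then, almost surely, $$\limsup_{n\to\infty} \Big(\frac{n\gamma_n^5}{\log n}\Big)^{2/5}\,\Big| S_n(f) - \int_{A_n} \big(-\log f(x)\big) f(x)\,dx\Big| < \infty.$$
   Context: $a_n \asymp b_n$ means $0<\liminf a_n/b_n \le \limsup a_n/b_n<\infty$. Hölder continuity of order $\iota$ means there is $C$ with $|K(x)-K(x')|\le C|x-x'|^\iota$ for all $x,x'$. *)

theory Defs
  imports "HOL-Probability.Probability" "HOL-Library.Landau_Symbols"
begin

definition asymp_eq :: "(nat \<Rightarrow> real) \<Rightarrow> (nat \<Rightarrow> real) \<Rightarrow> bool" where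
  "asymp_eq a b \<longleftrightarrow>
     0 < liminf (\<lambda>n. ereal (a n / b n)) \<and> limsup (\<lambda>n. ereal (a n / b n)) < \<infinity>"

definition lin_proc :: "(nat \<Rightarrow> real) \<Rightarrow> (int \<Rightarrow> 'a \<Rightarrow> real) \<Rightarrow> nat \<Rightarrow> 'a \<Rightarrow> real" where
  "lin_proc a eps n \<omega> = (\<Sum>i. a i * eps (int n - int i) \<omega>)"

definition kde :: "(real \<Rightarrow> real) \<Rightarrow> (nat \<Rightarrow> real) \<Rightarrow> (nat \<Rightarrow> 'a \<Rightarrow> real) \<Rightarrow> nat \<Rightarrow> 'a \<Rightarrow> real \<Rightarrow> real" where
  "kde K h X n \<omega> x = (1 / (real n * h n)) * (\<Sum>i=1..n. K ((x - X i \<omega>) / h n))"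

definition trunc_set :: "(real \<Rightarrow> real) \<Rightarrow> (nat \<Rightarrow> real) \<Rightarrow> (nat \<Rightarrow> 'a \<Rightarrow> real) \<Rightarrow> (nat \<Rightarrow> real) \<Rightarrow> nat \<Rightarrow> 'a \<Rightarrow> real set" where
  "trunc_set K h X \<gamma> n \<omega> = {x. 0 < \<gamma> n \<and> \<gamma> n \<le> kde K h X n \<omega> x}"

definition entropy_est :: "(real \<Rightarrow> real) \<Rightarrow> (nat \<Rightarrow> real) \<Rightarrow> (nat \<Rightarrow> 'a \<Rightarrow> real) \<Rightarrow> (nat \<Rightarrow> real) \<Rightarrow> nat \<Rightarrow> 'a \<Rightarrow> real" where
  "entropy_est K h X \<gamma> n \<omega> =
     - (LINT x : trunc_set K h X \<gamma> n \<omega> | lborel. kde K h X n \<omega> x * ln (kde K h X n \<omega> x))"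

end

theory Submission
  imports Defs "HOL-Real_Asymp.Real_Asymp"
begin

text \<open>
  Only the \<open>L\<^sup>2\<close> error of the kernel estimator matters. On the truncation set, whose Lebesgue
  measure is at most \<open>\<parallel>K\<parallel>\<^sub>1 / \<gamma>\<^sub>n\<close>, the map \<open>t \<mapsto> t ln t\<close> has difference quotients of order
  \<open>1 + \<bar>ln \<gamma>\<^sub>n\<bar>\<close> at points above \<open>\<gamma>\<^sub>n\<close>, so an \<open>L\<^sup>2\<close> error of order
  \<open>\<delta>\<^sub>n = (ln n / n)\<^bsup>2/5\<^esup>\<close> gives an entropy error of order \<open>\<delta>\<^sub>n (1 + \<bar>ln \<gamma>\<^sub>n\<bar>) / \<gamma>\<^sub>n\<close>.

  Let \<open>X\<^sub>i = a\<^sub>0 \<epsilon>\<^sub>i + Y\<^sub>i\<close> with \<open>Y\<^sub>i\<close> a function of the past and let \<open>\<phi>\<close> be the density of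
  \<open>a\<^sub>0 \<epsilon>\<^sub>i\<close>. The error splits into the bias, of order \<open>h\<^sub>n\<^sup>2\<close> by Taylor expansion; a martingale
  with increments bounded in \<open>L\<^sup>2\<close>, whose squared norm has exponential moments (Hoeffding's lemma applied
  to the inner product of each increment with the preceding sum), so that Borel--Cantelli gives the rate
  \<open>ln n / (n h\<^sub>n)\<close>; and the \<open>K\<close>-smoothing of \<open>\<Sum>\<^sub>i \<phi>(x - Y\<^sub>i) - f(x)\<close>. The expected squared norm of
  the latter over a block of length \<open>L\<close> is \<open>O(L)\<close>, by integrating out one innovation at a time as in the
  Efron--Stein inequality, and dyadic chaining makes it almost surely \<open>O(n\<^bsup>6/5\<^esup>)\<close>.
\<close>

section \<open>Elementary inequalities\<close>

text \<open>With \<open>r = (ln n / n) powr (1/5)\<close> the normalising factor of the theorem is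
  (\<gamma>/r)^2. The entropy error is of order r^2 (1 + |ln \<gamma>|) / \<gamma>, so the product
  is of order \<gamma> (1 + |ln \<gamma>|): a whole factor \<gamma> is left to absorb the logarithm.
  The target for every squared L^2 norm is r^4. For h of order r one has ln n / (n h) = r^5 / h, and
  n^(6/5) / n^2 = n^(-4/5) <= r^4, which is where 6/5 comes from. The bias stays a uniform bound,
  paid for only on a set of measure O(1/\<gamma>). The obstacle is that the observations share an
  infinite past. Given all innovations before the newest one, the density of an observation is a
  translate of \<phi>. Kernel terms minus their conditional means are martingale differences with
  squared norm O(h), whereas the conditional means depend on the past only through translates of
  \<phi>, whose L^2 distance is Lipschitz in the shift. Summable coefficients let each innovation
  influence a block by a bounded total amount, hence linear growth of the variance.\<close>

text \<open>The difference is u - v times the logarithm of the larger point, plus the smaller point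
  times a difference of logarithms; the latter product is at most |u - v| by ln t <= t - 1. Only the
  logarithm at a point above \<open>g\<close> is evaluated, so \<open>v\<close> may be arbitrarily
  small. The extra |u - v| in the bound stands in for an upper bound on \<open>u\<close>.\<close>

lemma abs_mult_ln_diff_le:
  fixes u v g B :: real
  assumes "0 < g" "g \<le> u" "0 \<le> v" "v \<le> B"
  shows "\<bar>u * ln u - v * ln v\<bar> \<le> \<bar>u - v\<bar> * (1 + B + \<bar>ln g\<bar> + \<bar>u - v\<bar>)"
proof -
  have u: "0 < u" using assms by simp
  have lb: "\<bar>ln t\<bar> \<le> \<bar>ln g\<bar> + t" if "g \<le> t" for t
  proof -
    have "ln g \<le> ln t" using that assms by simp
    moreover have "ln t \<le> t - 1" using that assms by (intro ln_le_minus_one) auto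
    ultimately show ?thesis using that assms by linarith
  qed
  have est: "y * \<bar>ln y - ln x\<bar> \<le> x - y" if "0 < y" "y \<le> x" for x y :: real
  proof -
    have "ln (x / y) \<le> x / y - 1" using that by (intro ln_le_minus_one) auto
    then have "y * ln (x / y) \<le> y * (x / y - 1)" using that by (intro mult_left_mono) auto
    moreover have "y * (x / y - 1) = x - y" using that by (simp add: field_simps)
    moreover have "\<bar>ln y - ln x\<bar> = ln (x / y)" using that by (simp add: ln_div)
    ultimately show ?thesis by simp
  qed
  \<comment> \<open>\<open>est\<close> needs both points positive; for \<open>v = 0\<close> the
    second product vanishes.\<close>
  consider "v = 0" | "0 < v" "v \<le> u" | "u < v" using assms by linarith
  then show ?thesis
  proof cases
    case 1
    have "u * \<bar>ln u\<bar> \<le> u * (1 + B + \<bar>ln g\<bar> + u)"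
      using lb[of u] assms u by (intro mult_left_mono) auto
    then show ?thesis using 1 u by (simp add: abs_mult)
  next
    case 2
    have "u * ln u - v * ln v = (u - v) * ln u - v * (ln v - ln u)" by (simp add: algebra_simps)
    also have "\<bar>\<dots>\<bar> \<le> \<bar>u - v\<bar> * \<bar>ln u\<bar> + v * \<bar>ln v - ln u\<bar>"
      using 2 by (intro order_trans[OF abs_triangle_ineq4]) (simp add: abs_mult)
    also have "\<dots> \<le> \<bar>u - v\<bar> * (\<bar>ln g\<bar> + u) + \<bar>u - v\<bar>"
      using lb[of u] est[of v u] 2 assms by (intro add_mono mult_left_mono) auto
    also have "\<dots> = \<bar>u - v\<bar> * (1 + \<bar>ln g\<bar> + u)" by (simp add: algebra_simps)
    also have "\<dots> \<le> \<bar>u - v\<bar> * (1 + B + \<bar>ln g\<bar> + \<bar>u - v\<bar>)"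
      using assms 2 by (intro mult_left_mono) auto
    finally show ?thesis .
  next
    case 3
    have "u * ln u - v * ln v = (u - v) * ln v + u * (ln u - ln v)" by (simp add: algebra_simps)
    also have "\<bar>\<dots>\<bar> \<le> \<bar>u - v\<bar> * \<bar>ln v\<bar> + u * \<bar>ln u - ln v\<bar>"
      using u by (intro order_trans[OF abs_triangle_ineq]) (simp add: abs_mult)
    also have "\<dots> \<le> \<bar>u - v\<bar> * (\<bar>ln g\<bar> + B) + \<bar>u - v\<bar>"
      using lb[of v] est[of u v] 3 u assms by (intro add_mono mult_left_mono) auto
    also have "\<dots> = \<bar>u - v\<bar> * (1 + \<bar>ln g\<bar> + B)" by (simp add: algebra_simps)
    also have "\<dots> \<le> \<bar>u - v\<bar> * (1 + B + \<bar>ln g\<bar> + \<bar>u - v\<bar>)"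
      by (intro mult_left_mono) auto
    finally show ?thesis .
  qed
qed

section \<open>Partial sums controlled by dyadic blocks\<close>

text \<open>The sum of the squared sums of \<open>z\<close> over all dyadic blocks inside \<open>[s, s + 2\<^sup>k)\<close>.\<close>

fun dyadic_energy :: "(nat \<Rightarrow> real) \<Rightarrow> nat \<Rightarrow> nat \<Rightarrow> real" where
  "dyadic_energy z 0 s = (z s)\<^sup>2"
| "dyadic_energy z (Suc k) s =
     dyadic_energy z k s + dyadic_energy z k (s + 2 ^ k) + (\<Sum>i\<in>{s..<s + 2 ^ Suc k}. z i)\<^sup>2"

lemma dyadic_energy_nonneg: "0 \<le> dyadic_energy z k s"
  by (induction k arbitrary: s) auto

lemma block_le_dyadic_energy: "(\<Sum>i\<in>{s..<s + 2 ^ k}. z i)\<^sup>2 \<le> dyadic_energy z k s"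
  by (cases k) (auto simp: dyadic_energy_nonneg)

text \<open>The Rademacher-Menshov device: an initial piece of a dyadic interval is a disjoint union
  of blocks, at most one per level, so Cauchy-Schwarz over the \<open>Suc k\<close> levels loses
  only this factor.\<close>

lemma partial_sum_le_dyadic_energy:
  assumes "m \<le> 2 ^ k"
  shows "(\<Sum>i\<in>{s..<s + m}. z i)\<^sup>2 \<le> real (Suc k) * dyadic_energy z k s"
  using assms
proof (induction k arbitrary: m s)
  case 0
  then have "m = 0 \<or> m = 1" by auto
  then show ?case by auto
next
  case (Suc k)
  let ?E = "dyadic_energy z"
  show ?case
  proof (cases "m \<le> 2 ^ k")
    case True
    have "(\<Sum>i\<in>{s..<s + m}. z i)\<^sup>2 \<le> real (Suc k) * ?E k s" using Suc.IH True .
    also have "\<dots> \<le> real (Suc (Suc k)) * ?E (Suc k) s"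
      using dyadic_energy_nonneg[of z k] by (intro mult_mono) (auto intro: add_nonneg_nonneg)
    finally show ?thesis .
  next
    case False
    define r where "r = m - 2 ^ k"
    have r: "m = 2 ^ k + r" "r \<le> 2 ^ k" using False Suc.prems by (auto simp: r_def)
    define b where "b = (\<Sum>i\<in>{s..<s + 2 ^ k}. z i)"
    define c where "c = (\<Sum>i\<in>{s + 2 ^ k..<s + 2 ^ k + r}. z i)"
    have sum: "(\<Sum>i\<in>{s..<s + m}. z i) = b + c"
      unfolding b_def c_def r by (subst sum.atLeastLessThan_concat) (auto simp: add.assoc)
    have b: "b\<^sup>2 \<le> ?E k s" unfolding b_def by (rule block_le_dyadic_energy)
    have c: "c\<^sup>2 \<le> real (Suc k) * ?E k (s + 2 ^ k)" unfolding c_def using Suc.IH r(2) .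
    \<comment> \<open>Cauchy-Schwarz with weights 1 and \<open>Suc k\<close>: (b + c)^2 is at most
      (k + 2) (b^2 + c^2/(k + 1)). The division cancels the factor that the induction hypothesis
      puts on \<open>c\<close>.\<close>
    have "0 \<le> (real (Suc k) * b - c)\<^sup>2 / real (Suc k)" by simp
    also have "\<dots> = real (Suc k) * b\<^sup>2 - 2 * b * c + c\<^sup>2 / real (Suc k)"
      by (simp add: power2_eq_square field_simps)
    finally have "(b + c)\<^sup>2 \<le> real (Suc (Suc k)) * (b\<^sup>2 + c\<^sup>2 / real (Suc k))"
      by (simp add: power2_eq_square field_simps)
    also have "\<dots> \<le> real (Suc (Suc k)) * (?E k s + ?E k (s + 2 ^ k))"
      using b c by (intro mult_left_mono add_mono) (auto simp: field_simps)
    also have "\<dots> \<le> real (Suc (Suc k)) * ?E (Suc k) s"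
      by (intro mult_left_mono) auto
    finally show ?thesis unfolding sum .
  qed
qed

section \<open>Second moments on a probability space\<close>

text \<open>E(G - m)^2 is the variance plus (E G - m)^2, and the variance is the least second moment
  over all centres \<open>c\<close>. The free centre lets a deterministic reference value replace
  the independent copy of the Efron-Stein inequality.\<close>

lemma (in prob_space) second_moment_le:
  fixes G :: "'a \<Rightarrow> real"
  assumes [measurable]: "G \<in> borel_measurable M" and bd: "\<And>v. \<bar>G v\<bar> \<le> B"
  shows "(\<integral>\<^sup>+v. ennreal ((G v - m)\<^sup>2) \<partial>M)
          \<le> (\<integral>\<^sup>+v. ennreal ((G v - c)\<^sup>2) \<partial>M) + ennreal ((expectation G - m)\<^sup>2)"
proof -
  have i: "integrable M G" using bd by (intro integrable_const_bound[where B=B]) auto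
  have i2: "integrable M (\<lambda>v. (G v - x)\<^sup>2)" for x
  proof (rule integrable_const_bound[where B="(B + \<bar>x\<bar>)\<^sup>2"])
    show "AE v in M. norm ((G v - x)\<^sup>2) \<le> (B + \<bar>x\<bar>)\<^sup>2"
    proof (intro always_eventually allI)
      fix v have "\<bar>G v - x\<bar> \<le> B + \<bar>x\<bar>" using bd[of v] by linarith
      then have "\<bar>G v - x\<bar>\<^sup>2 \<le> (B + \<bar>x\<bar>)\<^sup>2" by (intro power_mono) auto
      then show "norm ((G v - x)\<^sup>2) \<le> (B + \<bar>x\<bar>)\<^sup>2" by simp
    qed
  qed auto
  have eq: "expectation (\<lambda>v. (G v - x)\<^sup>2) = expectation (\<lambda>v. (G v)\<^sup>2) - 2 * x * expectation G + x\<^sup>2" for x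
  proof -
    have "expectation (\<lambda>v. (G v - x)\<^sup>2) = expectation (\<lambda>v. (G v)\<^sup>2 - 2 * x * G v + x\<^sup>2)"
      by (simp add: power2_eq_square algebra_simps)
    also have "\<dots> = expectation (\<lambda>v. (G v)\<^sup>2) - 2 * x * expectation G + x\<^sup>2"
      using i i2[of 0] by (simp add: prob_space)
    finally show ?thesis .
  qed
  have "0 \<le> (expectation G - c)\<^sup>2" by simp
  then have "expectation (\<lambda>v. (G v - m)\<^sup>2) \<le> expectation (\<lambda>v. (G v - c)\<^sup>2) + (expectation G - m)\<^sup>2"
    unfolding eq by (simp add: power2_eq_square algebra_simps)
  then show ?thesis using i2
    by (simp add: nn_integral_eq_integral ennreal_plus[symmetric] ennreal_leI del: ennreal_plus)
qed

text \<open>Jensen's inequality. A non-integrable \<open>G\<close> has expectation 0 by convention,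
  so it is covered too.\<close>

lemma (in prob_space) square_expectation_le:
  fixes G :: "'a \<Rightarrow> real"
  assumes [measurable]: "G \<in> borel_measurable M"
  shows "ennreal ((expectation G)\<^sup>2) \<le> (\<integral>\<^sup>+v. ennreal ((G v)\<^sup>2) \<partial>M)"
proof -
  have "ennreal \<bar>expectation G\<bar> \<le> (\<integral>\<^sup>+v. ennreal \<bar>G v\<bar> \<partial>M)"
    using integral_norm_bound_ennreal[of M G] integral_norm_bound[of M G]
    by (cases "integrable M G") (auto simp: not_integrable_integral_eq)
  then have "(ennreal \<bar>expectation G\<bar>)\<^sup>2 \<le> (\<integral>\<^sup>+v. ennreal \<bar>G v\<bar> \<partial>M)\<^sup>2"
    by (rule power_mono) auto
  also have "\<dots> \<le> (\<integral>\<^sup>+v. (ennreal \<bar>G v\<bar>)\<^sup>2 \<partial>M)"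
    using Cauchy_Schwarz_nn_integral[of "\<lambda>v. ennreal \<bar>G v\<bar>" M "\<lambda>_. 1"] by (simp add: emeasure_space_1)
  finally show ?thesis by (simp add: ennreal_power)
qed

section \<open>Independent innovations and linear processes\<close>

locale iid_innovations = prob_space M for M :: "'a measure" +
  fixes eps :: "int \<Rightarrow> 'a \<Rightarrow> real" and law :: "real measure"
  assumes indep: "indep_vars (\<lambda>_. borel) eps UNIV"
    and distr_eps: "\<And>i. distr M borel (eps i) = law"
    and square_integrable_law: "integrable law (\<lambda>v. v\<^sup>2)"
begin

lemma eps_measurable [measurable]: "eps i \<in> borel_measurable M"
  using indep by (auto simp: indep_vars_def)

lemma sets_law [simp, measurable_cong]: "sets law = sets borel"
  by (metis distr_eps sets_distr)

lemma space_law [simp]: "space law = UNIV"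
  by (metis distr_eps space_distr space_borel)

lemma prob_space_law: "prob_space law"
  using prob_space_distr[OF eps_measurable, of 0] by (simp add: distr_eps)

lemma emeasure_law_UNIV [simp]: "emeasure law UNIV = 1"
  using prob_space.emeasure_space_1[OF prob_space_law] by simp

text \<open>Sigma-algebra of the innovations strictly before time \<open>p\<close>. As a measure it
  carries no mass of its own; only its measurable sets matter, and the restriction of
  \<open>M\<close> to it is \<open>distr M (past p) (\<lambda>\<omega>. \<omega>)\<close>.\<close>

definition past :: "int \<Rightarrow> 'a measure" where
  "past p = vimage_algebra (space M) (\<lambda>\<omega>. \<lambda>j\<in>{..<p}. eps j \<omega>) (PiM {..<p} (\<lambda>_. borel))"

lemma space_past [simp]: "space (past p) = space M"
  by (simp add: past_def)

lemma eps_measurable_past: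
  assumes "j < p" shows "eps j \<in> borel_measurable (past p)"
proof -
  have "(\<lambda>\<omega>. \<lambda>j\<in>{..<p}. eps j \<omega>) \<in> past p \<rightarrow>\<^sub>M PiM {..<p} (\<lambda>_. borel)"
    unfolding past_def by (rule measurable_vimage_algebra1) (auto simp: space_PiM)
  from measurable_compose[OF this measurable_component_singleton[of j]] assms
  show ?thesis by simp
qed

lemma sets_past:
  "sets (past p) = {(\<lambda>\<omega>. \<lambda>j\<in>{..<p}. eps j \<omega>) -` A \<inter> space M | A. A \<in> sets (PiM {..<p} (\<lambda>_. borel))}"
  unfolding past_def by (rule sets_vimage_algebra2) (auto simp: space_PiM)

lemma subalgebra_past: "subalgebra M (past p)"
proof -
  have "(\<lambda>\<omega>. \<lambda>j\<in>{..<p}. eps j \<omega>) \<in> M \<rightarrow>\<^sub>M PiM {..<p} (\<lambda>_. borel)" by measurable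
  then show ?thesis unfolding subalgebra_def sets_past by (auto intro: measurable_sets)
qed

text \<open>Independence of \<open>eps p\<close> from everything before it, in the form of a product
  law. Agreement on rectangles suffices, and there it is the product rule for independent groups of
  innovations.\<close>

lemma past_pair_distr:
  "distr M (past p) (\<lambda>\<omega>. \<omega>) \<Otimes>\<^sub>M law = distr M (past p \<Otimes>\<^sub>M borel) (\<lambda>\<omega>. (\<omega>, eps p \<omega>))"
proof (rule pair_measure_eqI)
  let ?W = "\<lambda>\<omega>. \<lambda>j\<in>{..<p}. eps j \<omega>" and ?V = "\<lambda>\<omega>. \<lambda>j\<in>{p}. eps j \<omega>"
  have id: "(\<lambda>\<omega>. \<omega>) \<in> M \<rightarrow>\<^sub>M past p"
    using measurable_from_subalg[OF subalgebra_past measurable_ident_sets[OF refl]] .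
  have pair: "(\<lambda>\<omega>. (\<omega>, eps p \<omega>)) \<in> M \<rightarrow>\<^sub>M past p \<Otimes>\<^sub>M borel"
    using id by (intro measurable_Pair) auto
  interpret law: prob_space law by (rule prob_space_law)
  interpret P: prob_space "distr M (past p) (\<lambda>\<omega>. \<omega>)" by (rule prob_space_distr[OF id])
  show "sigma_finite_measure law" "sigma_finite_measure (distr M (past p) (\<lambda>\<omega>. \<omega>))" ..
  show "sets (distr M (past p) (\<lambda>\<omega>. \<omega>) \<Otimes>\<^sub>M law) = sets (distr M (past p \<Otimes>\<^sub>M borel) (\<lambda>\<omega>. (\<omega>, eps p \<omega>)))"
    unfolding sets_distr by (intro sets_pair_measure_cong) auto
  fix A B assume A: "A \<in> sets (distr M (past p) (\<lambda>\<omega>. \<omega>))" and B: "B \<in> sets law"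
  from A obtain A' where A': "A = ?W -` A' \<inter> space M" "A' \<in> sets (PiM {..<p} (\<lambda>_. borel))"
    unfolding sets_distr sets_past by auto
  have B' [measurable]: "B \<in> sets borel" using B by simp
  \<comment> \<open>The grouping theorem speaks of restricted families, so \<open>eps p\<close> is
    treated as a family over \<open>{p}\<close> and \<open>B\<close> is lifted to that
    one-coordinate space.\<close>
  define B'' where "B'' = (\<lambda>w. w p) -` B \<inter> space (PiM {p} (\<lambda>_. borel :: real measure))"
  have B''s: "B'' \<in> sets (PiM {p} (\<lambda>_. borel))" unfolding B''_def by measurable
  have VB: "?V -` B'' \<inter> space M = eps p -` B \<inter> space M"
    by (auto simp: B''_def space_PiM)
  have ind: "indep_var (PiM {..<p} (\<lambda>_. borel)) ?W (PiM {p} (\<lambda>_. borel)) ?V"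
    by (rule indep_var_restrict[OF indep]) auto
  have eqs: "(\<lambda>\<omega>. (?W \<omega>, ?V \<omega>)) -` (A' \<times> B'') \<inter> space M = A \<inter> eps p -` B"
    using VB unfolding A'(1) by blast
  have "prob (A \<inter> eps p -` B) = prob A * prob (eps p -` B \<inter> space M)"
    using indep_varD[OF ind A'(2) B''s] unfolding VB eqs A'(1)[symmetric] .
  moreover have AM: "A \<in> sets M" using A subalgebra_past[of p] by (auto simp: subalgebra_def)
  moreover have "A \<inter> space M = A" using AM sets.sets_into_space by blast
  moreover have Avim: "(\<lambda>\<omega>. (\<omega>, eps p \<omega>)) -` (A \<times> B) \<inter> space M = A \<inter> eps p -` B"
    using AM sets.sets_into_space by blast
  ultimately show "emeasure (distr M (past p) (\<lambda>\<omega>. \<omega>)) A * emeasure law B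
      = emeasure (distr M (past p \<Otimes>\<^sub>M borel) (\<lambda>\<omega>. (\<omega>, eps p \<omega>))) (A \<times> B)"
    using A id pair B' Avim
    by (simp add: distr_eps[of p, symmetric] emeasure_distr emeasure_eq_measure ennreal_mult[symmetric])
qed

text \<open>Takes the place of conditional expectation: a function of the past and of
  \<open>eps p\<close> may be averaged over \<open>eps p\<close> with the past frozen. For
  nonnegative integrands this is Tonelli on the product law.\<close>

lemma nn_integral_past:
  fixes G :: "'a \<Rightarrow> real \<Rightarrow> ennreal"
  assumes "case_prod G \<in> borel_measurable (past p \<Otimes>\<^sub>M borel)"
  shows "(\<integral>\<^sup>+\<omega>. G \<omega> (eps p \<omega>) \<partial>M) = (\<integral>\<^sup>+\<omega>. (\<integral>\<^sup>+v. G \<omega> v \<partial>law) \<partial>M)"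
proof -
  interpret law: prob_space law by (rule prob_space_law)
  have id: "(\<lambda>\<omega>. \<omega>) \<in> M \<rightarrow>\<^sub>M past p"
    using measurable_from_subalg[OF subalgebra_past measurable_ident_sets[OF refl]] .
  have pair: "(\<lambda>\<omega>. (\<omega>, eps p \<omega>)) \<in> M \<rightarrow>\<^sub>M past p \<Otimes>\<^sub>M borel"
    using id by (intro measurable_Pair) auto
  have G': "case_prod G \<in> borel_measurable (past p \<Otimes>\<^sub>M law)"
    using assms by (simp cong: measurable_cong_sets add: measurable_cong_sets[OF sets_pair_measure_cong[OF refl sets_law] refl])
  have G'': "case_prod G \<in> borel_measurable (distr M (past p) (\<lambda>\<omega>. \<omega>) \<Otimes>\<^sub>M law)"
    using assms by (simp add: measurable_cong_sets[OF sets_pair_measure_cong[OF sets_distr sets_law] refl])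
  note eq = past_pair_distr[of p]
  have "(\<integral>\<^sup>+\<omega>. G \<omega> (eps p \<omega>) \<partial>M) = (\<integral>\<^sup>+z. case_prod G z \<partial>distr M (past p \<Otimes>\<^sub>M borel) (\<lambda>\<omega>. (\<omega>, eps p \<omega>)))"
    using pair assms by (subst nn_integral_distr) auto
  also have "\<dots> = (\<integral>\<^sup>+\<omega>. (\<integral>\<^sup>+v. G \<omega> v \<partial>law) \<partial>distr M (past p) (\<lambda>\<omega>. \<omega>))"
    unfolding eq[symmetric] by (subst law.nn_integral_fst[OF G'', symmetric]) simp
  also have "\<dots> = (\<integral>\<^sup>+\<omega>. (\<integral>\<^sup>+v. G \<omega> v \<partial>law) \<partial>M)"
    using law.borel_measurable_nn_integral_fst[OF G'] id by (subst nn_integral_distr) auto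
  finally show ?thesis .
qed

lemma nn_integral_eps:
  assumes [measurable]: "G \<in> borel_measurable borel"
  shows "(\<integral>\<^sup>+\<omega>. G (eps i \<omega>) \<partial>M) = (\<integral>\<^sup>+v. G v \<partial>law)"
  unfolding distr_eps[of i, symmetric] by (subst nn_integral_distr) auto

section \<open>Linear processes in the innovations\<close>

definition s2 :: real where "s2 = (\<integral>v. v\<^sup>2 \<partial>law)"

lemma s2_nonneg: "0 \<le> s2"
  unfolding s2_def by simp

lemma nn_integral_law_square: "(\<integral>\<^sup>+v. ennreal (v\<^sup>2) \<partial>law) = ennreal s2"
  unfolding s2_def using square_integrable_law by (intro nn_integral_eq_integral) auto

text \<open>Coefficients and time are free parameters because removing the newest innovation shifts
  both. Where the series diverges the value is an unspecified default, so splitting it is justified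
  only almost everywhere.\<close>

definition lin :: "(nat \<Rightarrow> real) \<Rightarrow> int \<Rightarrow> 'a \<Rightarrow> real" where
  "lin b p \<omega> = (\<Sum>k. b k * eps (p - int k) \<omega>)"

lemma lin_measurable_past: "p < q \<Longrightarrow> lin b p \<in> borel_measurable (past q)"
  unfolding lin_def[abs_def] by (intro borel_measurable_suminf borel_measurable_times eps_measurable_past) auto

lemma lin_measurable [measurable]: "lin b p \<in> borel_measurable M"
  unfolding lin_def[abs_def] by measurable

text \<open>Cauchy-Schwarz with weights \<open>\<bar>b k\<bar>\<close>, carried out for extended
  nonnegative sums so that no convergence is presupposed. It yields both almost sure absolute
  convergence and the second moment bound.\<close>

lemma nn_integral_weighted_square_sum:
  assumes "summable (\<lambda>k. \<bar>b k\<bar>)"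
  shows "(\<integral>\<^sup>+\<omega>. (\<Sum>k. ennreal \<bar>b k * eps (p - int k) \<omega>\<bar>)\<^sup>2 \<partial>M) \<le> ennreal (s2 * (\<Sum>k. \<bar>b k\<bar>)\<^sup>2)"
proof -
  let ?A = "\<Sum>k. \<bar>b k\<bar>"
  have A: "(\<Sum>k. ennreal \<bar>b k\<bar>) = ennreal ?A" using assms by (intro suminf_ennreal2) auto
  have cs: "(\<Sum>k. ennreal \<bar>b k * e k\<bar>)\<^sup>2 \<le> ennreal ?A * (\<Sum>k. ennreal (\<bar>b k\<bar> * (e k)\<^sup>2))" for e :: "nat \<Rightarrow> real"
  proof -
    have "(\<Sum>k. ennreal \<bar>b k * e k\<bar>)\<^sup>2 =
        (\<integral>\<^sup>+k. ennreal (sqrt \<bar>b k\<bar>) * ennreal (sqrt \<bar>b k\<bar> * \<bar>e k\<bar>) \<partial>count_space UNIV)\<^sup>2"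
      by (simp add: nn_integral_count_space_nat ennreal_mult[symmetric] mult.assoc[symmetric] abs_mult)
    also have "\<dots> \<le> (\<integral>\<^sup>+k. (ennreal (sqrt \<bar>b k\<bar>))\<^sup>2 \<partial>count_space UNIV) *
        (\<integral>\<^sup>+k. (ennreal (sqrt \<bar>b k\<bar> * \<bar>e k\<bar>))\<^sup>2 \<partial>count_space UNIV)"
      by (rule Cauchy_Schwarz_nn_integral) auto
    also have "\<dots> = ennreal ?A * (\<Sum>k. ennreal (\<bar>b k\<bar> * (e k)\<^sup>2))"
      by (simp add: nn_integral_count_space_nat ennreal_power power_mult_distrib A)
    finally show ?thesis .
  qed
  have "(\<integral>\<^sup>+\<omega>. (\<Sum>k. ennreal \<bar>b k * eps (p - int k) \<omega>\<bar>)\<^sup>2 \<partial>M)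
      \<le> (\<integral>\<^sup>+\<omega>. ennreal ?A * (\<Sum>k. ennreal (\<bar>b k\<bar> * (eps (p - int k) \<omega>)\<^sup>2)) \<partial>M)"
    by (intro nn_integral_mono cs)
  also have "\<dots> = ennreal ?A * (\<Sum>k. (\<integral>\<^sup>+\<omega>. ennreal (\<bar>b k\<bar> * (eps (p - int k) \<omega>)\<^sup>2) \<partial>M))"
    by (simp add: nn_integral_cmult nn_integral_suminf)
  also have "\<dots> = ennreal ?A * (\<Sum>k. ennreal \<bar>b k\<bar> * ennreal s2)"
    using nn_integral_eps[of "\<lambda>v. ennreal (v\<^sup>2)"]
    by (simp add: ennreal_mult nn_integral_cmult nn_integral_law_square)
  also have "\<dots> = ennreal (s2 * ?A\<^sup>2)"
    unfolding ennreal_suminf_multc A using suminf_nonneg[OF assms] s2_nonneg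
    by (simp add: ennreal_mult[symmetric] power2_eq_square mult_ac)
  finally show ?thesis .
qed

lemma AE_summable_lin:
  assumes "summable (\<lambda>k. \<bar>b k\<bar>)"
  shows "AE \<omega> in M. summable (\<lambda>k. \<bar>b k * eps (p - int k) \<omega>\<bar>)"
proof -
  have "(\<integral>\<^sup>+\<omega>. (\<Sum>k. ennreal \<bar>b k * eps (p - int k) \<omega>\<bar>)\<^sup>2 \<partial>M) < \<infinity>"
    using nn_integral_weighted_square_sum[OF assms] by (rule le_less_trans) simp
  then have "AE \<omega> in M. (\<Sum>k. ennreal \<bar>b k * eps (p - int k) \<omega>\<bar>)\<^sup>2 \<noteq> \<infinity>"
    by (intro nn_integral_PInf_AE) auto
  then show ?thesis
    by eventually_elim (auto intro!: summable_suminf_not_top simp: power2_eq_square ennreal_mult_eq_top_iff)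
qed

text \<open>The recursion behind every induction on innovations; almost sure absolute convergence is
  what allows the first term to be split off.\<close>

lemma AE_lin_Suc:
  assumes "summable (\<lambda>k. \<bar>b k\<bar>)"
  shows "AE \<omega> in M. lin b p \<omega> = b 0 * eps p \<omega> + lin (\<lambda>k. b (Suc k)) (p - 1) \<omega>"
  using AE_summable_lin[OF assms, of p]
proof eventually_elim
  case (elim \<omega>)
  have "(\<Sum>k. b (Suc k) * eps (p - int (Suc k)) \<omega>) = lin b p \<omega> - b 0 * eps p \<omega>"
    using suminf_split_head[OF summable_rabs_cancel[OF elim]] unfolding lin_def by simp
  then show ?case unfolding lin_def by (simp add: diff_diff_eq)
qed

lemma nn_integral_lin_square:
  assumes "summable (\<lambda>k. \<bar>b k\<bar>)"
  shows "(\<integral>\<^sup>+\<omega>. ennreal ((lin b p \<omega>)\<^sup>2) \<partial>M) \<le> ennreal (s2 * (\<Sum>k. \<bar>b k\<bar>)\<^sup>2)"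
proof -
  have "(\<integral>\<^sup>+\<omega>. ennreal ((lin b p \<omega>)\<^sup>2) \<partial>M)
      \<le> (\<integral>\<^sup>+\<omega>. (\<Sum>k. ennreal \<bar>b k * eps (p - int k) \<omega>\<bar>)\<^sup>2 \<partial>M)"
  proof (rule nn_integral_mono_AE)
    show "AE \<omega> in M. ennreal ((lin b p \<omega>)\<^sup>2) \<le> (\<Sum>k. ennreal \<bar>b k * eps (p - int k) \<omega>\<bar>)\<^sup>2"
      using AE_summable_lin[OF assms, of p]
    proof eventually_elim
      case (elim \<omega>)
      have "\<bar>lin b p \<omega>\<bar> \<le> (\<Sum>k. \<bar>b k * eps (p - int k) \<omega>\<bar>)"
        unfolding lin_def using elim by (rule summable_rabs)
      then have "ennreal \<bar>lin b p \<omega>\<bar> \<le> (\<Sum>k. ennreal \<bar>b k * eps (p - int k) \<omega>\<bar>)"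
        using elim by (subst suminf_ennreal2) (auto intro: ennreal_leI)
      then have "(ennreal \<bar>lin b p \<omega>\<bar>)\<^sup>2 \<le> (\<Sum>k. ennreal \<bar>b k * eps (p - int k) \<omega>\<bar>)\<^sup>2"
        by (rule power_mono) auto
      then show ?case by (simp add: ennreal_power)
    qed
  qed
  also note nn_integral_weighted_square_sum[OF assms]
  finally show ?thesis .
qed

text \<open>Valid at every sample point: one series converges to \<open>s\<close> exactly when the
  other does, so even the default values for divergent series agree.\<close>

lemma lin_drop_zeros:
  assumes "\<And>k. k < d \<Longrightarrow> b k = 0"
  shows "lin b p \<omega> = lin (\<lambda>k. b (k + d)) (p - int d) \<omega>"
proof -
  have "(\<lambda>k. b k * eps (p - int k) \<omega>) sums s \<longleftrightarrow> (\<lambda>k. b (k + d) * eps (p - int d - int k) \<omega>) sums s" for s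
  proof -
    have "(\<lambda>k. b k * eps (p - int k) \<omega>) sums s \<longleftrightarrow>
        (\<lambda>k. b (k + d) * eps (p - int (k + d)) \<omega>) sums (s - (\<Sum>k<d. b k * eps (p - int k) \<omega>))"
      by (rule sums_iff_shift'[symmetric])
    moreover have "(\<Sum>k<d. b k * eps (p - int k) \<omega>) = 0" using assms by (intro sum.neutral) auto
    ultimately show ?thesis by (simp add: diff_diff_eq add.commute)
  qed
  then show ?thesis unfolding lin_def suminf_def by (intro arg_cong[where f=The] ext)
qed

end

section \<open>Variance of smooth functionals\<close>

text \<open>Lipschitz continuity, with constant |c|, of translation as a map from the reals into
  L^2. Only differences of translates are measured in L^2; boundedness supplies integrability
  against probability measures.\<close>

definition L2_lipschitz :: "real \<Rightarrow> (real \<Rightarrow> real) \<Rightarrow> bool" where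
  "L2_lipschitz c \<phi> \<longleftrightarrow> \<phi> \<in> borel_measurable borel \<and> (\<exists>B. \<forall>x. \<bar>\<phi> x\<bar> \<le> B) \<and>
     (\<forall>s t. (\<integral>\<^sup>+x. ennreal ((\<phi> (x - s) - \<phi> (x - t))\<^sup>2) \<partial>lborel) \<le> ennreal (c\<^sup>2 * (s - t)\<^sup>2))"

lemma L2_lipschitzD:
  assumes "L2_lipschitz c \<phi>"
  shows "\<phi> \<in> borel_measurable borel" "\<exists>B. \<forall>x. \<bar>\<phi> x\<bar> \<le> B"
    "(\<integral>\<^sup>+x. ennreal ((\<phi> (x - s) - \<phi> (x - t))\<^sup>2) \<partial>lborel) \<le> ennreal (c\<^sup>2 * (s - t)\<^sup>2)"
  using assms unfolding L2_lipschitz_def by auto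

text \<open>Minkowski's inequality for differences of translates, obtained from Cauchy-Schwarz with
  weights \<open>r i\<close>, which the Lipschitz bound turns back into a sum of shifts.\<close>

lemma L2_lipschitz_sum_shift:
  assumes I: "finite I" and lip: "\<And>i. i \<in> I \<Longrightarrow> L2_lipschitz c (\<phi> i)"
    and w: "\<And>i. i \<in> I \<Longrightarrow> \<bar>s i - t i\<bar> \<le> w i"
  shows "(\<integral>\<^sup>+x. ennreal ((\<Sum>i\<in>I. \<phi> i (x - s i) - \<phi> i (x - t i))\<^sup>2) \<partial>lborel) \<le> ennreal (c\<^sup>2 * (\<Sum>i\<in>I. w i)\<^sup>2)"
proof -
  \<comment> \<open>The weights occur as divisors, so indices with zero shift are removed; their
    terms vanish.\<close>
  define J where "J = {i \<in> I. s i \<noteq> t i}"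
  define r where "r i = \<bar>s i - t i\<bar>" for i
  have J: "finite J" "J \<subseteq> I" using I by (auto simp: J_def)
  have rpos: "i \<in> J \<Longrightarrow> 0 < r i" for i by (auto simp: J_def r_def)
  have [measurable]: "i \<in> J \<Longrightarrow> \<phi> i \<in> borel_measurable borel" for i using lip L2_lipschitzD(1) J by blast
  define R where "R = (\<Sum>i\<in>J. r i)"
  have R: "0 \<le> R" unfolding R_def by (intro sum_nonneg) (auto simp: r_def)
  have RW: "R \<le> (\<Sum>i\<in>I. w i)" unfolding R_def r_def
    using J I w by (intro sum_le_included[where i="\<lambda>x. x"]) (auto intro: order_trans[OF abs_ge_zero])
  have cs: "(\<Sum>i\<in>I. \<phi> i (x - s i) - \<phi> i (x - t i))\<^sup>2
      \<le> R * (\<Sum>i\<in>J. (\<phi> i (x - s i) - \<phi> i (x - t i))\<^sup>2 / r i)" for x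
  proof -
    define d where "d i = \<phi> i (x - s i) - \<phi> i (x - t i)" for i
    have "(\<Sum>i\<in>I. d i) = (\<Sum>i\<in>J. d i)"
      using J I by (intro sum.mono_neutral_right) (auto simp: J_def d_def)
    also have "\<dots> = (\<Sum>i\<in>J. sqrt (r i) * (d i / sqrt (r i)))"
      using rpos by (intro sum.cong) (auto dest!: rpos)
    finally have "(\<Sum>i\<in>I. d i)\<^sup>2 \<le> (\<Sum>i\<in>J. (sqrt (r i))\<^sup>2) * (\<Sum>i\<in>J. (d i / sqrt (r i))\<^sup>2)"
      using Cauchy_Schwarz_ineq_sum[of "\<lambda>i. sqrt (r i)" "\<lambda>i. d i / sqrt (r i)" J] by simp
    also have "(\<Sum>i\<in>J. (sqrt (r i))\<^sup>2) = R" unfolding R_def using rpos by (intro sum.cong) (auto simp: r_def)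
    also have "(\<Sum>i\<in>J. (d i / sqrt (r i))\<^sup>2) = (\<Sum>i\<in>J. (d i)\<^sup>2 / r i)"
      by (intro sum.cong) (auto simp: power_divide r_def)
    finally show ?thesis unfolding d_def .
  qed
  have "(\<integral>\<^sup>+x. ennreal ((\<Sum>i\<in>I. \<phi> i (x - s i) - \<phi> i (x - t i))\<^sup>2) \<partial>lborel)
      \<le> (\<integral>\<^sup>+x. ennreal R * (\<Sum>i\<in>J. ennreal (1 / r i) * ennreal ((\<phi> i (x - s i) - \<phi> i (x - t i))\<^sup>2)) \<partial>lborel)"
  proof (intro nn_integral_mono)
    fix x
    have "ennreal ((\<Sum>i\<in>I. \<phi> i (x - s i) - \<phi> i (x - t i))\<^sup>2)
      \<le> ennreal (R * (\<Sum>i\<in>J. (1 / r i) * (\<phi> i (x - s i) - \<phi> i (x - t i))\<^sup>2))"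
      using cs[of x] by (intro ennreal_leI) simp
    also have "\<dots> = ennreal R * (\<Sum>i\<in>J. ennreal (1 / r i) * ennreal ((\<phi> i (x - s i) - \<phi> i (x - t i))\<^sup>2))"
    proof -
      have "0 \<le> (\<Sum>i\<in>J. (1 / r i) * (\<phi> i (x - s i) - \<phi> i (x - t i))\<^sup>2)"
        by (intro sum_nonneg) (auto simp: r_def)
      moreover have "(\<Sum>i\<in>J. ennreal (1 / r i) * ennreal ((\<phi> i (x - s i) - \<phi> i (x - t i))\<^sup>2))
          = ennreal (\<Sum>i\<in>J. (1 / r i) * (\<phi> i (x - s i) - \<phi> i (x - t i))\<^sup>2)"
        by (subst sum_ennreal[symmetric]) (auto simp: r_def ennreal_mult[symmetric])
      ultimately show ?thesis using R by (simp only: ennreal_mult)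
    qed
    finally show "ennreal ((\<Sum>i\<in>I. \<phi> i (x - s i) - \<phi> i (x - t i))\<^sup>2) \<le> \<dots>" .
  qed
  also have "\<dots> = ennreal R * (\<Sum>i\<in>J. ennreal (1 / r i) * (\<integral>\<^sup>+x. ennreal ((\<phi> i (x - s i) - \<phi> i (x - t i))\<^sup>2) \<partial>lborel))"
    by (simp add: nn_integral_cmult nn_integral_sum)
  also have "\<dots> \<le> ennreal R * (\<Sum>i\<in>J. ennreal (1 / r i) * ennreal (c\<^sup>2 * (s i - t i)\<^sup>2))"
    using J lip by (intro mult_left_mono sum_mono L2_lipschitzD(3)) auto
  also have "\<dots> = ennreal R * (\<Sum>i\<in>J. ennreal (c\<^sup>2 * r i))"
  proof (intro arg_cong2[where f="(*)"] sum.cong refl)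
    fix i assume "i \<in> J"
    then have "0 < r i" by (rule rpos)
    moreover have "(s i - t i)\<^sup>2 = (r i)\<^sup>2" by (simp add: r_def)
    ultimately have "(1 / r i) * (c\<^sup>2 * (s i - t i)\<^sup>2) = c\<^sup>2 * r i"
      by (simp add: power2_eq_square)
    then show "ennreal (1 / r i) * ennreal (c\<^sup>2 * (s i - t i)\<^sup>2) = ennreal (c\<^sup>2 * r i)"
      using \<open>0 < r i\<close> by (subst ennreal_mult[symmetric]) auto
  qed
  also have "\<dots> = ennreal (c\<^sup>2 * R\<^sup>2)"
  proof -
    have "(\<Sum>i\<in>J. ennreal (c\<^sup>2 * r i)) = ennreal (c\<^sup>2 * R)"
      by (subst sum_ennreal) (auto simp: r_def R_def sum_distrib_left)
    then show ?thesis using R by (simp add: ennreal_mult[symmetric] power2_eq_square mult_ac)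
  qed
  also have "\<dots> \<le> ennreal (c\<^sup>2 * (\<Sum>i\<in>I. w i)\<^sup>2)"
    using R RW by (intro ennreal_leI mult_left_mono power_mono) auto
  finally show ?thesis .
qed

lemma L2_lipschitz_sum_bounded:
  assumes I: "finite I" and lip: "\<And>i. i \<in> I \<Longrightarrow> L2_lipschitz c (\<phi> i)"
  shows "\<exists>B. \<forall>y. \<bar>\<Sum>i\<in>I. \<phi> i (y i)\<bar> \<le> B"
proof -
  have "\<exists>B. \<forall>i\<in>I. \<forall>x. \<bar>\<phi> i x\<bar> \<le> B i" using L2_lipschitzD(2)[OF lip] by (intro bchoice) auto
  then obtain B where B: "\<And>i x. i \<in> I \<Longrightarrow> \<bar>\<phi> i x\<bar> \<le> B i" by blast
  then show ?thesis
    by (intro exI[of _ "\<Sum>i\<in>I. B i"] allI order_trans[OF sum_abs] sum_mono)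
qed

context iid_innovations
begin

lemma borel_measurable_law_square: "(\<lambda>v. ennreal (v\<^sup>2)) \<in> borel_measurable law"
  by measurable

text \<open>The signed counterpart of \<open>nn_integral_past\<close>; the uniform bound supplies
  the integrability that Fubini requires.\<close>

lemma integral_past:
  fixes G :: "'a \<Rightarrow> real \<Rightarrow> real"
  assumes G: "case_prod G \<in> borel_measurable (past p \<Otimes>\<^sub>M borel)" and B: "\<And>\<omega> v. \<bar>G \<omega> v\<bar> \<le> B"
  shows "(\<integral>\<omega>. G \<omega> (eps p \<omega>) \<partial>M) = (\<integral>\<omega>. (\<integral>v. G \<omega> v \<partial>law) \<partial>M)"
proof -
  interpret law: prob_space law by (rule prob_space_law)
  have id: "(\<lambda>\<omega>. \<omega>) \<in> M \<rightarrow>\<^sub>M past p"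
    using measurable_from_subalg[OF subalgebra_past measurable_ident_sets[OF refl]] .
  have pair: "(\<lambda>\<omega>. (\<omega>, eps p \<omega>)) \<in> M \<rightarrow>\<^sub>M past p \<Otimes>\<^sub>M borel"
    using id by (intro measurable_Pair) auto
  interpret N: prob_space "distr M (past p) (\<lambda>\<omega>. \<omega>)" by (rule prob_space_distr[OF id])
  interpret NL: pair_prob_space "distr M (past p) (\<lambda>\<omega>. \<omega>)" law ..
  have G': "case_prod G \<in> borel_measurable (past p \<Otimes>\<^sub>M law)"
    using G by (simp add: measurable_cong_sets[OF sets_pair_measure_cong[OF refl sets_law] refl])
  have "case_prod G \<in> borel_measurable (distr M (past p) (\<lambda>\<omega>. \<omega>) \<Otimes>\<^sub>M law)"
    using G by (simp add: measurable_cong_sets[OF sets_pair_measure_cong[OF sets_distr sets_law] refl])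
  then have int: "integrable (distr M (past p) (\<lambda>\<omega>. \<omega>) \<Otimes>\<^sub>M law) (case_prod G)"
    using B by (intro NL.integrable_const_bound[where B=B]) auto
  have "(\<integral>\<omega>. G \<omega> (eps p \<omega>) \<partial>M) = (\<integral>z. case_prod G z \<partial>distr M (past p \<Otimes>\<^sub>M borel) (\<lambda>\<omega>. (\<omega>, eps p \<omega>)))"
    using pair G by (subst integral_distr) auto
  also have "\<dots> = (\<integral>\<omega>. (\<integral>v. G \<omega> v \<partial>law) \<partial>distr M (past p) (\<lambda>\<omega>. \<omega>))"
    using NL.integral_fst[OF int] unfolding past_pair_distr[symmetric] by simp
  also have "\<dots> = (\<integral>\<omega>. (\<integral>v. G \<omega> v \<partial>law) \<partial>M)"
    using law.borel_measurable_lebesgue_integral[OF G'] id by (subst integral_distr) auto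
  finally show ?thesis .
qed

text \<open>Averaging over translates cannot increase the constant: Jensen inside, then Tonelli.
  This closes the class under integrating out an innovation, as the induction on the past
  requires.\<close>

lemma L2_lipschitz_average:
  assumes lip: "L2_lipschitz c \<phi>"
  shows "L2_lipschitz c (\<lambda>y. \<integral>v. \<phi> (y - b * v) \<partial>law)"
proof -
  interpret law: prob_space law by (rule prob_space_law)
  interpret PL: pair_sigma_finite law lborel ..
  note [measurable] = L2_lipschitzD(1)[OF lip]
  obtain B where B: "\<And>x. \<bar>\<phi> x\<bar> \<le> B" using L2_lipschitzD(2)[OF lip] by blast
  have int: "integrable law (\<lambda>v. \<phi> (y - b * v))" for y
    using B by (intro law.integrable_const_bound[where B=B]) auto
  have bd: "\<bar>\<integral>v. \<phi> (y - b * v) \<partial>law\<bar> \<le> B" for y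
  proof -
    have "\<bar>\<integral>v. \<phi> (y - b * v) \<partial>law\<bar> \<le> (\<integral>v. \<bar>\<phi> (y - b * v)\<bar> \<partial>law)" by (rule integral_abs_bound)
    also have "\<dots> \<le> (\<integral>v. B \<partial>law)" using B int by (intro integral_mono) auto
    finally show ?thesis using law.prob_space by simp
  qed
  have lip': "(\<integral>\<^sup>+x. ennreal (((\<integral>v. \<phi> (x - s - b * v) \<partial>law) - (\<integral>v. \<phi> (x - t - b * v) \<partial>law))\<^sup>2) \<partial>lborel)
      \<le> ennreal (c\<^sup>2 * (s - t)\<^sup>2)" for s t
  proof -
    have "(\<integral>\<^sup>+x. ennreal (((\<integral>v. \<phi> (x - s - b * v) \<partial>law) - (\<integral>v. \<phi> (x - t - b * v) \<partial>law))\<^sup>2) \<partial>lborel)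
        = (\<integral>\<^sup>+x. ennreal ((\<integral>v. \<phi> (x - s - b * v) - \<phi> (x - t - b * v) \<partial>law)\<^sup>2) \<partial>lborel)"
      using int by (simp add: Bochner_Integration.integral_diff)
    also have "\<dots> \<le> (\<integral>\<^sup>+x. (\<integral>\<^sup>+v. ennreal ((\<phi> (x - s - b * v) - \<phi> (x - t - b * v))\<^sup>2) \<partial>law) \<partial>lborel)"
      by (intro nn_integral_mono law.square_expectation_le) auto
    also have "\<dots> = (\<integral>\<^sup>+v. (\<integral>\<^sup>+x. ennreal ((\<phi> (x - s - b * v) - \<phi> (x - t - b * v))\<^sup>2) \<partial>lborel) \<partial>law)"
      by (rule PL.Fubini') simp
    also have "\<dots> \<le> (\<integral>\<^sup>+v. ennreal (c\<^sup>2 * (s - t)\<^sup>2) \<partial>law)"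
    proof (intro nn_integral_mono)
      fix v
      show "(\<integral>\<^sup>+x. ennreal ((\<phi> (x - s - b * v) - \<phi> (x - t - b * v))\<^sup>2) \<partial>lborel) \<le> ennreal (c\<^sup>2 * (s - t)\<^sup>2)"
        using L2_lipschitzD(3)[OF lip, of "s + b * v" "t + b * v"] by (simp add: diff_diff_eq)
    qed
    also have "\<dots> = ennreal (c\<^sup>2 * (s - t)\<^sup>2)" by simp
    finally show ?thesis .
  qed
  show ?thesis unfolding L2_lipschitz_def using bd lip' by (auto intro!: exI[of _ B])
qed

text \<open>The variance in \<open>v\<close> of the integrand is at most its second moment about the value at \<open>v = 0\<close>.\<close>

lemma variance_step:
  fixes m :: "real \<Rightarrow> real"
  assumes I: "finite I" and lip: "\<And>i. i \<in> I \<Longrightarrow> L2_lipschitz c (\<phi> i)"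
    and b: "\<And>i. i \<in> I \<Longrightarrow> summable (\<lambda>k. \<bar>b i k\<bar>)"
    and [measurable]: "m \<in> borel_measurable borel"
  shows "(\<integral>\<^sup>+\<omega>. (\<integral>\<^sup>+x. ennreal (((\<Sum>i\<in>I. \<phi> i (x - lin (b i) p \<omega>)) - m x)\<^sup>2) \<partial>lborel) \<partial>M)
    \<le> ennreal (c\<^sup>2 * s2 * (\<Sum>i\<in>I. \<bar>b i 0\<bar>)\<^sup>2) +
      (\<integral>\<^sup>+\<omega>. (\<integral>\<^sup>+x. ennreal (((\<Sum>i\<in>I. (\<integral>v. \<phi> i (x - lin (\<lambda>k. b i (Suc k)) (p - 1) \<omega> - b i 0 * v) \<partial>law)) - m x)\<^sup>2) \<partial>lborel) \<partial>M)"
    (is "?L \<le> _ + ?R")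
proof -
  interpret law: prob_space law by (rule prob_space_law)
  interpret PL: pair_sigma_finite law lborel ..
  have phi [measurable]: "i \<in> I \<Longrightarrow> \<phi> i \<in> borel_measurable borel" for i using lip L2_lipschitzD(1) by blast
  define T where "T i = lin (\<lambda>k. b i (Suc k)) (p - 1)" for i
  have T [measurable]: "T i \<in> borel_measurable (past p)" for i unfolding T_def by (rule lin_measurable_past) simp
  have TM [measurable]: "T i \<in> borel_measurable M" for i unfolding T_def by simp
  obtain B where B: "\<And>y. \<bar>\<Sum>i\<in>I. \<phi> i (y i)\<bar> \<le> B" using L2_lipschitz_sum_bounded[where \<phi>=\<phi>, OF I lip] by blast
  have phi_int: "integrable law (\<lambda>v. \<phi> i (y - b i 0 * v))" if "i \<in> I" for i y
  proof -
    obtain B where "\<And>x. \<bar>\<phi> i x\<bar> \<le> B" using L2_lipschitzD(2)[OF lip, OF \<open>i \<in> I\<close>] by blast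
    then show ?thesis using that by (intro law.integrable_const_bound[where B=B]) auto
  qed
  define G where "G x \<omega> v = (\<Sum>i\<in>I. \<phi> i (x - T i \<omega> - b i 0 * v))" for x \<omega> v
  have "AE \<omega> in M. \<forall>i\<in>I. lin (b i) p \<omega> = b i 0 * eps p \<omega> + T i \<omega>"
    unfolding T_def using I b by (intro AE_finite_allI AE_lin_Suc) auto
  then have "?L = (\<integral>\<^sup>+\<omega>. (\<integral>\<^sup>+x. ennreal ((G x \<omega> (eps p \<omega>) - m x)\<^sup>2) \<partial>lborel) \<partial>M)"
    by (intro nn_integral_cong_AE) (auto simp: G_def diff_diff_eq add.commute elim!: eventually_mono intro!: nn_integral_cong)
  also have "\<dots> = (\<integral>\<^sup>+\<omega>. (\<integral>\<^sup>+v. (\<integral>\<^sup>+x. ennreal ((G x \<omega> v - m x)\<^sup>2) \<partial>lborel) \<partial>law) \<partial>M)"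
    unfolding G_def by (rule nn_integral_past) measurable
  also have "\<dots> \<le> (\<integral>\<^sup>+\<omega>. ennreal (c\<^sup>2 * s2 * (\<Sum>i\<in>I. \<bar>b i 0\<bar>)\<^sup>2) +
      (\<integral>\<^sup>+x. ennreal (((\<Sum>i\<in>I. (\<integral>v. \<phi> i (x - T i \<omega> - b i 0 * v) \<partial>law)) - m x)\<^sup>2) \<partial>lborel) \<partial>M)"
  proof (intro nn_integral_mono)
    \<comment> \<open>For a frozen past the order of integration is exchanged twice: the variance
      bound acts at fixed \<open>x\<close>, the translation bound at fixed \<open>v\<close>.\<close>
    fix \<omega>
    have Gm1 [measurable]: "(\<lambda>v. G x \<omega> v) \<in> borel_measurable borel" for x unfolding G_def by measurable
    have Gm2 [measurable]: "(\<lambda>x. G x \<omega> v) \<in> borel_measurable borel" for v unfolding G_def by measurable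
    have EG: "(\<integral>v. G x \<omega> v \<partial>law) = (\<Sum>i\<in>I. (\<integral>v. \<phi> i (x - T i \<omega> - b i 0 * v) \<partial>law))" for x
      unfolding G_def using phi_int by (intro Bochner_Integration.integral_sum) auto
    have mE [measurable]: "(\<lambda>x. \<integral>v. G x \<omega> v \<partial>law) \<in> borel_measurable borel"
      unfolding G_def by measurable
    have "(\<integral>\<^sup>+v. (\<integral>\<^sup>+x. ennreal ((G x \<omega> v - m x)\<^sup>2) \<partial>lborel) \<partial>law) = (\<integral>\<^sup>+x. (\<integral>\<^sup>+v. ennreal ((G x \<omega> v - m x)\<^sup>2) \<partial>law) \<partial>lborel)"
      unfolding G_def by (rule PL.Fubini'[symmetric]) simp
    also have "\<dots> \<le> (\<integral>\<^sup>+x. (\<integral>\<^sup>+v. ennreal ((G x \<omega> v - G x \<omega> 0)\<^sup>2) \<partial>law) + ennreal (((\<integral>v. G x \<omega> v \<partial>law) - m x)\<^sup>2) \<partial>lborel)"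
      using B by (intro nn_integral_mono law.second_moment_le) (auto simp: G_def)
    also have "\<dots> = (\<integral>\<^sup>+x. (\<integral>\<^sup>+v. ennreal ((G x \<omega> v - G x \<omega> 0)\<^sup>2) \<partial>law) \<partial>lborel) + (\<integral>\<^sup>+x. ennreal (((\<integral>v. G x \<omega> v \<partial>law) - m x)\<^sup>2) \<partial>lborel)"
      unfolding G_def by (rule nn_integral_add) measurable
    also have "(\<integral>\<^sup>+x. (\<integral>\<^sup>+v. ennreal ((G x \<omega> v - G x \<omega> 0)\<^sup>2) \<partial>law) \<partial>lborel) = (\<integral>\<^sup>+v. (\<integral>\<^sup>+x. ennreal ((G x \<omega> v - G x \<omega> 0)\<^sup>2) \<partial>lborel) \<partial>law)"
      unfolding G_def by (rule PL.Fubini') simp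
    also have "\<dots> \<le> (\<integral>\<^sup>+v. ennreal (c\<^sup>2 * (\<Sum>i\<in>I. \<bar>b i 0\<bar>)\<^sup>2) * ennreal (v\<^sup>2) \<partial>law)"
    proof (intro nn_integral_mono)
      \<comment> \<open>Replacing \<open>v\<close> by 0 moves the argument of the
        \<open>i\<close>-th summand by \<open>b i 0 * v\<close>, so v^2 factors out of the squared
        total shift.\<close>
      fix v
      have "(\<integral>\<^sup>+x. ennreal ((\<Sum>i\<in>I. \<phi> i (x - (T i \<omega> + b i 0 * v)) - \<phi> i (x - T i \<omega>))\<^sup>2) \<partial>lborel)
          \<le> ennreal (c\<^sup>2 * (\<Sum>i\<in>I. \<bar>b i 0\<bar> * \<bar>v\<bar>)\<^sup>2)"
        using I lip by (rule L2_lipschitz_sum_shift) (auto simp: abs_mult)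
      then show "(\<integral>\<^sup>+x. ennreal ((G x \<omega> v - G x \<omega> 0)\<^sup>2) \<partial>lborel) \<le> ennreal (c\<^sup>2 * (\<Sum>i\<in>I. \<bar>b i 0\<bar>)\<^sup>2) * ennreal (v\<^sup>2)"
        by (simp add: G_def sum_subtractf diff_diff_eq sum_distrib_right[symmetric] power_mult_distrib ennreal_mult[symmetric] mult.assoc)
    qed
    also have "\<dots> = ennreal (c\<^sup>2 * s2 * (\<Sum>i\<in>I. \<bar>b i 0\<bar>)\<^sup>2)"
      unfolding nn_integral_cmult[OF borel_measurable_law_square] nn_integral_law_square
      using s2_nonneg by (simp add: ennreal_mult[symmetric] mult_ac)
    finally show "(\<integral>\<^sup>+v. (\<integral>\<^sup>+x. ennreal ((G x \<omega> v - m x)\<^sup>2) \<partial>lborel) \<partial>law)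
        \<le> ennreal (c\<^sup>2 * s2 * (\<Sum>i\<in>I. \<bar>b i 0\<bar>)\<^sup>2) +
          (\<integral>\<^sup>+x. ennreal (((\<Sum>i\<in>I. (\<integral>v. \<phi> i (x - T i \<omega> - b i 0 * v) \<partial>law)) - m x)\<^sup>2) \<partial>lborel)"
      unfolding EG by (simp add: add_right_mono)
  qed
  also have "\<dots> = ennreal (c\<^sup>2 * s2 * (\<Sum>i\<in>I. \<bar>b i 0\<bar>)\<^sup>2) + ?R"
    unfolding T_def by (subst nn_integral_add) (measurable, simp add: emeasure_space_1)
  finally show ?thesis .
qed

text \<open>Peeling off \<open>N\<close> innovations, newest first, costs one squared column sum of
  \<open>b\<close> per innovation; what is left is driven by the tails of the coefficients.
  \<open>\<phi>\<close>, \<open>b\<close> and \<open>p\<close> vary along the induction while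
  \<open>m\<close> stays fixed.\<close>

lemma block_variance_tail:
  fixes m :: "real \<Rightarrow> real"
  assumes I: "finite I" and lip: "\<And>i. i \<in> I \<Longrightarrow> L2_lipschitz c (\<phi> i)"
    and b: "\<And>i. i \<in> I \<Longrightarrow> summable (\<lambda>k. \<bar>b i k\<bar>)"
    and m: "m \<in> borel_measurable borel" "\<And>x. m x = (\<integral>\<omega>. (\<Sum>i\<in>I. \<phi> i (x - lin (b i) p \<omega>)) \<partial>M)"
  shows "(\<integral>\<^sup>+\<omega>. (\<integral>\<^sup>+x. ennreal (((\<Sum>i\<in>I. \<phi> i (x - lin (b i) p \<omega>)) - m x)\<^sup>2) \<partial>lborel) \<partial>M)
    \<le> ennreal (c\<^sup>2 * s2 * (\<Sum>k<N. (\<Sum>i\<in>I. \<bar>b i k\<bar>)\<^sup>2)) +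
      ennreal (c\<^sup>2) * (\<integral>\<^sup>+\<omega>. ennreal ((\<Sum>i\<in>I. \<bar>lin (\<lambda>k. b i (k + N)) (p - int N) \<omega>\<bar>)\<^sup>2) \<partial>M)"
  using lip b m(2)
proof (induction N arbitrary: \<phi> b p)
  case 0
  note lip = 0(1) and b = 0(2) and mean = 0(3)
  interpret LM: pair_sigma_finite lborel M ..
  note [measurable] = m(1)
  have phi [measurable]: "i \<in> I \<Longrightarrow> \<phi> i \<in> borel_measurable borel" for i using lip L2_lipschitzD(1) by blast
  obtain B where B: "\<And>y. \<bar>\<Sum>i\<in>I. \<phi> i (y i)\<bar> \<le> B" using L2_lipschitz_sum_bounded[where \<phi>=\<phi>, OF I lip] by blast
  have "(\<integral>\<^sup>+\<omega>. (\<integral>\<^sup>+x. ennreal (((\<Sum>i\<in>I. \<phi> i (x - lin (b i) p \<omega>)) - m x)\<^sup>2) \<partial>lborel) \<partial>M)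
     = (\<integral>\<^sup>+x. (\<integral>\<^sup>+\<omega>. ennreal (((\<Sum>i\<in>I. \<phi> i (x - lin (b i) p \<omega>)) - m x)\<^sup>2) \<partial>M) \<partial>lborel)"
    by (rule LM.Fubini') simp
  \<comment> \<open>The centre is the value at zero shift: the whole remaining linear process is
    treated as a single displacement.\<close>
  also have "\<dots> \<le> (\<integral>\<^sup>+x. (\<integral>\<^sup>+\<omega>. ennreal (((\<Sum>i\<in>I. \<phi> i (x - lin (b i) p \<omega>)) - (\<Sum>i\<in>I. \<phi> i (x - 0)))\<^sup>2) \<partial>M) \<partial>lborel)"
  proof (rule nn_integral_mono)
    fix x
    show "(\<integral>\<^sup>+\<omega>. ennreal (((\<Sum>i\<in>I. \<phi> i (x - lin (b i) p \<omega>)) - m x)\<^sup>2) \<partial>M)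
       \<le> (\<integral>\<^sup>+\<omega>. ennreal (((\<Sum>i\<in>I. \<phi> i (x - lin (b i) p \<omega>)) - (\<Sum>i\<in>I. \<phi> i (x - 0)))\<^sup>2) \<partial>M)"
      using second_moment_le[of "\<lambda>\<omega>. \<Sum>i\<in>I. \<phi> i (x - lin (b i) p \<omega>)" B "m x" "\<Sum>i\<in>I. \<phi> i (x - 0)"] B
      by (simp add: mean)
  qed
  also have "\<dots> = (\<integral>\<^sup>+\<omega>. (\<integral>\<^sup>+x. ennreal (((\<Sum>i\<in>I. \<phi> i (x - lin (b i) p \<omega>)) - (\<Sum>i\<in>I. \<phi> i (x - 0)))\<^sup>2) \<partial>lborel) \<partial>M)"
    by (rule LM.Fubini'[symmetric]) simp
  also have "\<dots> \<le> (\<integral>\<^sup>+\<omega>. ennreal (c\<^sup>2) * ennreal ((\<Sum>i\<in>I. \<bar>lin (b i) p \<omega>\<bar>)\<^sup>2) \<partial>M)"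
  proof (intro nn_integral_mono)
    fix \<omega>
    have "(\<integral>\<^sup>+x. ennreal ((\<Sum>i\<in>I. \<phi> i (x - lin (b i) p \<omega>) - \<phi> i (x - 0))\<^sup>2) \<partial>lborel)
        \<le> ennreal (c\<^sup>2 * (\<Sum>i\<in>I. \<bar>lin (b i) p \<omega>\<bar>)\<^sup>2)"
      using I lip by (rule L2_lipschitz_sum_shift) auto
    then show "(\<integral>\<^sup>+x. ennreal (((\<Sum>i\<in>I. \<phi> i (x - lin (b i) p \<omega>)) - (\<Sum>i\<in>I. \<phi> i (x - 0)))\<^sup>2) \<partial>lborel)
       \<le> ennreal (c\<^sup>2) * ennreal ((\<Sum>i\<in>I. \<bar>lin (b i) p \<omega>\<bar>)\<^sup>2)"
      unfolding sum_subtractf by (simp add: ennreal_mult)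
  qed
  also have "\<dots> = ennreal (c\<^sup>2) * (\<integral>\<^sup>+\<omega>. ennreal ((\<Sum>i\<in>I. \<bar>lin (b i) p \<omega>\<bar>)\<^sup>2) \<partial>M)"
    by (rule nn_integral_cmult) measurable
  finally show ?case by simp
next
  case (Suc N)
  note lip = Suc.prems(1) and b = Suc.prems(2) and mean = Suc.prems(3)
  interpret law: prob_space law by (rule prob_space_law)
  have phi [measurable]: "i \<in> I \<Longrightarrow> \<phi> i \<in> borel_measurable borel" for i using lip L2_lipschitzD(1) by blast
  obtain B where B: "\<And>y. \<bar>\<Sum>i\<in>I. \<phi> i (y i)\<bar> \<le> B" using L2_lipschitz_sum_bounded[where \<phi>=\<phi>, OF I lip] by blast
  have phi_int: "integrable law (\<lambda>v. \<phi> i (y - b i 0 * v))" if "i \<in> I" for i y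
  proof -
    obtain B where "\<And>x. \<bar>\<phi> i x\<bar> \<le> B" using L2_lipschitzD(2)[OF lip, OF \<open>i \<in> I\<close>] by blast
    then show ?thesis using that by (intro law.integrable_const_bound[where B=B]) auto
  qed
  define T where "T i = lin (\<lambda>k. b i (Suc k)) (p - 1)" for i
  have T [measurable]: "T i \<in> borel_measurable (past p)" for i unfolding T_def by (rule lin_measurable_past) simp
  \<comment> \<open>Tower property: averaging over the newest innovation leaves \<open>m\<close>
    unchanged, so the induction hypothesis applies to the averaged functions with the same
    \<open>m\<close>.\<close>
  have mean': "m x = (\<integral>\<omega>. (\<Sum>i\<in>I. (\<integral>v. \<phi> i (x - T i \<omega> - b i 0 * v) \<partial>law)) \<partial>M)" for x
  proof -
    have ae: "AE \<omega> in M. \<forall>i\<in>I. lin (b i) p \<omega> = b i 0 * eps p \<omega> + T i \<omega>"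
      unfolding T_def using I b by (intro AE_finite_allI AE_lin_Suc) auto
    have [measurable]: "T i \<in> borel_measurable M" for i unfolding T_def by simp
    have "m x = (\<integral>\<omega>. (\<Sum>i\<in>I. \<phi> i (x - T i \<omega> - b i 0 * eps p \<omega>)) \<partial>M)"
      unfolding mean using ae
      by (intro integral_cong_AE) (auto simp: diff_diff_eq add.commute elim!: eventually_mono intro!: sum.cong)
    also have "\<dots> = (\<integral>\<omega>. (\<integral>v. (\<Sum>i\<in>I. \<phi> i (x - T i \<omega> - b i 0 * v)) \<partial>law) \<partial>M)"
      by (rule integral_past[where B=B]) (measurable, rule B)
    also have "\<dots> = (\<integral>\<omega>. (\<Sum>i\<in>I. (\<integral>v. \<phi> i (x - T i \<omega> - b i 0 * v) \<partial>law)) \<partial>M)"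
      using phi_int by (intro Bochner_Integration.integral_cong refl Bochner_Integration.integral_sum) auto
    finally show ?thesis .
  qed
  have b': "summable (\<lambda>k. \<bar>b i (Suc k)\<bar>)" if "i \<in> I" for i
    using b[OF that] summable_Suc_iff[of "\<lambda>k. \<bar>b i k\<bar>"] by simp
  let ?V = "\<lambda>N. c\<^sup>2 * s2 * (\<Sum>k<N. (\<Sum>i\<in>I. \<bar>b i k\<bar>)\<^sup>2)"
  let ?V' = "c\<^sup>2 * s2 * (\<Sum>k<N. (\<Sum>i\<in>I. \<bar>b i (Suc k)\<bar>)\<^sup>2)"
  let ?R = "ennreal (c\<^sup>2) * (\<integral>\<^sup>+\<omega>. ennreal ((\<Sum>i\<in>I. \<bar>lin (\<lambda>k. b i (k + Suc N)) (p - int (Suc N)) \<omega>\<bar>)\<^sup>2) \<partial>M)"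
  have ih: "(\<integral>\<^sup>+\<omega>. (\<integral>\<^sup>+x. ennreal (((\<Sum>i\<in>I. (\<integral>v. \<phi> i (x - T i \<omega> - b i 0 * v) \<partial>law)) - m x)\<^sup>2) \<partial>lborel) \<partial>M)
      \<le> ennreal ?V' + ?R"
  proof -
    have "(\<integral>\<^sup>+\<omega>. (\<integral>\<^sup>+x. ennreal (((\<Sum>i\<in>I. (\<integral>v. \<phi> i (x - T i \<omega> - b i 0 * v) \<partial>law)) - m x)\<^sup>2) \<partial>lborel) \<partial>M)
      \<le> ennreal ?V' + ennreal (c\<^sup>2) *
         (\<integral>\<^sup>+\<omega>. ennreal ((\<Sum>i\<in>I. \<bar>lin (\<lambda>k. b i (Suc (k + N))) (p - 1 - int N) \<omega>\<bar>)\<^sup>2) \<partial>M)"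
      unfolding T_def
      by (rule Suc.IH[of "\<lambda>i y. \<integral>v. \<phi> i (y - b i 0 * v) \<partial>law" "\<lambda>i k. b i (Suc k)" "p - 1"])
         (use lip b' mean' in \<open>auto simp: L2_lipschitz_average T_def\<close>)
    then show ?thesis by (simp add: diff_diff_eq)
  qed
  have "(\<integral>\<^sup>+\<omega>. (\<integral>\<^sup>+x. ennreal (((\<Sum>i\<in>I. \<phi> i (x - lin (b i) p \<omega>)) - m x)\<^sup>2) \<partial>lborel) \<partial>M)
      \<le> ennreal (c\<^sup>2 * s2 * (\<Sum>i\<in>I. \<bar>b i 0\<bar>)\<^sup>2) + (ennreal ?V' + ?R)"
    by (rule order_trans[OF variance_step[OF I lip b m(1)]])
       (use ih in \<open>auto intro!: add_left_mono simp: T_def\<close>)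
  also have "\<dots> = ennreal (c\<^sup>2 * s2 * (\<Sum>i\<in>I. \<bar>b i 0\<bar>)\<^sup>2 + ?V') + ?R"
    using s2_nonneg by (subst ennreal_plus) (auto simp: add.assoc intro!: mult_nonneg_nonneg sum_nonneg)
  also have "c\<^sup>2 * s2 * (\<Sum>i\<in>I. \<bar>b i 0\<bar>)\<^sup>2 + ?V' = ?V (Suc N)"
    by (simp only: sum.lessThan_Suc_shift distrib_left)
  finally show ?case .
qed

text \<open>As \<open>N\<close> tends to infinity the tails disappear. Bounding one factor of each
  squared column sum by \<open>A\<close> leaves the total of all |b i k|, which the row sums bound
  by \<open>A * card I\<close>; hence linear growth in the block length.\<close>

lemma block_variance:
  fixes m :: "real \<Rightarrow> real"
  assumes I: "finite I" and lip: "\<And>i. i \<in> I \<Longrightarrow> L2_lipschitz c (\<phi> i)"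
    and b: "\<And>i. i \<in> I \<Longrightarrow> summable (\<lambda>k. \<bar>b i k\<bar>)"
    and m: "m \<in> borel_measurable borel" "\<And>x. m x = (\<integral>\<omega>. (\<Sum>i\<in>I. \<phi> i (x - lin (b i) p \<omega>)) \<partial>M)"
    and row: "\<And>i. i \<in> I \<Longrightarrow> (\<Sum>k. \<bar>b i k\<bar>) \<le> A" and col: "\<And>k. (\<Sum>i\<in>I. \<bar>b i k\<bar>) \<le> A"
  shows "(\<integral>\<^sup>+\<omega>. (\<integral>\<^sup>+x. ennreal (((\<Sum>i\<in>I. \<phi> i (x - lin (b i) p \<omega>)) - m x)\<^sup>2) \<partial>lborel) \<partial>M)
    \<le> ennreal (c\<^sup>2 * s2 * A\<^sup>2 * card I)" (is "?L \<le> _")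
proof -
  have A: "0 \<le> A" using order_trans[OF sum_nonneg col[of 0]] by auto
  have tail: "(\<lambda>N. \<Sum>k. \<bar>b i (k + N)\<bar>) \<longlonglongrightarrow> 0" if "i \<in> I" for i
    using suminf_exist_split2[OF b[OF that]] .
  have sq: "(\<integral>\<^sup>+\<omega>. ennreal ((\<Sum>i\<in>I. \<bar>lin (\<lambda>k. b i (k + N)) (p - int N) \<omega>\<bar>)\<^sup>2) \<partial>M)
      \<le> ennreal (card I * s2 * (\<Sum>i\<in>I. (\<Sum>k. \<bar>b i (k + N)\<bar>)\<^sup>2))" for N
  proof -
    have "(\<integral>\<^sup>+\<omega>. ennreal ((\<Sum>i\<in>I. \<bar>lin (\<lambda>k. b i (k + N)) (p - int N) \<omega>\<bar>)\<^sup>2) \<partial>M)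
      \<le> (\<integral>\<^sup>+\<omega>. ennreal (card I) * (\<Sum>i\<in>I. ennreal ((lin (\<lambda>k. b i (k + N)) (p - int N) \<omega>)\<^sup>2)) \<partial>M)"
    proof (intro nn_integral_mono)
      fix \<omega>
      have "(\<Sum>i\<in>I. \<bar>lin (\<lambda>k. b i (k + N)) (p - int N) \<omega>\<bar>)\<^sup>2
          \<le> real (card I) * (\<Sum>i\<in>I. (lin (\<lambda>k. b i (k + N)) (p - int N) \<omega>)\<^sup>2)"
        using Cauchy_Schwarz_ineq_sum[of "\<lambda>_. 1" "\<lambda>i. \<bar>lin (\<lambda>k. b i (k + N)) (p - int N) \<omega>\<bar>" I] by simp
      then show "ennreal ((\<Sum>i\<in>I. \<bar>lin (\<lambda>k. b i (k + N)) (p - int N) \<omega>\<bar>)\<^sup>2)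
        \<le> ennreal (card I) * (\<Sum>i\<in>I. ennreal ((lin (\<lambda>k. b i (k + N)) (p - int N) \<omega>)\<^sup>2))"
        by (simp add: sum_ennreal ennreal_mult[symmetric] sum_nonneg ennreal_leI del: sum_power2)
    qed
    also have "\<dots> = ennreal (card I) * (\<Sum>i\<in>I. (\<integral>\<^sup>+\<omega>. ennreal ((lin (\<lambda>k. b i (k + N)) (p - int N) \<omega>)\<^sup>2) \<partial>M))"
      by (simp add: nn_integral_cmult nn_integral_sum del: sum_ennreal)
    also have "\<dots> \<le> ennreal (card I) * (\<Sum>i\<in>I. ennreal (s2 * (\<Sum>k. \<bar>b i (k + N)\<bar>)\<^sup>2))"
      by (intro mult_left_mono sum_mono nn_integral_lin_square summable_ignore_initial_segment b) auto
    also have "\<dots> = ennreal (card I * s2 * (\<Sum>i\<in>I. (\<Sum>k. \<bar>b i (k + N)\<bar>)\<^sup>2))"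
      using s2_nonneg
      by (simp add: sum_ennreal ennreal_mult[symmetric] sum_nonneg sum_distrib_left[symmetric] mult.assoc)
    finally show ?thesis .
  qed
  have cols: "(\<Sum>k<N. (\<Sum>i\<in>I. \<bar>b i k\<bar>)\<^sup>2) \<le> A\<^sup>2 * card I" for N
  proof -
    have "(\<Sum>k<N. (\<Sum>i\<in>I. \<bar>b i k\<bar>)\<^sup>2) \<le> (\<Sum>k<N. A * (\<Sum>i\<in>I. \<bar>b i k\<bar>))"
      unfolding power2_eq_square using col by (intro sum_mono mult_right_mono) (auto intro: sum_nonneg)
    also have "\<dots> = A * (\<Sum>i\<in>I. \<Sum>k<N. \<bar>b i k\<bar>)"
      unfolding sum_distrib_left[symmetric] by (subst sum.swap) simp
    also have "\<dots> \<le> A * (\<Sum>i\<in>I. A)"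
    proof (intro mult_left_mono sum_mono A)
      fix i assume i: "i \<in> I"
      show "(\<Sum>k<N. \<bar>b i k\<bar>) \<le> A" using sum_le_suminf[OF b[OF i], of "{..<N}"] row[OF i] by simp
    qed
    finally show ?thesis by (simp add: power2_eq_square mult_ac)
  qed
  have bound: "?L \<le> ennreal (c\<^sup>2 * s2 * A\<^sup>2 * card I + c\<^sup>2 * (card I * s2 * (\<Sum>i\<in>I. (\<Sum>k. \<bar>b i (k + N)\<bar>)\<^sup>2)))" for N
  proof -
    have "?L \<le> ennreal (c\<^sup>2 * s2 * (\<Sum>k<N. (\<Sum>i\<in>I. \<bar>b i k\<bar>)\<^sup>2)) +
      ennreal (c\<^sup>2) * (\<integral>\<^sup>+\<omega>. ennreal ((\<Sum>i\<in>I. \<bar>lin (\<lambda>k. b i (k + N)) (p - int N) \<omega>\<bar>)\<^sup>2) \<partial>M)"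
      using I lip b m by (rule block_variance_tail)
    also have "\<dots> \<le> ennreal (c\<^sup>2 * s2 * (A\<^sup>2 * card I)) +
        ennreal (c\<^sup>2) * ennreal (card I * s2 * (\<Sum>i\<in>I. (\<Sum>k. \<bar>b i (k + N)\<bar>)\<^sup>2))"
      using s2_nonneg cols sq by (intro add_mono mult_left_mono ennreal_leI) auto
    finally show ?thesis
      using s2_nonneg by (simp add: ennreal_mult[symmetric] ennreal_plus[symmetric] sum_nonneg mult.assoc del: ennreal_plus)
  qed
  have "(\<lambda>N. ennreal (c\<^sup>2 * s2 * A\<^sup>2 * card I + c\<^sup>2 * (card I * s2 * (\<Sum>i\<in>I. (\<Sum>k. \<bar>b i (k + N)\<bar>)\<^sup>2))))
      \<longlonglongrightarrow> ennreal (c\<^sup>2 * s2 * A\<^sup>2 * card I + c\<^sup>2 * (card I * s2 * (\<Sum>i\<in>I. 0\<^sup>2)))"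
    using tail by (intro tendsto_ennrealI tendsto_intros)
  then have "(\<lambda>N. ennreal (c\<^sup>2 * s2 * A\<^sup>2 * card I + c\<^sup>2 * (card I * s2 * (\<Sum>i\<in>I. (\<Sum>k. \<bar>b i (k + N)\<bar>)\<^sup>2))))
      \<longlonglongrightarrow> ennreal (c\<^sup>2 * s2 * A\<^sup>2 * card I)" by simp
  then show ?thesis
    by (rule LIMSEQ_le_const) (use bound in auto)
qed

end

section \<open>Chaining\<close>

lemma summable_poly_exp: "summable (\<lambda>k. (real k + 1) ^ 2 * 2 powr (- real k / 5))"
proof (rule summable_comparison_test_bigo)
  show "summable (\<lambda>k. norm (1 / real (Suc k) ^ 2))"
    using inverse_squares_sums by (simp add: sums_iff inverse_eq_divide add_ac)
  show "(\<lambda>k. (real k + 1) ^ 2 * 2 powr (- real k / 5)) \<in> O(\<lambda>k. 1 / real (Suc k) ^ 2)"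
    by real_asymp
qed

lemma ex_power2_between:
  assumes "1 \<le> (n::nat)" shows "\<exists>k. n \<le> 2 ^ k \<and> 2 ^ k \<le> 2 * n"
  using assms
proof (induction n rule: nat_induct_at_least)
  case base show ?case by (rule exI[of _ 0]) auto
next
  case (Suc n)
  then obtain k where "n \<le> 2 ^ k" "2 ^ k \<le> 2 * n" by blast
  then show ?case
    by (cases "n = 2 ^ k") (auto intro: exI[of _ k] exI[of _ "Suc k"])
qed

context iid_innovations
begin

text \<open>When \<open>\<phi>\<close> is the density of the newest innovation term and
  \<open>lin b (int i - s)\<close> the contribution of the past, this is the conditional density of
  the observation given the past minus its marginal density.\<close>

definition smooth_dev :: "(real \<Rightarrow> real) \<Rightarrow> (nat \<Rightarrow> real) \<Rightarrow> int \<Rightarrow> nat \<Rightarrow> real \<Rightarrow> 'a \<Rightarrow> real" where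
  "smooth_dev \<phi> b s i x \<omega> = \<phi> (x - lin b (int i - s) \<omega>) - (\<integral>\<omega>. \<phi> (x - lin b (int i - s) \<omega>) \<partial>M)"

text \<open>The block bound works at a common time, so each process of the block is written at time
  \<open>p\<close> with \<open>d i\<close> leading zero coefficients. Rows keep the sum of |b k|; a
  column consists of zeros and coefficients of \<open>b\<close> at distinct indices, so it has the
  same bound.\<close>

lemma smooth_block_variance:
  assumes lip: "L2_lipschitz c \<phi>" and b: "summable (\<lambda>k. \<bar>b k\<bar>)"
  shows "(\<integral>\<^sup>+\<omega>. (\<integral>\<^sup>+x. ennreal ((\<Sum>i\<in>{q..<q + L}. smooth_dev \<phi> b s i x \<omega>)\<^sup>2) \<partial>lborel) \<partial>M)
    \<le> ennreal (c\<^sup>2 * s2 * (\<Sum>k. \<bar>b k\<bar>)\<^sup>2 * L)"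
proof -
  let ?A = "\<Sum>k. \<bar>b k\<bar>" and ?I = "{q..<q + L}"
  note [measurable] = L2_lipschitzD(1)[OF lip]
  obtain B where B: "\<And>x. \<bar>\<phi> x\<bar> \<le> B" using L2_lipschitzD(2)[OF lip] by blast
  define d where "d i = q + L - i" for i
  define e where "e i k = (if k < d i then 0 else b (k - d i))" for i k
  define p where "p = int (q + L) - s"
  have eq: "lin (e i) p \<omega> = lin b (int i - s) \<omega>" if "i \<in> ?I" for i \<omega>
  proof -
    have "lin (e i) p \<omega> = lin (\<lambda>k. e i (k + d i)) (p - int (d i)) \<omega>"
      by (rule lin_drop_zeros) (simp add: e_def)
    moreover have "p - int (d i) = int i - s" using that by (auto simp: p_def d_def)
    ultimately show ?thesis by (simp add: e_def)
  qed
  have sums: "(\<lambda>k. \<bar>e i k\<bar>) sums ?A" for i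
  proof -
    have "(\<lambda>k. \<bar>e i (k + d i)\<bar>) sums ?A" using b by (simp add: e_def summable_sums)
    then have "(\<lambda>k. \<bar>e i k\<bar>) sums (?A + (\<Sum>k<d i. \<bar>e i k\<bar>))" by (rule sums_iff_shift[THEN iffD1])
    moreover have "(\<Sum>k<d i. \<bar>e i k\<bar>) = 0" by (simp add: e_def)
    ultimately show ?thesis by simp
  qed
  have col: "(\<Sum>i\<in>?I. \<bar>e i k\<bar>) \<le> ?A" for k
  proof -
    let ?J = "{i \<in> ?I. d i \<le> k}"
    have inj: "inj_on (\<lambda>i. k - d i) ?J" by (auto simp: inj_on_def d_def)
    have "(\<Sum>i\<in>?I. \<bar>e i k\<bar>) = (\<Sum>i\<in>?J. \<bar>b (k - d i)\<bar>)"
      by (rule sum.mono_neutral_cong_right) (auto simp: e_def)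
    also have "\<dots> = (\<Sum>j\<in>(\<lambda>i. k - d i) ` ?J. \<bar>b j\<bar>)" using inj by (simp add: sum.reindex)
    also have "\<dots> \<le> ?A" using b by (intro sum_le_suminf) auto
    finally show ?thesis .
  qed
  have int: "integrable M (\<lambda>\<omega>. \<phi> (x - lin (e i) p \<omega>))" for i x
    using B by (intro integrable_const_bound[where B=B]) auto
  define m where "m x = (\<integral>\<omega>. (\<Sum>i\<in>?I. \<phi> (x - lin (e i) p \<omega>)) \<partial>M)" for x
  have mm: "m \<in> borel_measurable borel" unfolding m_def by measurable
  have ms: "m x = (\<Sum>i\<in>?I. (\<integral>\<omega>. \<phi> (x - lin (e i) p \<omega>) \<partial>M))" for x
    unfolding m_def using int by (rule Bochner_Integration.integral_sum)
  have "(\<Sum>i\<in>?I. smooth_dev \<phi> b s i x \<omega>) = (\<Sum>i\<in>?I. \<phi> (x - lin (e i) p \<omega>)) - m x" for x \<omega>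
    unfolding ms sum_subtractf[symmetric] smooth_dev_def by (intro sum.cong refl) (simp add: eq)
  moreover have "(\<integral>\<^sup>+\<omega>. (\<integral>\<^sup>+x. ennreal (((\<Sum>i\<in>?I. \<phi> (x - lin (e i) p \<omega>)) - m x)\<^sup>2) \<partial>lborel) \<partial>M)
      \<le> ennreal (c\<^sup>2 * s2 * ?A\<^sup>2 * card ?I)"
    using sums by (intro block_variance lip mm m_def col) (auto simp: sums_iff)
  ultimately show ?thesis by simp
qed

lemma smooth_dev_measurable [measurable]:
  assumes [measurable]: "\<phi> \<in> borel_measurable borel"
  shows "(\<lambda>z. smooth_dev \<phi> b s i (fst z) (snd z)) \<in> borel_measurable (lborel \<Otimes>\<^sub>M M)"
  unfolding smooth_dev_def by measurable

lemma smooth_dyadic_energy_measurable: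
  assumes [measurable]: "\<phi> \<in> borel_measurable borel"
  shows "(\<lambda>z. dyadic_energy (\<lambda>i. smooth_dev \<phi> b s i (fst z) (snd z)) k q) \<in> borel_measurable (lborel \<Otimes>\<^sub>M M)"
  by (induction k arbitrary: q) simp_all

text \<open>Each of the \<open>Suc k\<close> levels of the dyadic tree has total length 2^k, and the
  block variance is linear in the length.\<close>

lemma smooth_dyadic_energy:
  assumes lip: "L2_lipschitz c \<phi>" and b: "summable (\<lambda>k. \<bar>b k\<bar>)"
  shows "(\<integral>\<^sup>+\<omega>. (\<integral>\<^sup>+x. ennreal (dyadic_energy (\<lambda>i. smooth_dev \<phi> b s i x \<omega>) k q) \<partial>lborel) \<partial>M)
    \<le> ennreal (c\<^sup>2 * s2 * (\<Sum>k. \<bar>b k\<bar>)\<^sup>2 * (real (Suc k) * 2 ^ k))"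
proof (induction k arbitrary: q)
  case 0
  show ?case using smooth_block_variance[OF lip b, where q=q and L=1] by simp
next
  case (Suc k)
  note [measurable] = L2_lipschitzD(1)[OF lip]
  define V where "V = c\<^sup>2 * s2 * (\<Sum>k. \<bar>b k\<bar>)\<^sup>2"
  have V: "0 \<le> V" unfolding V_def using s2_nonneg by simp
  let ?Z = "\<lambda>x \<omega> i. smooth_dev \<phi> b s i x \<omega>"
  have E [measurable]: "(\<lambda>z. ennreal (dyadic_energy (?Z (fst z) (snd z)) k q)) \<in> borel_measurable (lborel \<Otimes>\<^sub>M M)" for k q
    using smooth_dyadic_energy_measurable[of \<phi> b s k q] by measurable
  have E': "(\<lambda>x. ennreal (dyadic_energy (?Z x \<omega>) k q)) \<in> borel_measurable lborel" if "\<omega> \<in> space M" for k q \<omega>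
    using measurable_compose[OF measurable_Pair2'[OF that] E[of k q]] by simp
  have S: "(\<lambda>z. ennreal ((\<Sum>i\<in>{q..<q + 2 ^ Suc k}. ?Z (fst z) (snd z) i)\<^sup>2)) \<in> borel_measurable (lborel \<Otimes>\<^sub>M M)"
    by measurable
  have S': "(\<lambda>x. ennreal ((\<Sum>i\<in>{q..<q + 2 ^ Suc k}. ?Z x \<omega> i)\<^sup>2)) \<in> borel_measurable lborel" if "\<omega> \<in> space M" for \<omega>
    using measurable_compose[OF measurable_Pair2'[OF that] S] by simp
  have ME: "(\<lambda>\<omega>. \<integral>\<^sup>+x. ennreal (dyadic_energy (?Z x \<omega>) k q) \<partial>lborel) \<in> borel_measurable M" for k q
    using lborel.borel_measurable_nn_integral[of "\<lambda>\<omega> x. ennreal (dyadic_energy (?Z x \<omega>) k q)" M]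
      measurable_compose[OF measurable_pair_swap' E[of k q]] by (simp add: split_beta')
  have MS: "(\<lambda>\<omega>. \<integral>\<^sup>+x. ennreal ((\<Sum>i\<in>{q..<q + 2 ^ Suc k}. ?Z x \<omega> i)\<^sup>2) \<partial>lborel) \<in> borel_measurable M"
    using lborel.borel_measurable_nn_integral[of "\<lambda>\<omega> x. ennreal ((\<Sum>i\<in>{q..<q + 2 ^ Suc k}. ?Z x \<omega> i)\<^sup>2)" M]
      measurable_compose[OF measurable_pair_swap' S] by (simp add: split_beta')
  have "(\<integral>\<^sup>+\<omega>. (\<integral>\<^sup>+x. ennreal (dyadic_energy (?Z x \<omega>) (Suc k) q) \<partial>lborel) \<partial>M)
    = (\<integral>\<^sup>+\<omega>. (\<integral>\<^sup>+x. ennreal (dyadic_energy (?Z x \<omega>) k q) \<partial>lborel) +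
        (\<integral>\<^sup>+x. ennreal (dyadic_energy (?Z x \<omega>) k (q + 2 ^ k)) \<partial>lborel) +
        (\<integral>\<^sup>+x. ennreal ((\<Sum>i\<in>{q..<q + 2 ^ Suc k}. ?Z x \<omega> i)\<^sup>2) \<partial>lborel) \<partial>M)"
  proof (rule nn_integral_cong)
    fix \<omega> assume w: "\<omega> \<in> space M"
    show "(\<integral>\<^sup>+x. ennreal (dyadic_energy (?Z x \<omega>) (Suc k) q) \<partial>lborel) =
        (\<integral>\<^sup>+x. ennreal (dyadic_energy (?Z x \<omega>) k q) \<partial>lborel) +
        (\<integral>\<^sup>+x. ennreal (dyadic_energy (?Z x \<omega>) k (q + 2 ^ k)) \<partial>lborel) +
        (\<integral>\<^sup>+x. ennreal ((\<Sum>i\<in>{q..<q + 2 ^ Suc k}. ?Z x \<omega> i)\<^sup>2) \<partial>lborel)"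
      using E'[OF w] S'[OF w]
      by (simp only: dyadic_energy.simps ennreal_plus dyadic_energy_nonneg add_nonneg_nonneg zero_le_power2
          nn_integral_add borel_measurable_add)
  qed
  also have "\<dots> = (\<integral>\<^sup>+\<omega>. (\<integral>\<^sup>+x. ennreal (dyadic_energy (?Z x \<omega>) k q) \<partial>lborel) \<partial>M) +
        (\<integral>\<^sup>+\<omega>. (\<integral>\<^sup>+x. ennreal (dyadic_energy (?Z x \<omega>) k (q + 2 ^ k)) \<partial>lborel) \<partial>M) +
        (\<integral>\<^sup>+\<omega>. (\<integral>\<^sup>+x. ennreal ((\<Sum>i\<in>{q..<q + 2 ^ Suc k}. ?Z x \<omega> i)\<^sup>2) \<partial>lborel) \<partial>M)"
    using ME MS by (simp only: nn_integral_add borel_measurable_add)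
  also have "\<dots> \<le> ennreal (V * (real (Suc k) * 2 ^ k)) + ennreal (V * (real (Suc k) * 2 ^ k)) + ennreal (V * real (2 ^ Suc k))"
    unfolding V_def by (intro add_mono Suc.IH smooth_block_variance lip b)
  also have "\<dots> = ennreal (V * (real (Suc (Suc k)) * 2 ^ Suc k))"
    using V by (simp add: ennreal_plus[symmetric] del: ennreal_plus) (simp add: algebra_simps)
  finally show ?case unfolding V_def .
qed

text \<open>Integrability of one weighted series over all dyadic scales bounds every scale at once,
  off a single null set; an arbitrary \<open>n\<close> is then enclosed in a nearby power of
  two.\<close>

lemma AE_smooth_dev_bound:
  assumes lip: "L2_lipschitz c \<phi>" and b: "summable (\<lambda>k. \<bar>b k\<bar>)"
  shows "AE \<omega> in M. \<exists>C\<ge>0. \<forall>n\<ge>1.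
    (\<integral>\<^sup>+x. ennreal ((\<Sum>i=1..n. smooth_dev \<phi> b s i x \<omega>)\<^sup>2) \<partial>lborel) \<le> ennreal (C * real n powr (6/5))"
proof -
  note [measurable] = L2_lipschitzD(1)[OF lip]
  define V where "V = c\<^sup>2 * s2 * (\<Sum>k. \<bar>b k\<bar>)\<^sup>2"
  have V: "0 \<le> V" unfolding V_def using s2_nonneg by simp
  let ?Z = "\<lambda>x \<omega> i. smooth_dev \<phi> b s i x \<omega>"
  have E [measurable]: "(\<lambda>z. ennreal (dyadic_energy (?Z (fst z) (snd z)) k q)) \<in> borel_measurable (lborel \<Otimes>\<^sub>M M)" for k q
    using smooth_dyadic_energy_measurable[of \<phi> b s k q] by measurable
  have E': "(\<lambda>x. ennreal (dyadic_energy (?Z x \<omega>) k q)) \<in> borel_measurable lborel" if "\<omega> \<in> space M" for k q \<omega>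
    using measurable_compose[OF measurable_Pair2'[OF that] E[of k q]] by simp
  define W where "W k \<omega> = (\<integral>\<^sup>+x. ennreal (dyadic_energy (?Z x \<omega>) k 1) \<partial>lborel)" for k \<omega>
  have W [measurable]: "W k \<in> borel_measurable M" for k unfolding W_def
    using lborel.borel_measurable_nn_integral[of "\<lambda>\<omega> x. ennreal (dyadic_energy (?Z x \<omega>) k 1)" M]
      measurable_compose[OF measurable_pair_swap' E[of k 1]] by (simp add: split_beta')
  \<comment> \<open>The factor \<open>real k + 1\<close> is the loss in passing from dyadic energies
    to partial sums. The power makes the expectations, of order (k+1) 2^k, summable: the weighted
    terms are of order (k+1)^2 2^(-k/5).\<close>
  define w where "w k = (real k + 1) * 2 powr (- (6 / 5) * real k)" for k
  have w: "0 < w k" for k by (simp add: w_def)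
  have "(\<integral>\<^sup>+\<omega>. (\<Sum>k. ennreal (w k) * W k \<omega>) \<partial>M) = (\<Sum>k. ennreal (w k) * (\<integral>\<^sup>+\<omega>. W k \<omega> \<partial>M))"
    by (simp add: nn_integral_suminf nn_integral_cmult)
  also have "\<dots> \<le> (\<Sum>k. ennreal (w k) * ennreal (V * (real (Suc k) * 2 ^ k)))"
    unfolding W_def V_def by (intro suminf_le mult_left_mono smooth_dyadic_energy lip b) auto
  also have "\<dots> = (\<Sum>k. ennreal (V * ((real k + 1) ^ 2 * 2 powr (- real k / 5))))"
  proof (intro suminf_cong)
    fix k
    have "2 powr (- (6 / 5) * real k) * 2 ^ k = (2::real) powr (- real k / 5)"
      by (simp add: powr_realpow[symmetric] powr_add[symmetric])
    then have "w k * (V * (real (Suc k) * 2 ^ k)) = V * ((real k + 1) ^ 2 * 2 powr (- real k / 5))"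
      unfolding w_def by (simp add: power2_eq_square algebra_simps)
    then show "ennreal (w k) * ennreal (V * (real (Suc k) * 2 ^ k)) = ennreal (V * ((real k + 1) ^ 2 * 2 powr (- real k / 5)))"
      using w[of k] V by (simp add: ennreal_mult[symmetric] del: of_nat_Suc)
  qed
  also have "\<dots> < \<infinity>"
    using V summable_mult[OF summable_poly_exp, of V] by (subst suminf_ennreal2) auto
  finally have "AE \<omega> in M. (\<Sum>k. ennreal (w k) * W k \<omega>) \<noteq> \<infinity>"
    by (intro nn_integral_PInf_AE) auto
  then show ?thesis
    using AE_space
  proof eventually_elim
    case (elim \<omega>)
    then obtain C where C: "(\<Sum>k. ennreal (w k) * W k \<omega>) = ennreal C" "0 \<le> C"
      by (cases "\<Sum>k. ennreal (w k) * W k \<omega>") auto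
    have Wk: "ennreal (real (Suc k)) * W k \<omega> \<le> ennreal (C * 2 powr (6 / 5 * real k))" for k
    proof -
      have "ennreal (w k) * W k \<omega> \<le> (\<Sum>k. ennreal (w k) * W k \<omega>)"
        using sum_le_suminf[of "\<lambda>k. ennreal (w k) * W k \<omega>" "{k}"] by simp
      then have "ennreal (2 powr (6 / 5 * real k)) * (ennreal (w k) * W k \<omega>) \<le> ennreal (2 powr (6 / 5 * real k)) * ennreal C"
        unfolding C by (rule mult_left_mono) simp
      moreover have "ennreal (2 powr (6 / 5 * real k)) * ennreal (w k) = ennreal (real (Suc k))"
      proof -
        have "2 powr (6 / 5 * real k) * 2 powr (- (6 / 5) * real k) = (1::real)"
          by (simp add: powr_add[symmetric])
        then have "2 powr (6 / 5 * real k) * w k = real (Suc k)"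
          unfolding w_def by (simp add: algebra_simps)
        then show ?thesis using w[of k] by (simp add: ennreal_mult[symmetric] del: of_nat_Suc)
      qed
      ultimately have "ennreal (real (Suc k)) * W k \<omega> \<le> ennreal (2 powr (6 / 5 * real k)) * ennreal C"
        by (simp only: mult.assoc[symmetric])
      then show ?thesis
        using C(2) by (simp only: ennreal_mult[symmetric] powr_ge_zero mult.commute)
    qed
    show ?case
    proof (intro exI[of _ "C * 2 powr (6/5)"] conjI allI impI)
      fix n :: nat assume "1 \<le> n"
      \<comment> \<open>Rounding \<open>n\<close> up to at most \<open>2 * n\<close> costs the
        constant \<open>2 powr (6/5)\<close>.\<close>
      then obtain k where k: "n \<le> 2 ^ k" "2 ^ k \<le> 2 * n" using ex_power2_between by blast
      have "(\<integral>\<^sup>+x. ennreal ((\<Sum>i=1..n. ?Z x \<omega> i)\<^sup>2) \<partial>lborel)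
          \<le> (\<integral>\<^sup>+x. ennreal (real (Suc k)) * ennreal (dyadic_energy (?Z x \<omega>) k 1) \<partial>lborel)"
      proof (intro nn_integral_mono)
        fix x
        have "{1..n} = {1..<1 + n}" by auto
        then show "ennreal ((\<Sum>i=1..n. ?Z x \<omega> i)\<^sup>2) \<le> ennreal (real (Suc k)) * ennreal (dyadic_energy (?Z x \<omega>) k 1)"
          using partial_sum_le_dyadic_energy[OF k(1), of "?Z x \<omega>" 1]
          by (simp add: ennreal_mult[symmetric] dyadic_energy_nonneg ennreal_leI del: of_nat_Suc)
      qed
      also have "\<dots> = ennreal (real (Suc k)) * W k \<omega>"
        unfolding W_def using E'[OF elim(2)] by (rule nn_integral_cmult)
      also have "\<dots> \<le> ennreal (C * 2 powr (6 / 5 * real k))" by (rule Wk)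
      also have "\<dots> \<le> ennreal (C * 2 powr (6/5) * real n powr (6/5))"
      proof (rule ennreal_leI)
        have "2 powr (6 / 5 * real k) = (2 powr real k) powr (6/5)"
          by (simp add: powr_powr mult.commute)
        also have "\<dots> \<le> (2 * real n) powr (6/5)"
          using k(2) by (intro powr_mono2) (auto simp: powr_realpow of_nat_le_iff[where 'a=real, symmetric] simp del: of_nat_le_iff)
        finally show "C * 2 powr (6 / 5 * real k) \<le> C * 2 powr (6/5) * real n powr (6/5)"
          using C(2) by (simp add: powr_mult mult.assoc mult_left_mono)
      qed
      finally show "(\<integral>\<^sup>+x. ennreal ((\<Sum>i=1..n. ?Z x \<omega> i)\<^sup>2) \<partial>lborel) \<le> ennreal (C * 2 powr (6/5) * real n powr (6/5))" .
    qed (use C in auto)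
  qed
qed

end

section \<open>Exponential moments of the martingale part\<close>

lemma integral_square_bound:
  fixes g :: "'b \<Rightarrow> real"
  assumes [measurable]: "g \<in> borel_measurable N" and "(\<integral>\<^sup>+x. ennreal ((g x)\<^sup>2) \<partial>N) \<le> ennreal B" "0 \<le> B"
  shows "integrable N (\<lambda>x. (g x)\<^sup>2)" "(\<integral>x. (g x)\<^sup>2 \<partial>N) \<le> B"
proof -
  show i: "integrable N (\<lambda>x. (g x)\<^sup>2)"
    using assms(2) by (intro integrableI_nonneg) (auto intro: le_less_trans)
  show "(\<integral>x. (g x)\<^sup>2 \<partial>N) \<le> B"
    using assms nn_integral_eq_integral[OF i] by simp
qed

lemma Cauchy_Schwarz_integral:
  fixes f g :: "'b \<Rightarrow> real"
  assumes [measurable]: "f \<in> borel_measurable N" "g \<in> borel_measurable N"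
    and f: "integrable N (\<lambda>x. (f x)\<^sup>2)" and g: "integrable N (\<lambda>x. (g x)\<^sup>2)"
  shows "integrable N (\<lambda>x. f x * g x)"
    "\<bar>\<integral>x. f x * g x \<partial>N\<bar> \<le> sqrt ((\<integral>x. (f x)\<^sup>2 \<partial>N) * (\<integral>x. (g x)\<^sup>2 \<partial>N))"
    "(\<integral>x. \<bar>f x * g x\<bar> \<partial>N) \<le> sqrt ((\<integral>x. (f x)\<^sup>2 \<partial>N) * (\<integral>x. (g x)\<^sup>2 \<partial>N))"
proof -
  show i: "integrable N (\<lambda>x. f x * g x)"
  proof (rule Bochner_Integration.integrable_bound)
    show "integrable N (\<lambda>x. (f x)\<^sup>2 + (g x)\<^sup>2)" using f g by simp
    have "\<bar>f x * g x\<bar> \<le> (f x)\<^sup>2 + (g x)\<^sup>2" for x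
    proof -
      have "0 \<le> (\<bar>f x\<bar> - \<bar>g x\<bar>)\<^sup>2 + (f x)\<^sup>2 + (g x)\<^sup>2" by simp
      then show ?thesis by (simp add: power2_eq_square abs_mult algebra_simps)
    qed
    then show "AE x in N. norm (f x * g x) \<le> norm ((f x)\<^sup>2 + (g x)\<^sup>2)" by simp
  qed simp
  have "(\<integral>\<^sup>+x. ennreal \<bar>f x\<bar> * ennreal \<bar>g x\<bar> \<partial>N)\<^sup>2 \<le> (\<integral>\<^sup>+x. (ennreal \<bar>f x\<bar>)\<^sup>2 \<partial>N) * (\<integral>\<^sup>+x. (ennreal \<bar>g x\<bar>)\<^sup>2 \<partial>N)"
    by (rule Cauchy_Schwarz_nn_integral) auto
  also have "\<dots> = ennreal ((\<integral>x. (f x)\<^sup>2 \<partial>N) * (\<integral>x. (g x)\<^sup>2 \<partial>N))"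
    using f g by (simp add: ennreal_power nn_integral_eq_integral ennreal_mult)
  also have "(\<integral>\<^sup>+x. ennreal \<bar>f x\<bar> * ennreal \<bar>g x\<bar> \<partial>N) = (\<integral>\<^sup>+x. ennreal \<bar>f x * g x\<bar> \<partial>N)"
    by (simp add: abs_mult ennreal_mult)
  also have "\<dots> = ennreal (\<integral>x. \<bar>f x * g x\<bar> \<partial>N)"
    using i by (intro nn_integral_eq_integral) auto
  finally have "(\<integral>x. \<bar>f x * g x\<bar> \<partial>N)\<^sup>2 \<le> (\<integral>x. (f x)\<^sup>2 \<partial>N) * (\<integral>x. (g x)\<^sup>2 \<partial>N)"
    by (simp add: ennreal_power)
  then show "(\<integral>x. \<bar>f x * g x\<bar> \<partial>N) \<le> sqrt ((\<integral>x. (f x)\<^sup>2 \<partial>N) * (\<integral>x. (g x)\<^sup>2 \<partial>N))"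
    by (rule real_le_rsqrt)
  then show "\<bar>\<integral>x. f x * g x \<partial>N\<bar> \<le> sqrt ((\<integral>x. (f x)\<^sup>2 \<partial>N) * (\<integral>x. (g x)\<^sup>2 \<partial>N))"
    using integral_abs_bound[of N "\<lambda>x. f x * g x"] by linarith
qed

text \<open>Expanding the square leaves a cross term \<open>2 * J v\<close> with \<open>J\<close>
  centred and bounded by \<open>sqrt (S * b)\<close>. Hoeffding's lemma turns it into a multiple of
  \<open>S\<close>, so the increment is traded for the larger parameter
  \<open>t + 2 * t\<^sup>2 * b\<close> in front of the old squared norm.\<close>

lemma (in prob_space) exp_square_norm_step:
  fixes s :: "real \<Rightarrow> real" and d :: "real \<Rightarrow> 'a \<Rightarrow> real"
  assumes s [measurable]: "s \<in> borel_measurable borel" and s2: "integrable lborel (\<lambda>x. (s x)\<^sup>2)"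
    and d [measurable]: "case_prod d \<in> borel_measurable (lborel \<Otimes>\<^sub>M M)"
    and d2: "\<And>v. v \<in> space M \<Longrightarrow> (\<integral>\<^sup>+x. ennreal ((d x v)\<^sup>2) \<partial>lborel) \<le> ennreal b" and b: "0 \<le> b"
    and mean: "\<And>x. (\<integral>v. d x v \<partial>M) = 0"
    and t: "0 < t"
  shows "(\<integral>\<^sup>+v. ennreal (exp (t * (\<integral>x. (s x + d x v)\<^sup>2 \<partial>lborel))) \<partial>M)
     \<le> ennreal (exp (t * b)) * ennreal (exp ((t + 2 * t\<^sup>2 * b) * (\<integral>x. (s x)\<^sup>2 \<partial>lborel)))"
proof -
  interpret LM: pair_sigma_finite lborel M ..
  define S where "S = (\<integral>x. (s x)\<^sup>2 \<partial>lborel)"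
  have S: "0 \<le> S" unfolding S_def by simp
  define c where "c = sqrt (S * b)"
  define J where "J v = (\<integral>x. s x * d x v \<partial>lborel)" for v
  have dm: "(\<lambda>x. d x v) \<in> borel_measurable lborel" if "v \<in> space M" for v
    using measurable_compose[OF measurable_Pair2'[OF that] d] by simp
  have dm': "(\<lambda>v. d x v) \<in> borel_measurable M" for x
    using measurable_compose[OF measurable_Pair1'[of x lborel M] d] by simp
  have di: "integrable lborel (\<lambda>x. (d x v)\<^sup>2)" "(\<integral>x. (d x v)\<^sup>2 \<partial>lborel) \<le> b" if "v \<in> space M" for v
    using integral_square_bound[OF dm[OF that] d2[OF that] b] by auto
  have sdi: "integrable lborel (\<lambda>x. s x * d x v)" and Jc: "\<bar>J v\<bar> \<le> c" and absJ: "(\<integral>x. \<bar>s x * d x v\<bar> \<partial>lborel) \<le> c"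
    if v: "v \<in> space M" for v
  proof -
    have sm: "s \<in> borel_measurable lborel" by simp
    note cs = Cauchy_Schwarz_integral[OF sm dm[OF v] s2 di(1)[OF v]]
    show "integrable lborel (\<lambda>x. s x * d x v)" by (rule cs(1))
    have "sqrt (S * (\<integral>x. (d x v)\<^sup>2 \<partial>lborel)) \<le> c"
      unfolding c_def using di(2)[OF v] S by (intro real_sqrt_le_mono mult_left_mono) auto
    then show "\<bar>J v\<bar> \<le> c" "(\<integral>x. \<bar>s x * d x v\<bar> \<partial>lborel) \<le> c"
      using cs(2,3) unfolding J_def S_def by linarith+
  qed
  have sd [measurable]: "(\<lambda>(x, v). s x * d x v) \<in> borel_measurable (lborel \<Otimes>\<^sub>M M)" by measurable
  have Jm [measurable]: "J \<in> borel_measurable M" unfolding J_def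
    using measurable_compose[OF measurable_pair_swap' sd]
    by (intro lborel.borel_measurable_lebesgue_integral) (simp add: split_beta')
  \<comment> \<open>The mean in \<open>v\<close> is zero for each fixed \<open>x\<close>; absolute
    integrability on the product permits exchanging it with the integral over \<open>x\<close>,
    which gives \<open>EJ\<close>.\<close>
  have int: "integrable (lborel \<Otimes>\<^sub>M M) (\<lambda>(x, v). s x * d x v)"
  proof (rule integrableI_bounded[OF sd])
    have "(\<integral>\<^sup>+z. ennreal (norm (case z of (x, v) \<Rightarrow> s x * d x v)) \<partial>(lborel \<Otimes>\<^sub>M M))
        = (\<integral>\<^sup>+v. (\<integral>\<^sup>+x. ennreal \<bar>s x * d x v\<bar> \<partial>lborel) \<partial>M)"
      by (subst LM.nn_integral_snd[symmetric]) auto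
    also have "\<dots> \<le> (\<integral>\<^sup>+v. ennreal c \<partial>M)"
    proof (rule nn_integral_mono)
      fix v assume v: "v \<in> space M"
      show "(\<integral>\<^sup>+x. ennreal \<bar>s x * d x v\<bar> \<partial>lborel) \<le> ennreal c"
        using absJ[OF v] sdi[OF v] by (subst nn_integral_eq_integral) (auto intro: ennreal_leI)
    qed
    also have "\<dots> < \<infinity>" by (simp add: emeasure_space_1)
    finally show "(\<integral>\<^sup>+z. ennreal (norm (case z of (x, v) \<Rightarrow> s x * d x v)) \<partial>(lborel \<Otimes>\<^sub>M M)) < \<infinity>" .
  qed
  have EJ: "expectation J = 0"
  proof -
    have "expectation J = (\<integral>x. (\<integral>v. s x * d x v \<partial>M) \<partial>lborel)"
      unfolding J_def by (rule LM.Fubini_integral[OF int])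
    also have "\<dots> = 0" by (simp add: mean)
    finally show ?thesis .
  qed
  interpret interval_bounded_random_variable M J "-c" c
    by unfold_locales (use Jc in \<open>auto simp: abs_le_iff minus_le_iff intro!: AE_I2\<close>)
  have hoeff: "(\<integral>\<^sup>+v. ennreal (exp (2 * t * J v)) \<partial>M) \<le> ennreal (exp (2 * t\<^sup>2 * (S * b)))"
  proof -
    \<comment> \<open>The interval from -c to c has length \<open>2 * c\<close>, so Hoeffding's
      exponent is (2t)^2 (2c)^2 / 8.\<close>
    have "(2 * t)\<^sup>2 * (c - - c)\<^sup>2 / 8 = 2 * t\<^sup>2 * c\<^sup>2" by (simp add: power2_eq_square)
    also have "c\<^sup>2 = S * b" unfolding c_def using S b by simp
    finally have eq: "(2 * t)\<^sup>2 * (c - - c)\<^sup>2 / 8 = 2 * t\<^sup>2 * (S * b)" .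
    show ?thesis using Hoeffdings_lemma_nn_integral_0[of "2 * t", OF _ EJ] t unfolding eq by simp
  qed
  have "(\<integral>\<^sup>+v. ennreal (exp (t * (\<integral>x. (s x + d x v)\<^sup>2 \<partial>lborel))) \<partial>M)
      \<le> (\<integral>\<^sup>+v. ennreal (exp (t * S + t * b)) * ennreal (exp (2 * t * J v)) \<partial>M)"
  proof (rule nn_integral_mono)
    fix v assume v: "v \<in> space M"
    have "(\<integral>x. (s x + d x v)\<^sup>2 \<partial>lborel) = (\<integral>x. (s x)\<^sup>2 + 2 * (s x * d x v) + (d x v)\<^sup>2 \<partial>lborel)"
      by (simp add: power2_eq_square algebra_simps)
    also have "\<dots> = S + 2 * J v + (\<integral>x. (d x v)\<^sup>2 \<partial>lborel)"
      unfolding S_def J_def using s2 sdi[OF v] di(1)[OF v] by simp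
    also have "\<dots> \<le> S + 2 * J v + b" using di(2)[OF v] by simp
    finally have "t * (\<integral>x. (s x + d x v)\<^sup>2 \<partial>lborel) \<le> t * (S + 2 * J v + b)"
      using t by (intro mult_left_mono) auto
    also have "\<dots> = (t * S + t * b) + 2 * t * J v" by (simp add: algebra_simps)
    finally show "ennreal (exp (t * (\<integral>x. (s x + d x v)\<^sup>2 \<partial>lborel)))
        \<le> ennreal (exp (t * S + t * b)) * ennreal (exp (2 * t * J v))"
      by (simp add: ennreal_mult[symmetric] exp_add[symmetric] ennreal_leI)
  qed
  also have "\<dots> = ennreal (exp (t * S + t * b)) * (\<integral>\<^sup>+v. ennreal (exp (2 * t * J v)) \<partial>M)"
    by (rule nn_integral_cmult) simp
  also have "\<dots> \<le> ennreal (exp (t * S + t * b)) * ennreal (exp (2 * t\<^sup>2 * (S * b)))"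
    by (intro mult_left_mono hoeff) simp
  also have "\<dots> = ennreal (exp (t * b)) * ennreal (exp ((t + 2 * t\<^sup>2 * b) * S))"
    by (simp add: ennreal_mult[symmetric] exp_add[symmetric] algebra_simps)
  finally show ?thesis unfolding S_def .
qed

context iid_innovations
begin

text \<open>
  The index shift \<open>s\<close> accounts for leading zero coefficients of the linear process: the innovation that
  enters at time \<open>i\<close> is \<open>eps (i - s)\<close>, and the past part starts at \<open>eps (i - s - 1)\<close>.
\<close>

definition mart_diff :: "(real \<Rightarrow> real) \<Rightarrow> real \<Rightarrow> (nat \<Rightarrow> real) \<Rightarrow> int \<Rightarrow> nat \<Rightarrow> real \<Rightarrow> 'a \<Rightarrow> real \<Rightarrow> real" where
  "mart_diff k a0 b s i x \<omega> v =
     k (x - lin b (int i - s - 1) \<omega> - a0 * v) - (\<integral>v. k (x - lin b (int i - s - 1) \<omega> - a0 * v) \<partial>law)"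

definition mart_sum :: "(real \<Rightarrow> real) \<Rightarrow> real \<Rightarrow> (nat \<Rightarrow> real) \<Rightarrow> int \<Rightarrow> nat \<Rightarrow> real \<Rightarrow> 'a \<Rightarrow> real" where
  "mart_sum k a0 b s n x \<omega> = (\<Sum>i=1..n. mart_diff k a0 b s i x \<omega> (eps (int i - s) \<omega>))"

text \<open>A deterministic bound, valid for every past and every \<open>v\<close>: translation
  preserves the L^2 norm and averaging does not increase it. The 4 comes from (p - q)^2 <= 2 p^2 + 2
  q^2.\<close>

lemma mart_diff_L2:
  assumes [measurable]: "k \<in> borel_measurable borel" and k2: "(\<integral>\<^sup>+x. ennreal ((k x)\<^sup>2) \<partial>lborel) \<le> ennreal J" and J: "0 \<le> J"
  shows "(\<integral>\<^sup>+x. ennreal ((mart_diff k a0 b s i x \<omega> v)\<^sup>2) \<partial>lborel) \<le> ennreal (4 * J)"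
proof -
  interpret law: prob_space law by (rule prob_space_law)
  interpret PL: pair_sigma_finite law lborel ..
  define y where "y = lin b (int i - s - 1) \<omega>"
  have shift: "(\<integral>\<^sup>+x. ennreal ((k (x - z))\<^sup>2) \<partial>lborel) \<le> ennreal J" for z
  proof -
    have "(\<integral>\<^sup>+x. ennreal ((k x)\<^sup>2) \<partial>lborel) = (\<integral>\<^sup>+x. ennreal ((k (x - z))\<^sup>2) \<partial>lborel)"
      using nn_integral_real_affine[of "\<lambda>x. ennreal ((k x)\<^sup>2)" 1 "-z"] by simp
    then show ?thesis using k2 by simp
  qed
  have avg: "(\<integral>\<^sup>+x. ennreal ((\<integral>v. k (x - y - a0 * v) \<partial>law)\<^sup>2) \<partial>lborel) \<le> ennreal J"
  proof -
    have "(\<integral>\<^sup>+x. ennreal ((\<integral>v. k (x - y - a0 * v) \<partial>law)\<^sup>2) \<partial>lborel)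
        \<le> (\<integral>\<^sup>+x. (\<integral>\<^sup>+v. ennreal ((k (x - y - a0 * v))\<^sup>2) \<partial>law) \<partial>lborel)"
      by (intro nn_integral_mono law.square_expectation_le) auto
    also have "\<dots> = (\<integral>\<^sup>+v. (\<integral>\<^sup>+x. ennreal ((k (x - y - a0 * v))\<^sup>2) \<partial>lborel) \<partial>law)"
      by (rule PL.Fubini') simp
    also have "\<dots> \<le> (\<integral>\<^sup>+v. ennreal J \<partial>law)"
      by (rule nn_integral_mono) (simp add: diff_diff_eq shift)
    finally show ?thesis by simp
  qed
  have "(\<integral>\<^sup>+x. ennreal ((mart_diff k a0 b s i x \<omega> v)\<^sup>2) \<partial>lborel)
      \<le> (\<integral>\<^sup>+x. 2 * ennreal ((k (x - y - a0 * v))\<^sup>2) + 2 * ennreal ((\<integral>v. k (x - y - a0 * v) \<partial>law)\<^sup>2) \<partial>lborel)"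
  proof (rule nn_integral_mono)
    fix x
    have sq: "(p - q)\<^sup>2 \<le> 2 * p\<^sup>2 + 2 * q\<^sup>2" for p q :: real
      using zero_le_power2[of "p + q"] by (simp add: power2_eq_square algebra_simps)
    have "ennreal ((mart_diff k a0 b s i x \<omega> v)\<^sup>2)
        \<le> ennreal (2 * (k (x - y - a0 * v))\<^sup>2 + 2 * (\<integral>v. k (x - y - a0 * v) \<partial>law)\<^sup>2)"
      unfolding mart_diff_def y_def[symmetric] by (intro ennreal_leI sq)
    then show "ennreal ((mart_diff k a0 b s i x \<omega> v)\<^sup>2)
        \<le> 2 * ennreal ((k (x - y - a0 * v))\<^sup>2) + 2 * ennreal ((\<integral>v. k (x - y - a0 * v) \<partial>law)\<^sup>2)"
      by (simp add: ennreal_mult)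
  qed
  also have "\<dots> = 2 * (\<integral>\<^sup>+x. ennreal ((k (x - y - a0 * v))\<^sup>2) \<partial>lborel) + 2 * (\<integral>\<^sup>+x. ennreal ((\<integral>v. k (x - y - a0 * v) \<partial>law)\<^sup>2) \<partial>lborel)"
    by (simp add: nn_integral_add nn_integral_cmult)
  also have "\<dots> \<le> 2 * ennreal J + 2 * ennreal J"
    using shift[of "y + a0 * v"] avg by (intro add_mono mult_left_mono) (auto simp: diff_diff_eq)
  also have "\<dots> = ennreal (4 * J)"
  proof -
    have "2 * ennreal J = ennreal (2 * J)" using J by (simp add: ennreal_mult)
    then show ?thesis using J by (simp add: ennreal_plus[symmetric] del: ennreal_plus)
  qed
  finally show ?thesis .
qed

lemma mart_diff_mean:
  assumes [measurable]: "k \<in> borel_measurable borel" and B: "\<And>x. \<bar>k x\<bar> \<le> B"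
  shows "(\<integral>v. mart_diff k a0 b s i x \<omega> v \<partial>law) = 0"
proof -
  interpret law: prob_space law by (rule prob_space_law)
  have "integrable law (\<lambda>v. k (y - a0 * v))" for y
    using B by (intro law.integrable_const_bound[where B=B]) auto
  then show ?thesis unfolding mart_diff_def using law.prob_space by simp
qed

lemma mart_sum_L2:
  assumes k [measurable]: "k \<in> borel_measurable borel" and k2: "(\<integral>\<^sup>+x. ennreal ((k x)\<^sup>2) \<partial>lborel) \<le> ennreal J" and J: "0 \<le> J"
  shows "integrable lborel (\<lambda>x. (mart_sum k a0 b s n x \<omega>)\<^sup>2)"
proof -
  interpret law: prob_space law by (rule prob_space_law)
  have [measurable]: "(\<lambda>x. mart_diff k a0 b s i x \<omega> v) \<in> borel_measurable borel" for i v
    unfolding mart_diff_def by measurable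
  have int: "integrable lborel (\<lambda>x. (mart_diff k a0 b s i x \<omega> v)\<^sup>2)" for i v
    using J mart_diff_L2[OF k k2 J, of a0 b s i \<omega> v] by (intro integral_square_bound(1)[where B="4 * J"]) auto
  show ?thesis
  proof (rule Bochner_Integration.integrable_bound)
    show "integrable lborel (\<lambda>x. real n * (\<Sum>i=1..n. (mart_diff k a0 b s i x \<omega> (eps (int i - s) \<omega>))\<^sup>2))"
      using int by simp
    show "AE x in lborel. norm ((mart_sum k a0 b s n x \<omega>)\<^sup>2)
        \<le> norm (real n * (\<Sum>i=1..n. (mart_diff k a0 b s i x \<omega> (eps (int i - s) \<omega>))\<^sup>2))"
    proof (rule AE_I2)
      fix x
      show "norm ((mart_sum k a0 b s n x \<omega>)\<^sup>2)
        \<le> norm (real n * (\<Sum>i=1..n. (mart_diff k a0 b s i x \<omega> (eps (int i - s) \<omega>))\<^sup>2))"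
        using Cauchy_Schwarz_ineq_sum[of "\<lambda>_. 1" "\<lambda>i. mart_diff k a0 b s i x \<omega> (eps (int i - s) \<omega>)" "{1..n}"]
        unfolding mart_sum_def by (simp add: sum_nonneg)
    qed
    show "(\<lambda>x. (mart_sum k a0 b s n x \<omega>)\<^sup>2) \<in> borel_measurable lborel"
      unfolding mart_sum_def by measurable
  qed
qed

text \<open>
  Removing the last of \<open>n\<close> increments turns \<open>t\<close> into \<open>t + 8 t\<^sup>2 J\<close>; the condition
  \<open>16 n t J \<le> 1\<close> is preserved with \<open>n - 1\<close> in place of \<open>n\<close>.
\<close>

lemma mart_sum_exp_moment:
  assumes k [measurable]: "k \<in> borel_measurable borel" and B: "\<And>x. \<bar>k x\<bar> \<le> B"
    and k2: "(\<integral>\<^sup>+x. ennreal ((k x)\<^sup>2) \<partial>lborel) \<le> ennreal J" and J: "0 \<le> J"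
    and t: "0 < t" "16 * real n * t * J \<le> 1"
  shows "(\<integral>\<^sup>+\<omega>. ennreal (exp (t * (\<integral>x. (mart_sum k a0 b s n x \<omega>)\<^sup>2 \<partial>lborel))) \<partial>M) \<le> ennreal (exp (8 * t * real n * J))"
  using t
proof (induction n arbitrary: t)
  case 0
  then show ?case by (simp add: mart_sum_def emeasure_space_1)
next
  case (Suc n)
  interpret law: prob_space law by (rule prob_space_law)
  define p where "p = int (Suc n) - s"
  \<comment> \<open>The bound on the squared norm of a single increment; in terms of it the
    condition on \<open>t\<close> reads \<open>4 * (real n + 1) * (t * c) \<le> 1\<close>.\<close>
  define c where "c = 4 * J"
  have c: "0 \<le> c" using J by (simp add: c_def)
  have meas_lin: "lin b (int i - s - 1) \<in> borel_measurable (past p)" if "i \<le> Suc n" for i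
    using that by (intro lin_measurable_past) (auto simp: p_def)
  note [measurable] = meas_lin
  have [measurable]: "eps (int i - s) \<in> borel_measurable (past p)" if "i \<le> n" for i
    using that by (intro eps_measurable_past) (auto simp: p_def)
  have eq: "mart_sum k a0 b s (Suc n) x \<omega> = mart_sum k a0 b s n x \<omega> + mart_diff k a0 b s (Suc n) x \<omega> (eps p \<omega>)" for x \<omega>
    by (simp add: mart_sum_def p_def)
  have mS: "(\<lambda>(\<omega>, x). mart_sum k a0 b s n x \<omega>) \<in> borel_measurable (past p \<Otimes>\<^sub>M borel)"
    unfolding mart_sum_def mart_diff_def by measurable
  note [measurable] = mS
  have D1: "(\<lambda>(x, v). mart_diff k a0 b s (Suc n) x \<omega> v) \<in> borel_measurable (lborel \<Otimes>\<^sub>M law)" for \<omega>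
    unfolding mart_diff_def by measurable
  have S1: "(\<lambda>x. mart_sum k a0 b s n x \<omega>) \<in> borel_measurable borel" for \<omega>
    unfolding mart_sum_def mart_diff_def by measurable
  have meas: "(\<lambda>(\<omega>, v). ennreal (exp (t * (\<integral>x. (mart_sum k a0 b s n x \<omega> + mart_diff k a0 b s (Suc n) x \<omega> v)\<^sup>2 \<partial>lborel))))
      \<in> borel_measurable (past p \<Otimes>\<^sub>M borel)"
    unfolding mart_diff_def using meas_lin[of "Suc n"] by measurable
  define t' where "t' = t + 2 * t\<^sup>2 * c"
  have t: "0 < t" "4 * (real n + 1) * (t * c) \<le> 1" using Suc.prems by (auto simp: c_def algebra_simps)
  have tc: "0 \<le> t * c" using t c by simp
  have t': "0 < t'" using t c unfolding t'_def by (intro add_pos_nonneg) auto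
  have t'c: "t' * c = t * c * (1 + 2 * (t * c))" unfolding t'_def by (simp add: power2_eq_square algebra_simps)
  have tn: "2 * real n * (t * c) \<le> 1/2" using t(2) tc by (simp add: algebra_simps)
  \<comment> \<open>Passing from n + 1 to n frees \<open>4 * (t * c)\<close>, and the growth of the
    parameter consumes at most \<open>2 * (t * c)\<close> of it.\<close>
  have "4 * real n * (t' * c) = 4 * real n * (t * c) + 2 * (t * c) * (4 * real n * (t * c))"
    unfolding t'c by (simp add: algebra_simps)
  also have "\<dots> \<le> 4 * real n * (t * c) + 2 * (t * c) * 1"
    using tn tc by (intro add_left_mono mult_left_mono) auto
  also have "\<dots> \<le> 1" using t(2) tc by (simp add: algebra_simps)
  finally have cond: "16 * real n * t' * J \<le> 1" unfolding c_def by (simp add: algebra_simps)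
  have "(\<integral>\<^sup>+\<omega>. ennreal (exp (t * (\<integral>x. (mart_sum k a0 b s (Suc n) x \<omega>)\<^sup>2 \<partial>lborel))) \<partial>M)
      = (\<integral>\<^sup>+\<omega>. (\<integral>\<^sup>+v. ennreal (exp (t * (\<integral>x. (mart_sum k a0 b s n x \<omega> + mart_diff k a0 b s (Suc n) x \<omega> v)\<^sup>2 \<partial>lborel))) \<partial>law) \<partial>M)"
    unfolding eq by (rule nn_integral_past[OF meas])
  also have "\<dots> \<le> (\<integral>\<^sup>+\<omega>. ennreal (exp (t * c)) * ennreal (exp (t' * (\<integral>x. (mart_sum k a0 b s n x \<omega>)\<^sup>2 \<partial>lborel))) \<partial>M)"
    unfolding t'_def
    by (intro nn_integral_mono law.exp_square_norm_step S1 D1 mart_sum_L2[OF k k2 J] mart_diff_mean[OF k B] t c)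
       (auto simp: c_def intro: mart_diff_L2[OF k k2 J])
  also have "\<dots> = ennreal (exp (t * c)) * (\<integral>\<^sup>+\<omega>. ennreal (exp (t' * (\<integral>x. (mart_sum k a0 b s n x \<omega>)\<^sup>2 \<partial>lborel))) \<partial>M)"
  proof (rule nn_integral_cmult)
    have "(\<lambda>(\<omega>, x). mart_sum k a0 b s n x \<omega>) \<in> borel_measurable (M \<Otimes>\<^sub>M borel)"
      unfolding mart_sum_def mart_diff_def by measurable
    then show "(\<lambda>\<omega>. ennreal (exp (t' * (\<integral>x. (mart_sum k a0 b s n x \<omega>)\<^sup>2 \<partial>lborel)))) \<in> borel_measurable M"
      by measurable
  qed
  also have "\<dots> \<le> ennreal (exp (t * c)) * ennreal (exp (8 * t' * real n * J))"
    by (intro mult_left_mono Suc.IH t' cond) simp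
  also have "\<dots> \<le> ennreal (exp (8 * t * real (Suc n) * J))"
  proof -
    \<comment> \<open>The increment's own cost \<open>t * c\<close> and, by \<open>tn\<close>, at
      most another \<open>t * c\<close> from the larger parameter add up to what the index n + 1
      contributes to \<open>2 * (real n + 1) * (t * c)\<close>.\<close>
    have "t * c + 8 * t' * real n * J = t * c + 2 * real n * (t' * c)" unfolding c_def by simp
    also have "\<dots> = t * c + 2 * real n * (t * c) + 2 * (t * c) * (2 * real n * (t * c))" unfolding t'c by (simp add: algebra_simps)
    also have "\<dots> \<le> t * c + 2 * real n * (t * c) + 2 * (t * c) * (1/2)"
      using tn tc by (intro add_left_mono mult_left_mono) auto
    also have "\<dots> = 8 * t * real (Suc n) * J" unfolding c_def by (simp add: algebra_simps)
    finally show ?thesis by (simp add: ennreal_mult[symmetric] exp_add[symmetric] ennreal_leI)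
  qed
  finally show ?case .
qed

text \<open>Chernoff's bound and Borel-Cantelli. The kernel changes with \<open>n\<close>, so a
  different martingale is evaluated at its final time for each \<open>n\<close>, and summable tail
  probabilities are all that is asked.\<close>

lemma AE_mart_sum_bound:
  fixes k :: "nat \<Rightarrow> real \<Rightarrow> real"
  assumes k [measurable]: "\<And>n. k n \<in> borel_measurable borel" and B: "\<And>n x. \<bar>k n x\<bar> \<le> B"
    and k2: "\<And>n. (\<integral>\<^sup>+x. ennreal ((k n x)\<^sup>2) \<partial>lborel) \<le> ennreal (J n)" and J: "\<And>n. 0 < J n"
  shows "AE \<omega> in M. \<forall>\<^sub>F n in sequentially.
    (\<integral>\<^sup>+x. ennreal ((mart_sum (k n) a0 b s n x \<omega>)\<^sup>2) \<partial>lborel) \<le> ennreal (32 * real n * J n * ln (real n))"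
proof -
  interpret law: prob_space law by (rule prob_space_law)
  define Q where "Q n \<omega> = (\<integral>x. (mart_sum (k n) a0 b s n x \<omega>)\<^sup>2 \<partial>lborel)" for n \<omega>
  have Qm [measurable]: "Q n \<in> borel_measurable M" for n
  proof -
    have "(\<lambda>(\<omega>, x). mart_sum (k n) a0 b s n x \<omega>) \<in> borel_measurable (M \<Otimes>\<^sub>M borel)"
      unfolding mart_sum_def mart_diff_def by measurable
    then show ?thesis unfolding Q_def by measurable
  qed
  define A where "A n = {\<omega> \<in> space M. 32 * real n * J n * ln (real n) < Q n \<omega>}" for n
  have [measurable]: "A n \<in> sets M" for n unfolding A_def by measurable
  have PA: "measure M (A n) \<le> exp (1/2) * (1 / real n ^ 2)" if n: "1 \<le> n" for n
  proof -
    \<comment> \<open>The largest parameter that the moment bound admits; it keeps the moment at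
      most exp(1/2). The constant 32 in the threshold then makes the exponent
      \<open>2 * ln (real n)\<close>, hence a tail of order 1/n^2.\<close>
    define t where "t = 1 / (16 * real n * J n)"
    have t: "0 < t" "16 * real n * t * J n \<le> 1" "8 * t * real n * J n = 1/2"
      unfolding t_def using n J[of n] by (auto simp: field_simps)
    have eq: "t * (32 * real n * J n * ln (real n)) = 2 * ln (real n)"
      unfolding t_def using n J[of n] by (simp add: field_simps)
    have n2: "exp (2 * ln (real n)) = real n ^ 2" using n by (simp add: exp_of_nat_mult[of 2, simplified])
    have "emeasure M (A n) = (\<integral>\<^sup>+\<omega>. indicator (A n) \<omega> \<partial>M)" by simp
    also have "\<dots> \<le> (\<integral>\<^sup>+\<omega>. ennreal (1 / real n ^ 2) * ennreal (exp (t * Q n \<omega>)) \<partial>M)"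
    proof (rule nn_integral_mono)
      fix \<omega>
      show "indicator (A n) \<omega> \<le> ennreal (1 / real n ^ 2) * ennreal (exp (t * Q n \<omega>))"
      proof (cases "\<omega> \<in> A n")
        case True
        then have "t * (32 * real n * J n * ln (real n)) \<le> t * Q n \<omega>"
          using t by (intro mult_left_mono) (auto simp: A_def)
        then have "real n ^ 2 \<le> exp (t * Q n \<omega>)" unfolding eq n2[symmetric] by simp
        then have "1 \<le> 1 / real n ^ 2 * exp (t * Q n \<omega>)" using n by (simp add: field_simps)
        then have "ennreal 1 \<le> ennreal (1 / real n ^ 2 * exp (t * Q n \<omega>))" by (rule ennreal_leI)
        then show ?thesis using True by (simp add: ennreal_mult[symmetric])
      qed simp
    qed
    also have "\<dots> = ennreal (1 / real n ^ 2) * (\<integral>\<^sup>+\<omega>. ennreal (exp (t * Q n \<omega>)) \<partial>M)"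
      by (rule nn_integral_cmult) measurable
    also have "\<dots> \<le> ennreal (1 / real n ^ 2) * ennreal (exp (8 * t * real n * J n))"
      unfolding Q_def using B k2 J[of n] t by (intro mult_left_mono mart_sum_exp_moment[where B=B]) auto
    also have "\<dots> = ennreal (exp (1/2) * (1 / real n ^ 2))"
      unfolding t by (simp add: ennreal_mult[symmetric])
    finally show ?thesis by (simp add: emeasure_eq_measure)
  qed
  have "summable (\<lambda>n. measure M (A n))"
  proof (rule summable_comparison_test')
    show "summable (\<lambda>n. exp (1/2) * (1 / real n ^ 2))"
      using inverse_power_summable[of 2, where 'a=real] by (intro summable_mult) (simp add: inverse_eq_divide)
    show "norm (measure M (A n)) \<le> exp (1/2) * (1 / real n ^ 2)" if "1 \<le> n" for n
      using PA[OF that] by simp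
  qed
  then have "AE \<omega> in M. \<forall>\<^sub>F n in sequentially. \<omega> \<in> space M - A n"
    by (intro borel_cantelli_AE1) (auto simp: emeasure_eq_measure)
  then show ?thesis
  proof eventually_elim
    case (elim \<omega>)
    then show ?case
    proof eventually_elim
      case (elim n)
      have "integrable lborel (\<lambda>x. (mart_sum (k n) a0 b s n x \<omega>)\<^sup>2)"
        using k2 J[of n] by (intro mart_sum_L2[where J="J n"]) auto
      then have "(\<integral>\<^sup>+x. ennreal ((mart_sum (k n) a0 b s n x \<omega>)\<^sup>2) \<partial>lborel) = ennreal (Q n \<omega>)"
        unfolding Q_def by (rule nn_integral_eq_integral) simp
      then show ?case using elim by (auto simp: A_def not_less intro: ennreal_leI)
    qed
  qed
qed

end

section \<open>Kernel smoothing and truncated entropy\<close>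

text \<open>The fundamental theorem of calculus writes the difference as an integral of
  \<open>\<phi>'\<close> over an interval of length |s - t|. Cauchy-Schwarz gives one factor of the
  length, Tonelli with translation invariance the other.\<close>

lemma L2_lipschitz_deriv:
  assumes der: "\<And>x. (\<phi> has_real_derivative \<phi>' x) (at x)" and cont: "continuous_on UNIV \<phi>'"
    and B: "\<And>x. \<bar>\<phi> x\<bar> \<le> B" and c: "(\<integral>\<^sup>+x. ennreal ((\<phi>' x)\<^sup>2) \<partial>lborel) \<le> ennreal (c\<^sup>2)"
  shows "L2_lipschitz c \<phi>"
proof -
  have phi: "continuous_on UNIV \<phi>" using der by (intro continuous_at_imp_continuous_on) (auto intro: DERIV_isCont)
  have [measurable]: "\<phi> \<in> borel_measurable borel" "\<phi>' \<in> borel_measurable borel"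
    using phi cont by (auto intro: borel_measurable_continuous_onI)
  have main: "(\<integral>\<^sup>+x. ennreal ((\<phi> (x - s) - \<phi> (x - t))\<^sup>2) \<partial>lborel) \<le> ennreal (c\<^sup>2 * (s - t)\<^sup>2)" if st: "s \<le> t" for s t
  proof -
    have pt: "ennreal ((\<phi> (x - s) - \<phi> (x - t))\<^sup>2)
        \<le> ennreal (t - s) * (\<integral>\<^sup>+u. indicator {s..t} u * ennreal ((\<phi>' (x - u))\<^sup>2) \<partial>lborel)" for x
    proof -
      have "integral\<^sup>L lborel (\<lambda>u. indicator {s..t} u *\<^sub>R \<phi>' (x - u)) = (- \<phi> (x - t)) - (- \<phi> (x - s))"
      proof (rule integral_FTC_atLeastAtMost[OF st])
        fix u
        have "((\<lambda>u. - \<phi> (x - u)) has_real_derivative \<phi>' (x - u)) (at u within {s..t})"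
          by (rule has_field_derivative_at_within) (auto intro!: derivative_eq_intros DERIV_chain'[OF _ der])
        then show "((\<lambda>u. - \<phi> (x - u)) has_vector_derivative \<phi>' (x - u)) (at u within {s..t})"
          by (simp add: has_real_derivative_iff_has_vector_derivative)
      next
        show "continuous_on {s..t} (\<lambda>u. \<phi>' (x - u))"
          by (intro continuous_on_compose2[OF cont] continuous_intros) auto
      qed
      then have eq: "\<phi> (x - s) - \<phi> (x - t) = (\<integral>u. indicator {s..t} u * \<phi>' (x - u) \<partial>lborel)" by simp
      have "ennreal \<bar>\<phi> (x - s) - \<phi> (x - t)\<bar> \<le> (\<integral>\<^sup>+u. ennreal \<bar>indicator {s..t} u * \<phi>' (x - u)\<bar> \<partial>lborel)"
        unfolding eq using integral_norm_bound_ennreal[of lborel "\<lambda>u. indicator {s..t} u * \<phi>' (x - u)"]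
        by (cases "integrable lborel (\<lambda>u. indicator {s..t} u * \<phi>' (x - u))") (auto simp: not_integrable_integral_eq)
      also have "\<dots> = (\<integral>\<^sup>+u. indicator {s..t} u * (indicator {s..t} u * ennreal \<bar>\<phi>' (x - u)\<bar>) \<partial>lborel)"
        by (intro nn_integral_cong) (auto simp: indicator_def)
      finally have "(ennreal \<bar>\<phi> (x - s) - \<phi> (x - t)\<bar>)\<^sup>2
          \<le> (\<integral>\<^sup>+u. indicator {s..t} u * (indicator {s..t} u * ennreal \<bar>\<phi>' (x - u)\<bar>) \<partial>lborel)\<^sup>2"
        by (rule power_mono) simp
      also have "\<dots> \<le> (\<integral>\<^sup>+u. (indicator {s..t} u)\<^sup>2 \<partial>lborel) * (\<integral>\<^sup>+u. (indicator {s..t} u * ennreal \<bar>\<phi>' (x - u)\<bar>)\<^sup>2 \<partial>lborel)"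
        by (rule Cauchy_Schwarz_nn_integral) auto
      also have "(\<integral>\<^sup>+u. (indicator {s..t} u)\<^sup>2 \<partial>lborel) = ennreal (t - s)"
      proof -
        have "(\<integral>\<^sup>+u. (indicator {s..t} u)\<^sup>2 \<partial>lborel) = (\<integral>\<^sup>+u. indicator {s..t} u \<partial>lborel)"
          by (intro nn_integral_cong) (auto simp: indicator_def)
        then show ?thesis using st by simp
      qed
      also have "(\<integral>\<^sup>+u. (indicator {s..t} u * ennreal \<bar>\<phi>' (x - u)\<bar>)\<^sup>2 \<partial>lborel) = (\<integral>\<^sup>+u. indicator {s..t} u * ennreal ((\<phi>' (x - u))\<^sup>2) \<partial>lborel)"
        by (intro nn_integral_cong) (auto simp: indicator_def ennreal_power)
      finally show ?thesis by (simp add: ennreal_power)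
    qed
    have shift: "(\<integral>\<^sup>+x. ennreal ((\<phi>' (x - u))\<^sup>2) \<partial>lborel) \<le> ennreal (c\<^sup>2)" for u
      using nn_integral_real_affine[of "\<lambda>x. ennreal ((\<phi>' x)\<^sup>2)" 1 "-u"] c by simp
    have "(\<integral>\<^sup>+x. ennreal ((\<phi> (x - s) - \<phi> (x - t))\<^sup>2) \<partial>lborel)
        \<le> (\<integral>\<^sup>+x. ennreal (t - s) * (\<integral>\<^sup>+u. indicator {s..t} u * ennreal ((\<phi>' (x - u))\<^sup>2) \<partial>lborel) \<partial>lborel)"
      by (rule nn_integral_mono) (rule pt)
    also have "\<dots> = ennreal (t - s) * (\<integral>\<^sup>+x. (\<integral>\<^sup>+u. indicator {s..t} u * ennreal ((\<phi>' (x - u))\<^sup>2) \<partial>lborel) \<partial>lborel)"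
      by (rule nn_integral_cmult) measurable
    also have "(\<integral>\<^sup>+x. (\<integral>\<^sup>+u. indicator {s..t} u * ennreal ((\<phi>' (x - u))\<^sup>2) \<partial>lborel) \<partial>lborel)
        = (\<integral>\<^sup>+u. (\<integral>\<^sup>+x. indicator {s..t} u * ennreal ((\<phi>' (x - u))\<^sup>2) \<partial>lborel) \<partial>lborel)"
      by (rule lborel_pair.Fubini') measurable
    also have "\<dots> = (\<integral>\<^sup>+u. indicator {s..t} u * (\<integral>\<^sup>+x. ennreal ((\<phi>' (x - u))\<^sup>2) \<partial>lborel) \<partial>lborel)"
      by (intro nn_integral_cong nn_integral_cmult) measurable
    also have "\<dots> \<le> (\<integral>\<^sup>+u. indicator {s..t} u * ennreal (c\<^sup>2) \<partial>lborel)"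
      by (intro nn_integral_mono mult_left_mono shift) auto
    also have "\<dots> = ennreal (t - s) * ennreal (c\<^sup>2)"
      using st by (subst nn_integral_multc) auto
    also have "ennreal (t - s) * \<dots> = ennreal (c\<^sup>2 * (s - t)\<^sup>2)"
    proof -
      have "c\<^sup>2 * (s - t)\<^sup>2 = (t - s) * ((t - s) * c\<^sup>2)" by (simp add: power2_eq_square algebra_simps)
      then show ?thesis using st by (simp only: ennreal_mult zero_le_power2 mult_nonneg_nonneg diff_ge_0_iff_ge)
    qed
    finally show ?thesis by (simp add: mult_left_mono)
  qed
  have "(\<integral>\<^sup>+x. ennreal ((\<phi> (x - s) - \<phi> (x - t))\<^sup>2) \<partial>lborel) \<le> ennreal (c\<^sup>2 * (s - t)\<^sup>2)" for s t
    using main[of s t] main[of t s] by (cases "s \<le> t") (auto simp: power2_commute)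
  then show ?thesis unfolding L2_lipschitz_def using B by auto
qed

section \<open>Smoothing with the kernel\<close>

text \<open>For \<open>h > 0\<close> this is the convolution of \<open>F\<close> with K(./h)/h,
  after the substitution that moves \<open>h\<close> from the kernel to the argument of
  \<open>F\<close>.\<close>

definition smoothing :: "(real \<Rightarrow> real) \<Rightarrow> real \<Rightarrow> (real \<Rightarrow> real) \<Rightarrow> real \<Rightarrow> real" where
  "smoothing K h F x = (\<integral>u. K u * F (x - h * u) \<partial>lborel)"

lemma smoothing_measurable [measurable]:
  assumes [measurable]: "K \<in> borel_measurable borel" "F \<in> borel_measurable borel"
  shows "smoothing K h F \<in> borel_measurable borel"
  unfolding smoothing_def[abs_def] by measurable

text \<open>Densities are identified only up to null sets. Undoing the substitution puts the
  integration variable directly into \<open>F\<close>, where a null set is harmless.\<close>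

lemma smoothing_cong_AE:
  assumes [measurable]: "K \<in> borel_measurable borel" "F \<in> borel_measurable borel" "G \<in> borel_measurable borel"
    and ae: "AE x in lborel. F x = G x" and h: "h \<noteq> 0"
  shows "smoothing K h F x = smoothing K h G x"
proof -
  have eq: "smoothing K h F x = (1 / \<bar>h\<bar>) * (\<integral>y. K ((x - y) / h) * F y \<partial>lborel)" for F
  proof -
    have "(\<integral>y. K ((x - y) / h) * F y \<partial>lborel) = \<bar>- h\<bar> *\<^sub>R (\<integral>u. K ((x - (x + - h * u)) / h) * F (x + - h * u) \<partial>lborel)"
      by (rule lborel_integral_real_affine) (use h in simp)
    then show ?thesis unfolding smoothing_def using h by simp
  qed
  have "(\<integral>y. K ((x - y) / h) * F y \<partial>lborel) = (\<integral>y. K ((x - y) / h) * G y \<partial>lborel)"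
    using ae by (intro integral_cong_AE) auto
  then show ?thesis unfolding eq by simp
qed

text \<open>Young's convolution inequality with \<open>K\<close> in L^1: Cauchy-Schwarz with respect
  to the weight \<open>\<bar>K u\<bar>\<close>, then Tonelli.\<close>

lemma smoothing_L2:
  assumes [measurable]: "K \<in> borel_measurable borel" "F \<in> borel_measurable borel" and K: "integrable lborel K"
  shows "(\<integral>\<^sup>+x. ennreal ((smoothing K h F x)\<^sup>2) \<partial>lborel)
    \<le> ennreal ((\<integral>u. \<bar>K u\<bar> \<partial>lborel)\<^sup>2) * (\<integral>\<^sup>+x. ennreal ((F x)\<^sup>2) \<partial>lborel)"
proof -
  let ?k = "\<integral>u. \<bar>K u\<bar> \<partial>lborel"
  have k: "(\<integral>\<^sup>+u. ennreal \<bar>K u\<bar> \<partial>lborel) = ennreal ?k"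
    using K by (intro nn_integral_eq_integral) auto
  have pt: "ennreal ((smoothing K h F x)\<^sup>2) \<le> ennreal ?k * (\<integral>\<^sup>+u. ennreal \<bar>K u\<bar> * ennreal ((F (x - h * u))\<^sup>2) \<partial>lborel)" for x
  proof -
    have "ennreal \<bar>smoothing K h F x\<bar> \<le> (\<integral>\<^sup>+u. ennreal \<bar>K u * F (x - h * u)\<bar> \<partial>lborel)"
      unfolding smoothing_def using integral_norm_bound_ennreal[of lborel "\<lambda>u. K u * F (x - h * u)"]
      by (cases "integrable lborel (\<lambda>u. K u * F (x - h * u))") (auto simp: not_integrable_integral_eq)
    also have "\<dots> = (\<integral>\<^sup>+u. ennreal (sqrt \<bar>K u\<bar>) * ennreal (sqrt \<bar>K u\<bar> * \<bar>F (x - h * u)\<bar>) \<partial>lborel)"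
      by (intro nn_integral_cong) (simp add: ennreal_mult[symmetric] mult.assoc[symmetric] abs_mult)
    finally have "(ennreal \<bar>smoothing K h F x\<bar>)\<^sup>2 \<le> (\<integral>\<^sup>+u. ennreal (sqrt \<bar>K u\<bar>) * ennreal (sqrt \<bar>K u\<bar> * \<bar>F (x - h * u)\<bar>) \<partial>lborel)\<^sup>2"
      by (rule power_mono) simp
    also have "\<dots> \<le> (\<integral>\<^sup>+u. (ennreal (sqrt \<bar>K u\<bar>))\<^sup>2 \<partial>lborel) * (\<integral>\<^sup>+u. (ennreal (sqrt \<bar>K u\<bar> * \<bar>F (x - h * u)\<bar>))\<^sup>2 \<partial>lborel)"
      by (rule Cauchy_Schwarz_nn_integral) auto
    also have "\<dots> = ennreal ?k * (\<integral>\<^sup>+u. ennreal \<bar>K u\<bar> * ennreal ((F (x - h * u))\<^sup>2) \<partial>lborel)"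
      by (simp add: ennreal_power power_mult_distrib k ennreal_mult)
    finally show ?thesis by (simp add: ennreal_power)
  qed
  have shift: "(\<integral>\<^sup>+x. ennreal ((F (x - z))\<^sup>2) \<partial>lborel) = (\<integral>\<^sup>+x. ennreal ((F x)\<^sup>2) \<partial>lborel)" for z
    using nn_integral_real_affine[of "\<lambda>x. ennreal ((F x)\<^sup>2)" 1 "-z"] by simp
  have "(\<integral>\<^sup>+x. ennreal ((smoothing K h F x)\<^sup>2) \<partial>lborel)
      \<le> (\<integral>\<^sup>+x. ennreal ?k * (\<integral>\<^sup>+u. ennreal \<bar>K u\<bar> * ennreal ((F (x - h * u))\<^sup>2) \<partial>lborel) \<partial>lborel)"
    by (rule nn_integral_mono) (rule pt)
  also have "\<dots> = ennreal ?k * (\<integral>\<^sup>+x. (\<integral>\<^sup>+u. ennreal \<bar>K u\<bar> * ennreal ((F (x - h * u))\<^sup>2) \<partial>lborel) \<partial>lborel)"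
    by (rule nn_integral_cmult) measurable
  also have "(\<integral>\<^sup>+x. (\<integral>\<^sup>+u. ennreal \<bar>K u\<bar> * ennreal ((F (x - h * u))\<^sup>2) \<partial>lborel) \<partial>lborel)
      = (\<integral>\<^sup>+u. (\<integral>\<^sup>+x. ennreal \<bar>K u\<bar> * ennreal ((F (x - h * u))\<^sup>2) \<partial>lborel) \<partial>lborel)"
    by (rule lborel_pair.Fubini') measurable
  also have "\<dots> = (\<integral>\<^sup>+u. ennreal \<bar>K u\<bar> * (\<integral>\<^sup>+x. ennreal ((F x)\<^sup>2) \<partial>lborel) \<partial>lborel)"
    by (simp add: nn_integral_cmult shift)
  also have "\<dots> = ennreal ?k * (\<integral>\<^sup>+x. ennreal ((F x)\<^sup>2) \<partial>lborel)"
    by (subst nn_integral_multc) (auto simp: k)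
  finally show ?thesis by (simp add: ennreal_mult power2_eq_square mult.assoc)
qed

text \<open>The mean value theorem applied to \<open>f\<close> and then to \<open>g1\<close>. It
  copes with a bounded, possibly discontinuous second derivative; the constant is \<open>G\<close>
  rather than G/2.\<close>

lemma taylor2_bound:
  fixes f :: "real \<Rightarrow> real"
  assumes f1: "\<And>x. (f has_real_derivative g1 x) (at x)" and f2: "\<And>x. (g1 has_real_derivative g2 x) (at x)"
    and G: "\<And>x. \<bar>g2 x\<bar> \<le> G"
  shows "\<bar>f y - f x - (y - x) * g1 x\<bar> \<le> G * (y - x)\<^sup>2"
proof -
  have mvt: "\<exists>z. \<bar>z - x\<bar> \<le> \<bar>y - x\<bar> \<and> F y - F x = (y - x) * F' z"
    if F: "\<And>x. (F has_real_derivative F' x) (at x)" for F F' :: "real \<Rightarrow> real" and x y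
  proof (cases y x rule: linorder_cases)
    case less
    then obtain z where "y < z" "z < x" "F x - F y = (x - y) * F' z" using MVT2[of y x F F'] F by auto
    then show ?thesis by (intro exI[of _ z]) (auto simp: algebra_simps)
  next
    case greater
    then obtain z where "x < z" "z < y" "F y - F x = (y - x) * F' z" using MVT2[of x y F F'] F by auto
    then show ?thesis by (intro exI[of _ z]) auto
  qed auto
  obtain z where z: "\<bar>z - x\<bar> \<le> \<bar>y - x\<bar>" "f y - f x = (y - x) * g1 z" using mvt[OF f1] by blast
  obtain w where w: "g1 z - g1 x = (z - x) * g2 w" using mvt[OF f2] by blast
  have "f y - f x - (y - x) * g1 x = (y - x) * ((z - x) * g2 w)"
    unfolding z w[symmetric] by (simp add: algebra_simps)
  also have "\<bar>\<dots>\<bar> = \<bar>y - x\<bar> * (\<bar>z - x\<bar> * \<bar>g2 w\<bar>)" by (simp add: abs_mult)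
  also have "\<dots> \<le> \<bar>y - x\<bar> * (\<bar>y - x\<bar> * G)"
    using z G by (intro mult_left_mono mult_mono) auto
  finally show ?thesis by (simp add: power2_eq_square abs_mult[symmetric] mult_ac)
qed

text \<open>Unit mass reproduces \<open>f x\<close> and the vanishing first moment removes the
  linear term, so only the Taylor remainder is weighted by the kernel. The same decomposition
  provides the integrability.\<close>

lemma smoothing_bias:
  fixes f :: "real \<Rightarrow> real"
  assumes f1: "\<And>x. (f has_real_derivative g1 x) (at x)" and f2: "\<And>x. (g1 has_real_derivative g2 x) (at x)"
    and G: "\<And>x. \<bar>g2 x\<bar> \<le> G"
    and K: "integrable lborel K" "(\<integral>u. K u \<partial>lborel) = 1" "integrable lborel (\<lambda>u. u * K u)" "(\<integral>u. u * K u \<partial>lborel) = 0"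
    and K2: "integrable lborel (\<lambda>u. u\<^sup>2 * \<bar>K u\<bar>)"
  shows "integrable lborel (\<lambda>u. K u * f (x - h * u))"
    and "\<bar>smoothing K h f x - f x\<bar> \<le> G * (\<integral>u. u\<^sup>2 * \<bar>K u\<bar> \<partial>lborel) * h\<^sup>2"
proof -
  have [measurable]: "K \<in> borel_measurable borel" using K(1) by auto
  have "continuous_on UNIV f" using f1 by (intro continuous_at_imp_continuous_on) (auto intro: DERIV_isCont)
  then have [measurable]: "f \<in> borel_measurable borel" by (rule borel_measurable_continuous_onI)
  define r where "r u = K u * (f (x - h * u) - f x + h * u * g1 x)" for u
  have [measurable]: "r \<in> borel_measurable borel" unfolding r_def by measurable
  have rb: "\<bar>r u\<bar> \<le> G * h\<^sup>2 * (u\<^sup>2 * \<bar>K u\<bar>)" for u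
  proof -
    have "\<bar>f (x - h * u) - f x + h * u * g1 x\<bar> \<le> G * (h * u)\<^sup>2"
      using taylor2_bound[OF f1 f2 G, of "x - h * u" x] by simp
    then have "\<bar>K u\<bar> * \<bar>f (x - h * u) - f x + h * u * g1 x\<bar> \<le> \<bar>K u\<bar> * (G * (h * u)\<^sup>2)"
      by (rule mult_left_mono) simp
    then show ?thesis unfolding r_def by (simp add: abs_mult power_mult_distrib mult_ac)
  qed
  have ri: "integrable lborel r"
    by (rule Bochner_Integration.integrable_bound[of _ "\<lambda>u. G * h\<^sup>2 * (u\<^sup>2 * \<bar>K u\<bar>)"])
       (use K2 rb in \<open>auto intro!: AE_I2 intro: order_trans[OF _ abs_ge_self]\<close>)
  have eq: "K u * f (x - h * u) = r u + f x * K u - h * g1 x * (u * K u)" for u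
    unfolding r_def by (simp add: algebra_simps)
  show "integrable lborel (\<lambda>u. K u * f (x - h * u))" unfolding eq using ri K by simp
  have "smoothing K h f x - f x = (\<integral>u. r u \<partial>lborel)"
    unfolding smoothing_def eq using ri K by simp
  also have "\<bar>\<dots>\<bar> \<le> (\<integral>u. \<bar>r u\<bar> \<partial>lborel)" by (rule integral_abs_bound)
  also have "\<dots> \<le> (\<integral>u. G * h\<^sup>2 * (u\<^sup>2 * \<bar>K u\<bar>) \<partial>lborel)"
    using ri K2 rb by (intro integral_mono) auto
  also have "\<dots> = G * (\<integral>u. u\<^sup>2 * \<bar>K u\<bar> \<partial>lborel) * h\<^sup>2"
    using K2 by simp
  finally show "\<bar>smoothing K h f x - f x\<bar> \<le> G * (\<integral>u. u\<^sup>2 * \<bar>K u\<bar> \<partial>lborel) * h\<^sup>2" .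
qed

section \<open>From estimation error to entropy error\<close>

text \<open>\<open>p\<close> is the part of the error controlled in L^2 and the rest is uniformly
  small. Since \<open>u\<close> is at least \<open>g\<close> on \<open>A\<close>, Markov's
  inequality bounds the measure of \<open>A\<close> by \<open>c / g\<close>, and every constant term
  is paid at this price.\<close>

lemma truncated_entropy_diff:
  fixes u v p :: "real \<Rightarrow> real"
  assumes [measurable]: "u \<in> borel_measurable borel" "v \<in> borel_measurable borel" "p \<in> borel_measurable borel"
    and A: "A = {x. g \<le> u x}" and g: "0 < g" "g \<le> 1" and d: "0 < d" "d \<le> 1"
    and v: "\<And>x. 0 \<le> v x" "AE x in lborel. v x \<le> B" and B: "0 \<le> B"
    and bias: "\<And>x. \<bar>u x - v x - p x\<bar> \<le> C * d" and C: "0 \<le> C"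
    and p: "(\<integral>\<^sup>+x. ennreal ((p x)\<^sup>2) \<partial>lborel) \<le> ennreal (e * d\<^sup>2)" and e: "0 \<le> e"
    and u: "(\<integral>\<^sup>+x. ennreal \<bar>u x\<bar> \<partial>lborel) \<le> ennreal c" and c: "0 \<le> c"
    and ent: "integrable lborel (\<lambda>x. v x * ln (v x))"
  shows "\<bar>(LINT x : A | lborel. u x * ln (u x)) - (LINT x : A | lborel. v x * ln (v x))\<bar>
    \<le> (1 + B + \<bar>ln g\<bar>) * (3 * e + (1 + C + 2 * C\<^sup>2) * c) * (d / g)"
proof -
  have [measurable]: "A \<in> sets borel" unfolding A by measurable
  define L where "L = 1 + B + \<bar>ln g\<bar>"
  have L: "1 \<le> L" using B by (simp add: L_def)
  \<comment> \<open>\<open>a1\<close> and \<open>a2\<close> are the coefficients of (p x)^2 and of 1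
    in the pointwise bound on \<open>D\<close>. They rest on |p| <= p^2/d + d, where
    \<open>d\<close> is the scale at which both terms integrate to order \<open>d\<close>, up to the
    factors \<open>L\<close> and \<open>1 / g\<close>.\<close>
  define a1 where "a1 = L / d + 2"
  define a2 where "a2 = L * (d + C * d) + 2 * (C * d)\<^sup>2"
  have a: "0 \<le> a1" "0 \<le> a2" using L d C by (auto simp: a1_def a2_def)
  have Ameas: "emeasure lborel A \<le> ennreal (c / g)"
  proof -
    have "ennreal g * emeasure lborel A = (\<integral>\<^sup>+x. ennreal g * indicator A x \<partial>lborel)"
      by (simp add: nn_integral_cmult)
    also have "\<dots> \<le> (\<integral>\<^sup>+x. ennreal \<bar>u x\<bar> \<partial>lborel)"
      by (intro nn_integral_mono) (auto simp: A indicator_def intro!: ennreal_leI)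
    also have "\<dots> \<le> ennreal c" by (rule u)
    finally have "ennreal (1 / g) * (ennreal g * emeasure lborel A) \<le> ennreal (1 / g) * ennreal c"
      by (rule mult_left_mono) simp
    then show ?thesis using g c by (simp add: mult.assoc[symmetric] ennreal_mult[symmetric])
  qed
  define D where "D x = indicator A x * (u x * ln (u x) - v x * ln (v x))" for x
  have [measurable]: "D \<in> borel_measurable borel" unfolding D_def by measurable
  have pt: "AE x in lborel. ennreal (norm (D x)) \<le> ennreal a1 * ennreal ((p x)\<^sup>2) + ennreal a2 * indicator A x"
    using v(2)
  proof eventually_elim
    case (elim x)
    show ?case
    proof (cases "x \<in> A")
      case True
      define r where "r = \<bar>u x - v x\<bar>"
      have r: "0 \<le> r" "r \<le> \<bar>p x\<bar> + C * d" using bias[of x] by (auto simp: r_def)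
      have "\<bar>D x\<bar> \<le> r * (L + r)"
        using abs_mult_ln_diff_le[of g "u x" "v x" B] True g v(1)[of x] elim
        unfolding D_def L_def r_def A by (simp add: algebra_simps)
      also have "\<dots> \<le> (\<bar>p x\<bar> + C * d) * L + r\<^sup>2"
        using r L by (simp add: distrib_left power2_eq_square mult_right_mono)
      also have "r\<^sup>2 \<le> 2 * (p x)\<^sup>2 + 2 * (C * d)\<^sup>2"
      proof -
        have "r\<^sup>2 \<le> (\<bar>p x\<bar> + C * d)\<^sup>2" using r by (intro power_mono) auto
        also have "\<dots> \<le> 2 * (p x)\<^sup>2 + 2 * (C * d)\<^sup>2"
          using zero_le_power2[of "\<bar>p x\<bar> - C * d"] by (simp add: power2_sum power2_diff)
        finally show ?thesis .
      qed
      also have "\<bar>p x\<bar> \<le> (p x)\<^sup>2 / d + d"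
      proof -
        have "0 \<le> (\<bar>p x\<bar> - d)\<^sup>2 + \<bar>p x\<bar> * d" using d by simp
        then have "\<bar>p x\<bar> * d \<le> (p x)\<^sup>2 + d * d" by (simp add: power2_diff power2_eq_square algebra_simps)
        then show ?thesis using d by (simp add: field_simps)
      qed
      finally have "\<bar>D x\<bar> \<le> a1 * (p x)\<^sup>2 + a2"
        using L unfolding a1_def a2_def by (simp add: algebra_simps)
      then have "ennreal \<bar>D x\<bar> \<le> ennreal (a1 * (p x)\<^sup>2 + a2)" by (rule ennreal_leI)
      then show ?thesis using True a by (simp add: ennreal_mult)
    next
      case False then show ?thesis by (simp add: D_def)
    qed
  qed
  have tot: "a1 * (e * d\<^sup>2) + a2 * (c / g) \<le> L * (3 * e + (1 + C + 2 * C\<^sup>2) * c) * (d / g)"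
  proof -
    \<comment> \<open>By \<open>g \<le> 1\<close> the L^2 contribution, which carries no measure of
      \<open>A\<close>, also fits under the rate \<open>d / g\<close>.\<close>
    have dg: "d \<le> d / g" using d g by (simp add: field_simps)
    have "a1 * (e * d\<^sup>2) = e * (L * d + 2 * d\<^sup>2)" unfolding a1_def using d by (simp add: field_simps power2_eq_square)
    also have "2 * d\<^sup>2 \<le> 2 * (L * d)" using d L by (simp add: power2_eq_square mult_mono)
    then have "e * (L * d + 2 * d\<^sup>2) \<le> e * (3 * (L * d))" using e by (intro mult_left_mono) auto
    also have "\<dots> \<le> e * (3 * (L * (d / g)))" using e L dg by (intro mult_left_mono) auto
    finally have 1: "a1 * (e * d\<^sup>2) \<le> L * (3 * e) * (d / g)" by (simp add: mult_ac)
    have "(C * d)\<^sup>2 \<le> C\<^sup>2 * (L * d)"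
      unfolding power_mult_distrib using d L by (intro mult_left_mono) (auto simp: power2_eq_square intro!: mult_mono)
    then have "a2 \<le> L * ((1 + C + 2 * C\<^sup>2) * d)" unfolding a2_def by (simp add: algebra_simps)
    then have "a2 * (c / g) \<le> L * ((1 + C + 2 * C\<^sup>2) * d) * (c / g)" using c g by (intro mult_right_mono) auto
    also have "\<dots> = L * ((1 + C + 2 * C\<^sup>2) * c) * (d / g)" by simp
    finally show ?thesis using 1 by (simp only: distrib_left distrib_right)
  qed
  have "(\<integral>\<^sup>+x. ennreal (norm (D x)) \<partial>lborel) \<le> (\<integral>\<^sup>+x. ennreal a1 * ennreal ((p x)\<^sup>2) + ennreal a2 * indicator A x \<partial>lborel)"
    by (rule nn_integral_mono_AE[OF pt])
  also have "\<dots> = ennreal a1 * (\<integral>\<^sup>+x. ennreal ((p x)\<^sup>2) \<partial>lborel) + ennreal a2 * emeasure lborel A"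
    by (simp add: nn_integral_add nn_integral_cmult)
  also have "\<dots> \<le> ennreal a1 * ennreal (e * d\<^sup>2) + ennreal a2 * ennreal (c / g)"
    by (intro add_mono mult_left_mono p Ameas) auto
  also have "\<dots> = ennreal (a1 * (e * d\<^sup>2) + a2 * (c / g))"
    using a e c g by (simp add: ennreal_mult[symmetric] ennreal_plus[symmetric] del: ennreal_plus)
  also have "\<dots> \<le> ennreal (L * (3 * e + (1 + C + 2 * C\<^sup>2) * c) * (d / g))" by (rule ennreal_leI[OF tot])
  finally have Dn: "(\<integral>\<^sup>+x. ennreal (norm (D x)) \<partial>lborel) \<le> ennreal (L * (3 * e + (1 + C + 2 * C\<^sup>2) * c) * (d / g))" .
  have Di: "integrable lborel D" using Dn by (intro integrableI_bounded) (auto intro: le_less_trans)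
  \<comment> \<open>Finite entropy of \<open>v\<close> makes its integral over \<open>A\<close>
    genuine, so the difference of the set integrals is the integral of \<open>D\<close>.\<close>
  have vi: "integrable lborel (\<lambda>x. indicator A x * (v x * ln (v x)))"
    using integrable_mult_indicator[OF _ ent, of A] by simp
  have "(LINT x : A | lborel. u x * ln (u x)) = (\<integral>x. D x + indicator A x * (v x * ln (v x)) \<partial>lborel)"
    unfolding set_lebesgue_integral_def D_def by (simp add: algebra_simps)
  also have "\<dots> = (\<integral>x. D x \<partial>lborel) + (LINT x : A | lborel. v x * ln (v x))"
    unfolding set_lebesgue_integral_def using Di vi by simp
  finally have "\<bar>(LINT x : A | lborel. u x * ln (u x)) - (LINT x : A | lborel. v x * ln (v x))\<bar> = \<bar>\<integral>x. D x \<partial>lborel\<bar>" by simp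
  also have "\<dots> \<le> (\<integral>x. \<bar>D x\<bar> \<partial>lborel)" by (rule integral_abs_bound)
  also have "\<dots> \<le> L * (3 * e + (1 + C + 2 * C\<^sup>2) * c) * (d / g)"
  proof -
    have "ennreal (\<integral>x. \<bar>D x\<bar> \<partial>lborel) = (\<integral>\<^sup>+x. ennreal (norm (D x)) \<partial>lborel)"
      using Di by (subst nn_integral_eq_integral) auto
    moreover have "0 \<le> L * (3 * e + (1 + C + 2 * C\<^sup>2) * c) * (d / g)"
      using L e C c d g by (intro mult_nonneg_nonneg add_nonneg_nonneg) auto
    ultimately show ?thesis using Dn ennreal_le_iff by metis
  qed
  finally show ?thesis unfolding L_def .
qed

section \<open>The kernel density estimator\<close>

context iid_innovations
begin

text \<open>Given the past, \<open>a0 * eps p \<omega> + Y \<omega>\<close> has a rescaled translate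
  of the innovation density. Averaging over the past yields a density of \<open>X\<close>, and
  densities are unique almost everywhere.\<close>

lemma marginal_density:
  assumes law_g: "law = density lborel (\<lambda>x. ennreal (g x))" and [measurable]: "g \<in> borel_measurable borel"
    and g: "\<And>x. 0 \<le> g x" "\<And>x. g x \<le> B" and a0: "a0 \<noteq> 0"
    and Y [measurable]: "Y \<in> borel_measurable (past p)"
    and X: "AE \<omega> in M. X \<omega> = a0 * eps p \<omega> + Y \<omega>"
    and f: "distributed M lborel X (\<lambda>x. ennreal (f x))" "\<And>x. 0 \<le> f x"
  shows "AE x in lborel. f x = (\<integral>\<omega>. g ((x - Y \<omega>) / a0) / \<bar>a0\<bar> \<partial>M)"
proof -
  interpret LM: pair_sigma_finite lborel M ..
  define m where "m x = (\<integral>\<omega>. g ((x - Y \<omega>) / a0) / \<bar>a0\<bar> \<partial>M)" for x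
  have Xm [measurable]: "X \<in> borel_measurable M" using distributed_measurable[OF f(1)] by simp
  have YM [measurable]: "Y \<in> borel_measurable M" by (rule measurable_from_subalg[OF subalgebra_past Y])
  have mm [measurable]: "m \<in> borel_measurable borel" unfolding m_def by measurable
  have m0: "0 \<le> m x" for x unfolding m_def using g by simp
  have mn: "(\<integral>\<^sup>+\<omega>. ennreal (g ((x - Y \<omega>) / a0) / \<bar>a0\<bar>) \<partial>M) = ennreal (m x)" for x
    unfolding m_def using g
    by (intro nn_integral_eq_integral integrable_const_bound[where B="B / \<bar>a0\<bar>"]) (auto intro!: divide_right_mono)
  have "distr M lborel X = density lborel (\<lambda>x. ennreal (m x))"
  proof (rule measure_eqI)
    fix A assume "A \<in> sets (distr M lborel X)"
    then have A [measurable]: "A \<in> sets borel" by simp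
    have "emeasure (distr M lborel X) A = (\<integral>\<^sup>+\<omega>. indicator A (X \<omega>) \<partial>M)"
      by (subst nn_integral_indicator[symmetric]) (auto simp: nn_integral_distr simp del: nn_integral_indicator)
    also have "\<dots> = (\<integral>\<^sup>+\<omega>. indicator A (a0 * eps p \<omega> + Y \<omega>) \<partial>M)"
      using X by (intro nn_integral_cong_AE) (auto elim!: eventually_mono)
    also have "\<dots> = (\<integral>\<^sup>+\<omega>. (\<integral>\<^sup>+v. indicator A (a0 * v + Y \<omega>) \<partial>law) \<partial>M)"
      by (rule nn_integral_past) measurable
    also have "\<dots> = (\<integral>\<^sup>+\<omega>. (\<integral>\<^sup>+x. ennreal (g ((x - Y \<omega>) / a0) / \<bar>a0\<bar>) * indicator A x \<partial>lborel) \<partial>M)"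
    proof (rule nn_integral_cong)
      fix \<omega>
      have "(\<integral>\<^sup>+v. indicator A (a0 * v + Y \<omega>) \<partial>law) = (\<integral>\<^sup>+v. ennreal (g v) * indicator A (a0 * v + Y \<omega>) \<partial>lborel)"
        unfolding law_g by (rule nn_integral_density) measurable
      also have "\<dots> = ennreal \<bar>1 / a0\<bar> * (\<integral>\<^sup>+x. ennreal (g (- Y \<omega> / a0 + 1 / a0 * x)) * indicator A (a0 * (- Y \<omega> / a0 + 1 / a0 * x) + Y \<omega>) \<partial>lborel)"
        by (rule nn_integral_real_affine) (use a0 in auto)
      also have "\<dots> = (\<integral>\<^sup>+x. ennreal \<bar>1 / a0\<bar> * (ennreal (g (- Y \<omega> / a0 + 1 / a0 * x)) * indicator A (a0 * (- Y \<omega> / a0 + 1 / a0 * x) + Y \<omega>)) \<partial>lborel)"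
        by (rule nn_integral_cmult[symmetric]) measurable
      also have "\<dots> = (\<integral>\<^sup>+x. ennreal (g ((x - Y \<omega>) / a0) / \<bar>a0\<bar>) * indicator A x \<partial>lborel)"
      proof (rule nn_integral_cong)
        fix x
        have 1: "- Y \<omega> / a0 + 1 / a0 * x = (x - Y \<omega>) / a0" using a0 by (simp add: field_simps)
        have 2: "a0 * ((x - Y \<omega>) / a0) + Y \<omega> = x" using a0 by simp
        have 3: "ennreal \<bar>1 / a0\<bar> * ennreal (g ((x - Y \<omega>) / a0)) = ennreal (g ((x - Y \<omega>) / a0) / \<bar>a0\<bar>)"
          using g by (simp add: ennreal_mult[symmetric])
        show "ennreal \<bar>1 / a0\<bar> * (ennreal (g (- Y \<omega> / a0 + 1 / a0 * x)) * indicator A (a0 * (- Y \<omega> / a0 + 1 / a0 * x) + Y \<omega>))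
            = ennreal (g ((x - Y \<omega>) / a0) / \<bar>a0\<bar>) * indicator A x"
          unfolding 1 2 mult.assoc[symmetric] 3 ..
      qed
      finally show "(\<integral>\<^sup>+v. indicator A (a0 * v + Y \<omega>) \<partial>law)
          = (\<integral>\<^sup>+x. ennreal (g ((x - Y \<omega>) / a0) / \<bar>a0\<bar>) * indicator A x \<partial>lborel)" .
    qed
    also have "\<dots> = (\<integral>\<^sup>+x. (\<integral>\<^sup>+\<omega>. ennreal (g ((x - Y \<omega>) / a0) / \<bar>a0\<bar>) * indicator A x \<partial>M) \<partial>lborel)"
      by (rule LM.Fubini') measurable
    also have "\<dots> = (\<integral>\<^sup>+x. ennreal (m x) * indicator A x \<partial>lborel)"
      by (intro nn_integral_cong) (subst nn_integral_multc, auto simp: mn)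
    also have "\<dots> = emeasure (density lborel (\<lambda>x. ennreal (m x))) A"
      by (subst emeasure_density) auto
    finally show "emeasure (distr M lborel X) A = emeasure (density lborel (\<lambda>x. ennreal (m x))) A" .
  qed simp
  then have "distributed M lborel X (\<lambda>x. ennreal (m x))"
    unfolding distributed_def by simp
  from distributed_unique[OF f(1) this] show ?thesis
    unfolding m_def[symmetric] using f(2) m0 by (auto elim!: eventually_mono)
qed

text \<open>The conditional mean of a kernel term is \<open>h n\<close> times the smoothing of a
  translate of \<open>\<phi>\<close>. Subtracting it leaves the martingale, and the averaged
  conditional densities minus \<open>f\<close> form the centred smooth part; the two summands of the
  rate belong to these two pieces.\<close>

lemma AE_kde_L2:
  fixes X :: "nat \<Rightarrow> 'a \<Rightarrow> real" and K :: "real \<Rightarrow> real" and h :: "nat \<Rightarrow> real"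
  assumes law_g: "law = density lborel (\<lambda>x. ennreal (g x))"
    and g: "\<And>x. 0 \<le> g x" "\<And>x. g x \<le> B"
    and g1: "\<And>x. (g has_real_derivative g1 x) (at x)" "continuous_on UNIV g1" "integrable lborel (\<lambda>x. (g1 x)\<^sup>2)"
    and a0: "a0 \<noteq> 0" and b: "summable (\<lambda>k. \<bar>b k\<bar>)"
    and X: "\<And>i. AE \<omega> in M. X i \<omega> = a0 * eps (int i - s) \<omega> + lin b (int i - s - 1) \<omega>"
    and f: "\<And>i. distributed M lborel (X i) (\<lambda>x. ennreal (f x))" "\<And>x. 0 \<le> f x" "f \<in> borel_measurable borel"
    and K: "integrable lborel K" "\<And>u. \<bar>K u\<bar> \<le> KB" and h: "\<And>n. 0 < h n"
  shows "AE x in lborel. f x \<le> B / \<bar>a0\<bar>"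
    and "AE \<omega> in M. \<exists>C\<ge>0. \<forall>\<^sub>F n in sequentially.
      (\<integral>\<^sup>+x. ennreal ((kde K h X n \<omega> x - smoothing K (h n) f x)\<^sup>2) \<partial>lborel)
        \<le> ennreal (C * (ln (real n) / (real n * h n) + real n powr (- (4/5))))"
proof -
  interpret law: prob_space law by (rule prob_space_law)
  have Kb [measurable]: "K \<in> borel_measurable borel" using K(1) by auto
  note [measurable] = f(3)
  have gc: "continuous_on UNIV g" using g1(1) by (intro continuous_at_imp_continuous_on) (auto intro: DERIV_isCont)
  have [measurable]: "g \<in> borel_measurable borel" using gc by (rule borel_measurable_continuous_onI)
  have B: "0 \<le> B" using g[of 0] by linarith
  define \<phi> where "\<phi> z = g (z / a0) / \<bar>a0\<bar>" for z
  define \<phi>' where "\<phi>' z = g1 (z / a0) / (a0 * \<bar>a0\<bar>)" for z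
  have [measurable]: "\<phi> \<in> borel_measurable borel" unfolding \<phi>_def by measurable
  have phib: "0 \<le> \<phi> z" "\<phi> z \<le> B / \<bar>a0\<bar>" for z
    using g by (auto simp: \<phi>_def intro: divide_right_mono)
  have phib': "\<bar>\<phi> z\<bar> \<le> B / \<bar>a0\<bar>" for z using phib[of z] by simp
  define c where "c = sqrt (\<integral>x. (\<phi>' x)\<^sup>2 \<partial>lborel)"
  have lip: "L2_lipschitz c \<phi>"
  proof (rule L2_lipschitz_deriv)
    show "(\<phi> has_real_derivative \<phi>' x) (at x)" for x
    proof -
      have "((\<lambda>z. z / a0) has_real_derivative (1 / a0)) (at x)" using a0 by (auto intro!: derivative_eq_intros)
      from DERIV_chain2[OF g1(1) this] have "((\<lambda>z. g (z / a0)) has_real_derivative g1 (x / a0) * (1 / a0)) (at x)" .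
      from DERIV_cdivide[OF this, of "\<bar>a0\<bar>"] show ?thesis unfolding \<phi>_def \<phi>'_def by simp
    qed
    show "continuous_on UNIV \<phi>'" unfolding \<phi>'_def
      by (intro continuous_intros continuous_on_compose2[OF g1(2)]) (use a0 in auto)
    show "\<bar>\<phi> x\<bar> \<le> B / \<bar>a0\<bar>" for x by (rule phib')
    have "integrable lborel (\<lambda>x. (g1 (0 + 1 / a0 * x))\<^sup>2)"
      using lborel_integrable_real_affine[OF g1(3), of "1 / a0" 0] a0 by simp
    then have "integrable lborel (\<lambda>x. (g1 (x / a0))\<^sup>2 / (a0 * \<bar>a0\<bar>)\<^sup>2)" by simp
    then have "integrable lborel (\<lambda>x. (\<phi>' x)\<^sup>2)" unfolding \<phi>'_def by (simp add: power_divide)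
    then show "(\<integral>\<^sup>+x. ennreal ((\<phi>' x)\<^sup>2) \<partial>lborel) \<le> ennreal (c\<^sup>2)"
      unfolding c_def by (subst nn_integral_eq_integral) auto
  qed
  define Y where "Y i = lin b (int i - s - 1)" for i :: nat
  have Ym [measurable]: "Y i \<in> borel_measurable M" for i unfolding Y_def by measurable
  have dens: "AE x in lborel. f x = (\<integral>\<omega>. \<phi> (x - Y i \<omega>) \<partial>M)" for i
    unfolding \<phi>_def using law_g _ g a0 _ X[of i, folded Y_def] f(1)[of i] f(2)
    by (rule marginal_density) (auto simp: Y_def intro: lin_measurable_past)
  have mb: "\<bar>\<integral>\<omega>. \<phi> (x - Y i \<omega>) \<partial>M\<bar> \<le> B / \<bar>a0\<bar>" for x i
  proof -
    have "\<bar>\<integral>\<omega>. \<phi> (x - Y i \<omega>) \<partial>M\<bar> \<le> (\<integral>\<omega>. \<bar>\<phi> (x - Y i \<omega>)\<bar> \<partial>M)" by (rule integral_abs_bound)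
    also have "\<dots> \<le> (\<integral>\<omega>. B / \<bar>a0\<bar> \<partial>M)"
      using phib' B by (intro integral_mono integrable_const_bound[where B="B / \<bar>a0\<bar>"]) auto
    finally show ?thesis by (simp add: prob_space)
  qed
  show "AE x in lborel. f x \<le> B / \<bar>a0\<bar>"
    using dens[of 0] by eventually_elim (use mb[of _ 0] in \<open>auto simp: abs_le_iff\<close>)
  define k where "k n y = K (y / h n)" for n y
  define k2 where "k2 = (\<integral>u. (K u)\<^sup>2 \<partial>lborel)"
  have K2: "integrable lborel (\<lambda>u. (K u)\<^sup>2)"
  proof (rule Bochner_Integration.integrable_bound)
    show "integrable lborel (\<lambda>u. KB * K u)" using K(1) by simp
    show "AE u in lborel. norm ((K u)\<^sup>2) \<le> norm (KB * K u)"
    proof (rule AE_I2)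
      fix u
      have "\<bar>K u\<bar> * \<bar>K u\<bar> \<le> \<bar>KB\<bar> * \<bar>K u\<bar>" using K(2)[of u] by (intro mult_right_mono) auto
      then show "norm ((K u)\<^sup>2) \<le> norm (KB * K u)" by (simp add: power2_eq_square abs_mult)
    qed
  qed measurable
  have k20: "0 \<le> k2" unfolding k2_def by simp
  \<comment> \<open>The added 1 keeps \<open>J n\<close> positive even if \<open>k2\<close> is zero;
    the exponential bound divides by it.\<close>
  define J where "J n = h n * (k2 + 1)" for n
  have J: "0 < J n" for n unfolding J_def using h[of n] k20 by simp
  have km [measurable]: "k n \<in> borel_measurable borel" for n unfolding k_def by measurable
  have kJ: "(\<integral>\<^sup>+y. ennreal ((k n y)\<^sup>2) \<partial>lborel) \<le> ennreal (J n)" for n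
  proof -
    have "(\<integral>\<^sup>+y. ennreal ((k n y)\<^sup>2) \<partial>lborel) = ennreal \<bar>h n\<bar> * (\<integral>\<^sup>+u. ennreal ((k n (0 + h n * u))\<^sup>2) \<partial>lborel)"
      using h[of n] by (intro nn_integral_real_affine) auto
    also have "\<dots> = ennreal (h n) * ennreal k2"
      unfolding k_def k2_def using h[of n] K2 by (simp add: nn_integral_eq_integral)
    also have "\<dots> \<le> ennreal (J n)"
      unfolding J_def using h[of n] k20 by (simp add: ennreal_mult[symmetric] ennreal_leI)
    finally show ?thesis .
  qed
  have mart: "AE \<omega> in M. \<forall>\<^sub>F n in sequentially.
      (\<integral>\<^sup>+x. ennreal ((mart_sum (k n) a0 b s n x \<omega>)\<^sup>2) \<partial>lborel) \<le> ennreal (32 * real n * J n * ln (real n))"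
    using km _ kJ J by (rule AE_mart_sum_bound[where B=KB]) (simp add: k_def K)
  \<comment> \<open>The shift is \<open>s + 1\<close> because \<open>Y i\<close> ends at the
    innovation with index \<open>int i - s - 1\<close>, one before the fresh one.\<close>
  have smooth: "AE \<omega> in M. \<exists>C\<ge>0. \<forall>n\<ge>1.
    (\<integral>\<^sup>+x. ennreal ((\<Sum>i=1..n. smooth_dev \<phi> b (s + 1) i x \<omega>)\<^sup>2) \<partial>lborel) \<le> ennreal (C * real n powr (6/5))"
    by (rule AE_smooth_dev_bound[OF lip b])
  have Xall: "AE \<omega> in M. \<forall>i. X i \<omega> = a0 * eps (int i - s) \<omega> + Y i \<omega>"
    unfolding AE_all_countable Y_def using X by blast
  have intK: "integrable lborel (\<lambda>u. K u * F (x - h n * u))"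
    if [measurable]: "F \<in> borel_measurable borel" and "\<And>z. \<bar>F z\<bar> \<le> B'" for F B' x n
  proof (rule Bochner_Integration.integrable_bound)
    show "integrable lborel (\<lambda>u. B' * K u)" using K(1) by simp
    show "AE u in lborel. norm (K u * F (x - h n * u)) \<le> norm (B' * K u)"
    proof (rule AE_I2)
      fix u
      have "\<bar>F (x - h n * u)\<bar> \<le> \<bar>B'\<bar>" using that(2) by (rule order_trans) simp
      then have "\<bar>K u\<bar> * \<bar>F (x - h n * u)\<bar> \<le> \<bar>K u\<bar> * \<bar>B'\<bar>" by (intro mult_left_mono) auto
      then show "norm (K u * F (x - h n * u)) \<le> norm (B' * K u)" by (simp add: abs_mult mult.commute)
    qed
  qed measurable
  define kn where "kn = (\<integral>u. \<bar>K u\<bar> \<partial>lborel)"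
  have decomp: "kde K h X n \<omega> x - smoothing K (h n) f x =
      mart_sum (k n) a0 b s n x \<omega> / (real n * h n) +
      smoothing K (h n) (\<lambda>z. (\<Sum>i=1..n. smooth_dev \<phi> b (s + 1) i z \<omega>) / real n) x"
    if n: "1 \<le> n" and Xw: "\<forall>i. X i \<omega> = a0 * eps (int i - s) \<omega> + Y i \<omega>" for n \<omega> x
  proof -
    let ?S = "smoothing K (h n)"
    \<comment> \<open>The substitution x - Y - a0 v = h u turns averaging over the innovation into
      smoothing of \<open>\<phi>\<close>; its Jacobian supplies both \<open>h n\<close> and the
      normalisation of \<open>\<phi>\<close>.\<close>
    have kap: "(\<integral>v. k n (x - Y i \<omega> - a0 * v) \<partial>law) = h n * ?S (\<lambda>z. \<phi> (z - Y i \<omega>)) x" for i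
    proof -
      have "(\<integral>v. k n (x - Y i \<omega> - a0 * v) \<partial>law) = (\<integral>v. g v * K ((x - Y i \<omega> - a0 * v) / h n) \<partial>lborel)"
        unfolding law_g k_def using g(1) by (subst integral_density) auto
      also have "\<dots> = \<bar>- h n / a0\<bar> *\<^sub>R (\<integral>u. g ((x - Y i \<omega>) / a0 + - h n / a0 * u) *
          K ((x - Y i \<omega> - a0 * ((x - Y i \<omega>) / a0 + - h n / a0 * u)) / h n) \<partial>lborel)"
        by (rule lborel_integral_real_affine) (use a0 h[of n] in auto)
      also have "\<dots> = (h n / \<bar>a0\<bar>) * (\<integral>u. g ((x - h n * u - Y i \<omega>) / a0) * K u \<partial>lborel)"
      proof -
        have 1: "(x - Y i \<omega>) / a0 + - h n / a0 * u = (x - h n * u - Y i \<omega>) / a0" for u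
          using a0 by (simp add: field_simps)
        have 2: "(x - Y i \<omega> - a0 * ((x - h n * u - Y i \<omega>) / a0)) / h n = u" for u
          using a0 h[of n] by simp
        show ?thesis unfolding 1 2 using h[of n] by simp
      qed
      also have "\<dots> = h n * ?S (\<lambda>z. \<phi> (z - Y i \<omega>)) x"
        unfolding smoothing_def \<phi>_def by (simp add: mult.commute)
      finally show ?thesis .
    qed
    have ms: "mart_sum (k n) a0 b s n x \<omega> = (\<Sum>i=1..n. K ((x - X i \<omega>) / h n)) - h n * (\<Sum>i=1..n. ?S (\<lambda>z. \<phi> (z - Y i \<omega>)) x)"
      unfolding mart_sum_def mart_diff_def Y_def[symmetric] kap sum_subtractf sum_distrib_left
      by (simp add: k_def Xw diff_diff_eq add.commute)
    have sm: "?S (\<lambda>z. (\<Sum>i=1..n. smooth_dev \<phi> b (s + 1) i z \<omega>) / real n) x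
        = (\<Sum>i=1..n. ?S (\<lambda>z. \<phi> (z - Y i \<omega>)) x) / real n - ?S f x"
    proof -
      have sd: "smooth_dev \<phi> b (s + 1) i z \<omega> = \<phi> (z - Y i \<omega>) - (\<integral>\<omega>. \<phi> (z - Y i \<omega>) \<partial>M)" for i z
        unfolding smooth_dev_def Y_def by (simp add: diff_diff_eq)
      have i1: "integrable lborel (\<lambda>u. K u * \<phi> (x - h n * u - Y i \<omega>))" for i
        using phib' by (intro intK[of "\<lambda>z. \<phi> (z - Y i \<omega>)"]) auto
      have i2: "integrable lborel (\<lambda>u. K u * (\<integral>\<omega>. \<phi> (x - h n * u - Y i \<omega>) \<partial>M))" for i
        using mb by (intro intK[of "\<lambda>z. (\<integral>\<omega>. \<phi> (z - Y i \<omega>) \<partial>M)"]) auto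
      have "?S (\<lambda>z. (\<Sum>i=1..n. smooth_dev \<phi> b (s + 1) i z \<omega>) / real n) x =
          (\<integral>u. (\<Sum>i=1..n. K u * \<phi> (x - h n * u - Y i \<omega>) - K u * (\<integral>\<omega>. \<phi> (x - h n * u - Y i \<omega>) \<partial>M)) / real n \<partial>lborel)"
        unfolding smoothing_def sd by (simp add: sum_distrib_left right_diff_distrib)
      also have "\<dots> = (\<Sum>i=1..n. ?S (\<lambda>z. \<phi> (z - Y i \<omega>)) x - ?S (\<lambda>z. \<integral>\<omega>. \<phi> (z - Y i \<omega>) \<partial>M) x) / real n"
        unfolding smoothing_def using i1 i2 by (simp add: Bochner_Integration.integral_sum)
      also have "\<dots> = (\<Sum>i=1..n. ?S (\<lambda>z. \<phi> (z - Y i \<omega>)) x - ?S f x) / real n"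
      proof -
        \<comment> \<open>\<open>f\<close> agrees with these means only almost everywhere, but their
          smoothings agree at the given \<open>x\<close>.\<close>
        have "?S (\<lambda>z. \<integral>\<omega>. \<phi> (z - Y i \<omega>) \<partial>M) x = ?S f x" for i
          using dens[of i] h[of n] by (intro smoothing_cong_AE) (auto elim!: eventually_mono)
        then show ?thesis by simp
      qed
      finally show ?thesis using n by (simp add: sum_subtractf diff_divide_distrib)
    qed
    have "kde K h X n \<omega> x = (\<Sum>i=1..n. K ((x - X i \<omega>) / h n)) / (real n * h n)"
      by (simp add: kde_def)
    then show ?thesis unfolding ms sm using n h[of n]
      by (simp add: diff_divide_distrib)
  qed
  show "AE \<omega> in M. \<exists>C\<ge>0. \<forall>\<^sub>F n in sequentially.
      (\<integral>\<^sup>+x. ennreal ((kde K h X n \<omega> x - smoothing K (h n) f x)\<^sup>2) \<partial>lborel)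
        \<le> ennreal (C * (ln (real n) / (real n * h n) + real n powr (- (4/5))))"
    using mart smooth Xall AE_space
  proof eventually_elim
    case (elim \<omega>)
    then obtain C where C: "0 \<le> C" "\<And>n. 1 \<le> n \<Longrightarrow>
        (\<integral>\<^sup>+x. ennreal ((\<Sum>i=1..n. smooth_dev \<phi> b (s + 1) i x \<omega>)\<^sup>2) \<partial>lborel) \<le> ennreal (C * real n powr (6/5))" by blast
    \<comment> \<open>Both entries carry the 2 from (p + q)^2 <= 2 p^2 + 2 q^2; the martingale bound
      adds 32 and Young's inequality \<open>kn\<^sup>2\<close>.\<close>
    define C' where "C' = max (64 * (k2 + 1)) (2 * (kn\<^sup>2 * C))"
    show ?case
    proof (intro exI[of _ C'] conjI)
      show "0 \<le> C'" unfolding C'_def using k20 by auto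
      show "\<forall>\<^sub>F n in sequentially. (\<integral>\<^sup>+x. ennreal ((kde K h X n \<omega> x - smoothing K (h n) f x)\<^sup>2) \<partial>lborel)
        \<le> ennreal (C' * (ln (real n) / (real n * h n) + real n powr (- (4/5))))"
        using elim(1) eventually_ge_at_top[of 1]
      proof eventually_elim
        case (elim n)
        note n = elim(2)
        let ?m = "\<lambda>x. mart_sum (k n) a0 b s n x \<omega>" and ?s = "\<lambda>z. (\<Sum>i=1..n. smooth_dev \<phi> b (s + 1) i z \<omega>)"
        have [measurable]: "?m \<in> borel_measurable borel" unfolding mart_sum_def mart_diff_def by measurable
        have [measurable]: "(\<lambda>z. smooth_dev \<phi> b (s + 1) i z \<omega>) \<in> borel_measurable borel" for i
          unfolding smooth_dev_def by measurable
        have sq: "(p + q)\<^sup>2 \<le> 2 * p\<^sup>2 + 2 * q\<^sup>2" for p q :: real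
          using zero_le_power2[of "p - q"] by (simp add: power2_eq_square algebra_simps)
        define w where "w = 1 / (real n * h n)\<^sup>2"
        have w: "0 \<le> w" by (simp add: w_def)
        have "(\<integral>\<^sup>+x. ennreal ((kde K h X n \<omega> x - smoothing K (h n) f x)\<^sup>2) \<partial>lborel)
          \<le> (\<integral>\<^sup>+x. ennreal (2 * w) * ennreal ((?m x)\<^sup>2) + 2 * ennreal ((smoothing K (h n) (\<lambda>z. ?s z / real n) x)\<^sup>2) \<partial>lborel)"
        proof (rule nn_integral_mono)
          fix x
          have "(kde K h X n \<omega> x - smoothing K (h n) f x)\<^sup>2
              \<le> 2 * (?m x / (real n * h n))\<^sup>2 + 2 * (smoothing K (h n) (\<lambda>z. ?s z / real n) x)\<^sup>2"
            unfolding decomp[OF n \<open>\<forall>i. X i \<omega> = a0 * eps (int i - s) \<omega> + Y i \<omega>\<close>] by (rule sq)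
          also have "2 * (?m x / (real n * h n))\<^sup>2 = 2 * w * (?m x)\<^sup>2" by (simp add: w_def power_divide)
          finally show "ennreal ((kde K h X n \<omega> x - smoothing K (h n) f x)\<^sup>2)
              \<le> ennreal (2 * w) * ennreal ((?m x)\<^sup>2) + 2 * ennreal ((smoothing K (h n) (\<lambda>z. ?s z / real n) x)\<^sup>2)"
            using w by (simp add: ennreal_mult[symmetric] ennreal_leI flip: ennreal_plus ennreal_numeral)
        qed
        also have "\<dots> = ennreal (2 * w) * (\<integral>\<^sup>+x. ennreal ((?m x)\<^sup>2) \<partial>lborel)
            + 2 * (\<integral>\<^sup>+x. ennreal ((smoothing K (h n) (\<lambda>z. ?s z / real n) x)\<^sup>2) \<partial>lborel)"
          by (subst nn_integral_add) (auto simp: nn_integral_cmult)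
        also have "\<dots> \<le> ennreal (2 * w) * ennreal (32 * real n * J n * ln (real n))
            + 2 * (ennreal (kn\<^sup>2) * ennreal (C * real n powr (6/5) / (real n)\<^sup>2))"
        proof (intro add_mono mult_left_mono elim(1))
          have "(\<integral>\<^sup>+x. ennreal ((smoothing K (h n) (\<lambda>z. ?s z / real n) x)\<^sup>2) \<partial>lborel)
              \<le> ennreal (kn\<^sup>2) * (\<integral>\<^sup>+x. ennreal ((?s x / real n)\<^sup>2) \<partial>lborel)"
            unfolding kn_def by (rule smoothing_L2) (use K in auto)
          also have "(\<integral>\<^sup>+x. ennreal ((?s x / real n)\<^sup>2) \<partial>lborel) = ennreal (1 / (real n)\<^sup>2) * (\<integral>\<^sup>+x. ennreal ((?s x)\<^sup>2) \<partial>lborel)"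
            by (subst nn_integral_cmult[symmetric]) (auto simp: ennreal_mult[symmetric] power_divide)
          also have "\<dots> \<le> ennreal (1 / (real n)\<^sup>2) * ennreal (C * real n powr (6/5))"
            by (intro mult_left_mono C(2) n) simp
          also have "\<dots> = ennreal (C * real n powr (6/5) / (real n)\<^sup>2)"
            using C(1) by (simp add: ennreal_mult[symmetric])
          finally show "(\<integral>\<^sup>+x. ennreal ((smoothing K (h n) (\<lambda>z. ?s z / real n) x)\<^sup>2) \<partial>lborel)
              \<le> ennreal (kn\<^sup>2) * ennreal (C * real n powr (6/5) / (real n)\<^sup>2)" by (simp add: mult_left_mono)
        qed auto
        also have "\<dots> = ennreal (64 * (k2 + 1) * (ln (real n) / (real n * h n)) + 2 * (kn\<^sup>2 * C) * real n powr (- (4/5)))"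
        proof -
          have l: "0 \<le> ln (real n)" using n by simp
          have 1: "2 * w * (32 * real n * J n * ln (real n)) = 64 * (k2 + 1) * (ln (real n) / (real n * h n))"
            unfolding w_def J_def using n h[of n] by (simp add: field_simps power2_eq_square)
          have "real n powr (6/5) / (real n)\<^sup>2 = real n powr (6/5) / real n powr 2"
            using n by simp
          also have "\<dots> = real n powr (- (4/5))" by (simp only: powr_diff[symmetric]) simp
          finally have 2: "2 * (kn\<^sup>2 * (C * real n powr (6/5) / (real n)\<^sup>2)) = 2 * (kn\<^sup>2 * C) * real n powr (- (4/5))"
            by (simp only: times_divide_eq_right[symmetric] mult.assoc)
          have "ennreal (2 * w) * ennreal (32 * real n * J n * ln (real n)) = ennreal (2 * w * (32 * real n * J n * ln (real n)))"
            using w l J[of n] by (intro ennreal_mult[symmetric]) auto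
          moreover have "2 * (ennreal (kn\<^sup>2) * ennreal (C * real n powr (6/5) / (real n)\<^sup>2)) = ennreal (2 * (kn\<^sup>2 * (C * real n powr (6/5) / (real n)\<^sup>2)))"
          proof -
            have "2 * (ennreal y * ennreal z) = ennreal (2 * (y * z))" if "0 \<le> y" "0 \<le> z" for y z
              using that by (simp add: ennreal_mult)
            from this[of "kn\<^sup>2" "C * real n powr (6/5) / (real n)\<^sup>2"] show ?thesis using C(1) by fastforce
          qed
          ultimately show ?thesis unfolding 1 2 using l k20 h[of n] C(1) by (subst ennreal_plus) auto
        qed
        also have "\<dots> \<le> ennreal (C' * (ln (real n) / (real n * h n) + real n powr (- (4/5))))"
          unfolding distrib_left using n h[of n]
          by (intro ennreal_leI add_mono mult_right_mono) (auto simp: C'_def)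
        finally show ?case .
      qed
    qed
  qed
qed

end

section \<open>Mass of the estimator, bandwidths and rates\<close>

text \<open>The kernel may change sign, so the L^1 norm of the estimator is controlled by that of
  \<open>K\<close>. This is the input to the measure bound for the truncation set.\<close>

lemma kde_L1:
  assumes K: "integrable lborel K" and h: "0 < h n" and n: "1 \<le> n"
  shows "(\<integral>\<^sup>+x. ennreal \<bar>kde K h X n \<omega> x\<bar> \<partial>lborel) \<le> ennreal (\<integral>u. \<bar>K u\<bar> \<partial>lborel)"
proof -
  have [measurable]: "K \<in> borel_measurable borel" using K by auto
  let ?k = "\<integral>u. \<bar>K u\<bar> \<partial>lborel"
  have one: "(\<integral>\<^sup>+x. ennreal \<bar>K ((x - y) / h n)\<bar> \<partial>lborel) = ennreal (h n * ?k)" for y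
  proof -
    have "(\<integral>\<^sup>+x. ennreal \<bar>K ((x - y) / h n)\<bar> \<partial>lborel) = ennreal \<bar>h n\<bar> * (\<integral>\<^sup>+u. ennreal \<bar>K ((y + h n * u - y) / h n)\<bar> \<partial>lborel)"
      by (rule nn_integral_real_affine) (use h in auto)
    also have "\<dots> = ennreal (h n) * ennreal ?k"
      using h K by (simp add: nn_integral_eq_integral)
    finally show ?thesis using h by (simp add: ennreal_mult)
  qed
  have "(\<integral>\<^sup>+x. ennreal \<bar>kde K h X n \<omega> x\<bar> \<partial>lborel)
      \<le> (\<integral>\<^sup>+x. ennreal (1 / (real n * h n)) * (\<Sum>i=1..n. ennreal \<bar>K ((x - X i \<omega>) / h n)\<bar>) \<partial>lborel)"
  proof (rule nn_integral_mono)
    fix x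
    have "\<bar>kde K h X n \<omega> x\<bar> = 1 / (real n * h n) * \<bar>\<Sum>i=1..n. K ((x - X i \<omega>) / h n)\<bar>"
      using h by (simp add: kde_def abs_mult)
    also have "\<dots> \<le> 1 / (real n * h n) * (\<Sum>i=1..n. \<bar>K ((x - X i \<omega>) / h n)\<bar>)"
      using h by (intro mult_left_mono sum_abs) auto
    finally show "ennreal \<bar>kde K h X n \<omega> x\<bar> \<le> ennreal (1 / (real n * h n)) * (\<Sum>i=1..n. ennreal \<bar>K ((x - X i \<omega>) / h n)\<bar>)"
      using h by (simp only: sum_ennreal abs_ge_zero) (auto simp: ennreal_mult[symmetric] sum_nonneg intro: ennreal_leI)
  qed
  also have "\<dots> = ennreal (1 / (real n * h n)) * (\<Sum>i=1..n. ennreal (h n * ?k))"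
    by (simp add: nn_integral_cmult nn_integral_sum one del: sum_ennreal)
  also have "\<dots> = ennreal (1 / (real n * h n)) * ennreal (real n * (h n * ?k))"
    using h by (subst sum_ennreal) auto
  also have "\<dots> = ennreal ?k"
    using h n by (subst ennreal_mult[symmetric]) auto
  finally show ?thesis .
qed

lemma asymp_eqD:
  assumes "asymp_eq h r" and r: "\<forall>\<^sub>F n in sequentially. 0 < r n"
  obtains c1 c2 where "0 < c1" "0 < c2" "\<forall>\<^sub>F n in sequentially. c1 * r n \<le> h n \<and> h n \<le> c2 * r n"
proof -
  have "0 < liminf (\<lambda>n. ereal (h n / r n))" "limsup (\<lambda>n. ereal (h n / r n)) < \<infinity>"
    using assms(1) by (auto simp: asymp_eq_def)
  then obtain c1 c2 where c: "0 < ereal c1" "ereal c1 < liminf (\<lambda>n. ereal (h n / r n))"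
      "limsup (\<lambda>n. ereal (h n / r n)) < ereal c2"
    by (blast dest: ereal_dense2)
  have "\<forall>\<^sub>F n in sequentially. ereal c1 < ereal (h n / r n)" using less_LiminfD[OF c(2)] .
  moreover have "\<forall>\<^sub>F n in sequentially. ereal (h n / r n) < ereal c2" using Limsup_lessD[OF c(3)] .
  \<comment> \<open>The maximum with 1 provides a positive upper constant directly.\<close>
  ultimately have ev: "\<forall>\<^sub>F n in sequentially. c1 * r n \<le> h n \<and> h n \<le> max c2 1 * r n" using r
  proof eventually_elim
    case (elim n)
    have "c2 * r n \<le> max c2 1 * r n" using elim by (intro mult_right_mono) auto
    moreover have "c1 * r n \<le> h n" "h n \<le> c2 * r n" using elim by (auto simp: field_simps)
    ultimately show ?case by linarith
  qed
  show ?thesis by (rule that[OF _ _ ev]) (use c in auto)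
qed

text \<open>\<open>r\<close> is the reference bandwidth. From index 3 on \<open>ln (real n)\<close>
  is at least 1, because e <= 3; this gives n^(-4/5) <= r^4.\<close>

lemma rate_facts:
  fixes n :: nat
  assumes n: "3 \<le> n"
  defines "r \<equiv> (ln (real n) / real n) powr (1/5)"
  shows "0 < r" "r \<le> 1" "r ^ 5 = ln (real n) / real n" "real n powr (- (4/5)) \<le> r ^ 4"
    and "\<And>g. 0 < g \<Longrightarrow> (real n * g ^ 5 / ln (real n)) powr (2/5) = g\<^sup>2 / r\<^sup>2"
proof -
  have "exp 1 \<le> real n" using exp_le n by linarith
  then have l: "1 \<le> ln (real n)" using n by (subst ln_ge_iff) auto
  have ln: "ln (real n) \<le> real n" using ln_le_minus_one[of "real n"] n by simp
  define q where "q = ln (real n) / real n"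
  have q: "0 < q" "q \<le> 1" unfolding q_def using l ln n by auto
  have rq: "r = q powr (1/5)" by (simp add: r_def q_def)
  show "0 < r" using q by (simp add: rq)
  show "r \<le> 1" unfolding rq using q by (intro powr_le1) auto
  have pw: "r ^ k = q powr (real k / 5)" for k
    using q by (simp add: rq powr_powr powr_realpow[symmetric])
  show "r ^ 5 = ln (real n) / real n" unfolding pw using q l by (simp add: q_def)
  have "real n powr (- (4/5)) = (1 / real n) powr (4/5)" using n by (simp add: powr_minus powr_divide field_simps)
  also have "\<dots> \<le> q powr (4/5)" unfolding q_def using l n by (intro powr_mono2) (auto intro: divide_right_mono)
  finally show "real n powr (- (4/5)) \<le> r ^ 4" by (simp add: pw)
  fix g :: real assume g: "0 < g"
  have "real n * g ^ 5 / ln (real n) = g ^ 5 / q" unfolding q_def by simp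
  then have "(real n * g ^ 5 / ln (real n)) powr (2/5) = (g ^ 5) powr (2/5) / q powr (2/5)"
    using g q by (simp add: powr_divide)
  also have "(g ^ 5) powr (2/5) = g\<^sup>2"
  proof -
    have "(g ^ 5) powr (2/5) = (g powr 5) powr (2/5)" using g by simp
    also have "\<dots> = g powr 2" by (simp only: powr_powr) simp
    finally show ?thesis using g by simp
  qed
  also have "q powr (2/5) = r\<^sup>2" by (simp add: pw)
  finally show "(real n * g ^ 5 / ln (real n)) powr (2/5) = g\<^sup>2 / r\<^sup>2" .
qed

section \<open>The almost sure rate of the truncated entropy estimator\<close>

theorem theorem1:
  fixes M :: "'a measure"
    and eps :: "int \<Rightarrow> 'a \<Rightarrow> real"
    and f_eps :: "real \<Rightarrow> real"
    and a :: "nat \<Rightarrow> real"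
    and f :: "real \<Rightarrow> real"
    and K :: "real \<Rightarrow> real"
    and h \<gamma> :: "nat \<Rightarrow> real"
  assumes P: "prob_space M"
    and indep: "prob_space.indep_vars M (\<lambda>_. borel) eps UNIV"
    and eps_dens: "\<And>i. distributed M lborel (eps i) (\<lambda>x. ennreal (f_eps x))"
    and f_eps_nonneg: "\<And>x. 0 \<le> f_eps x"
    and mean0: "\<And>i. integral\<^sup>L M (eps i) = 0"
    and var_fin: "\<And>i. integrable M (\<lambda>\<omega>. (eps i \<omega>)\<^sup>2)"
    and a_abs: "summable (\<lambda>i. \<bar>a i\<bar>)"
    and a_sum: "(\<Sum>i. a i) \<noteq> 0"
    and f_dens: "\<And>n. distributed M lborel (lin_proc a eps n) (\<lambda>x. ennreal (f x))"
    and f_nonneg: "\<And>x. 0 \<le> f x"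
    and entropy_fin: "integrable lborel (\<lambda>x. f x * ln (f x))"
    and K_int: "integrable lborel K" "(LINT u | lborel. K u) = 1"
    and h_pos: "\<And>n. 0 < h n"
    and B1: "asymp_eq h (\<lambda>n. (ln (real n) / real n) powr (1/5))"
    and K1_bdd: "bounded (range K)"
    and K1_supp: "\<exists>R. \<forall>u. R < \<bar>u\<bar> \<longrightarrow> K u = 0"
    and K1_hoelder: "\<exists>\<iota> C. 0 < \<iota> \<and> \<iota> \<le> 1 \<and> (\<forall>x y. \<bar>K x - K y\<bar> \<le> C * \<bar>x - y\<bar> powr \<iota>)"
    and K2: "integrable lborel (\<lambda>u. u * K u)" "(LINT u | lborel. u * K u) = 0"
    and D12: "\<exists>f1 f2. (\<forall>x. (f_eps has_real_derivative f1 x) (at x))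
                  \<and> (\<forall>x. (f1 has_real_derivative f2 x) (at x))
                  \<and> bounded (range f_eps) \<and> bounded (range f1) \<and> bounded (range f2)
                  \<and> integrable lborel (\<lambda>x. (f_eps x)\<^sup>2)
                  \<and> integrable lborel (\<lambda>x. (f1 x)\<^sup>2)
                  \<and> integrable lborel (\<lambda>x. (f2 x)\<^sup>2)"
    and D3: "\<exists>g1 g2. (\<forall>x. (f has_real_derivative g1 x) (at x))
                  \<and> (\<forall>x. (g1 has_real_derivative g2 x) (at x))
                  \<and> bounded (range g2)"
    and gamma_pos: "\<And>n. 0 < \<gamma> n"
    and gamma_lim: "\<gamma> \<longlonglongrightarrow> 0"
    and h_small: "h \<in> o(\<gamma>)"
  shows "AE \<omega> in M.
           limsup (\<lambda>n. ereal ((real n * \<gamma> n ^ 5 / ln (real n)) powr (2/5) *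
              \<bar>entropy_est K h (lin_proc a eps) \<gamma> n \<omega>
               - (LINT x : trunc_set K h (lin_proc a eps) \<gamma> n \<omega> | lborel. (- ln (f x)) * f x)\<bar>))
           < \<infinity>"
proof -
  interpret prob_space M by (rule P)
  obtain f1 f2 where f1: "\<And>x. (f_eps has_real_derivative f1 x) (at x)"
      and f2: "\<And>x. (f1 has_real_derivative f2 x) (at x)"
      and fb: "bounded (range f_eps)" and f1L2: "integrable lborel (\<lambda>x. (f1 x)\<^sup>2)"
    using D12 by blast
  obtain g1 g2 where g1: "\<And>x. (f has_real_derivative g1 x) (at x)"
      and g2: "\<And>x. (g1 has_real_derivative g2 x) (at x)" and g2b: "bounded (range g2)"
    using D3 by blast
  obtain B where B: "\<And>x. f_eps x \<le> B" using fb unfolding bounded_iff by (auto simp: abs_le_iff)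
  obtain G where G: "\<And>x. \<bar>g2 x\<bar> \<le> G" using g2b unfolding bounded_iff by auto
  obtain KB where KB: "\<And>x. \<bar>K x\<bar> \<le> KB" using K1_bdd unfolding bounded_iff by auto
  obtain R where R: "\<And>u. R < \<bar>u\<bar> \<Longrightarrow> K u = 0" using K1_supp by blast
  have Km [measurable]: "K \<in> borel_measurable borel" using K_int(1) by auto
  have "continuous_on UNIV f" using g1 by (intro continuous_at_imp_continuous_on) (auto intro: DERIV_isCont)
  then have fm [measurable]: "f \<in> borel_measurable borel" by (rule borel_measurable_continuous_onI)
  have f1c: "continuous_on UNIV f1" using f2 by (intro continuous_at_imp_continuous_on) (auto intro: DERIV_isCont)
  have B0: "0 \<le> B" using B[of 0] f_eps_nonneg[of 0] by linarith
  have G0: "0 \<le> G" using G[of 0] by linarith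
  define law where "law = density lborel (\<lambda>x. ennreal (f_eps x))"
  have distr: "distr M borel (eps i) = law" for i
    unfolding law_def distributed_distr_eq_density[OF eps_dens[of i], symmetric] by (rule distr_cong) auto
  have em [measurable]: "eps i \<in> borel_measurable M" for i using distributed_measurable[OF eps_dens[of i]] by simp
  interpret iid_innovations M eps law
  proof
    show "integrable law (\<lambda>v. v\<^sup>2)"
      using var_fin[of 0] unfolding distr[of 0, symmetric] by (subst integrable_distr_eq) auto
  qed (use indep distr in auto)
  have ex: "\<exists>i. a i \<noteq> 0"
  proof (rule ccontr)
    assume "\<nexists>i. a i \<noteq> 0"
    then have "a = (\<lambda>_. 0)" by auto
    then show False using a_sum by simp
  qed
  \<comment> \<open>Leading coefficients may vanish, so the newest innovation that really enters
    time \<open>i\<close> has index \<open>int i - int k0\<close>. \<open>a k0\<close> plays the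
    part of \<open>a0\<close>, and \<open>b\<close> holds the later coefficients.\<close>
  define k0 where "k0 = (LEAST i. a i \<noteq> 0)"
  have k0: "a k0 \<noteq> 0" "\<And>i. i < k0 \<Longrightarrow> a i = 0"
    unfolding k0_def using LeastI_ex[OF ex] by (auto dest: not_less_Least)
  define b where "b k = a (Suc k + k0)" for k
  have sa: "summable (\<lambda>k. \<bar>a (k + k0)\<bar>)" using a_abs by (rule summable_ignore_initial_segment)
  have sb: "summable (\<lambda>k. \<bar>b k\<bar>)"
    unfolding b_def using sa summable_Suc_iff[of "\<lambda>k. \<bar>a (k + k0)\<bar>"] by simp
  let ?X = "lin_proc a eps"
  have X: "AE \<omega> in M. ?X i \<omega> = a k0 * eps (int i - int k0) \<omega> + lin b (int i - int k0 - 1) \<omega>" for i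
  proof -
    have "?X i \<omega> = lin (\<lambda>k. a (k + k0)) (int i - int k0) \<omega>" for \<omega>
      using lin_drop_zeros[of k0 a "int i" \<omega>] k0(2) by (simp add: lin_proc_def lin_def)
    then show ?thesis using AE_lin_Suc[OF sa, of "int i - int k0"] unfolding b_def by simp
  qed
  note L2 = AE_kde_L2[OF law_def f_eps_nonneg B f1 f1c f1L2 k0(1) sb X f_dens f_nonneg fm]
  have f_le: "AE x in lborel. f x \<le> B / \<bar>a k0\<bar>"
    by (rule L2(1)[OF K_int(1) KB h_pos])
  have kde_L2: "AE \<omega> in M. \<exists>C\<ge>0. \<forall>\<^sub>F n in sequentially.
      (\<integral>\<^sup>+x. ennreal ((kde K h ?X n \<omega> x - smoothing K (h n) f x)\<^sup>2) \<partial>lborel)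
        \<le> ennreal (C * (ln (real n) / (real n * h n) + real n powr (- (4/5))))"
    by (rule L2(2)[OF K_int(1) KB h_pos])
  define kn where "kn = (\<integral>u. \<bar>K u\<bar> \<partial>lborel)"
  have kn: "0 \<le> kn" unfolding kn_def by simp
  \<comment> \<open>Bounded support gives u^2 <= R^2 wherever \<open>K u\<close> is nonzero.\<close>
  have K2i: "integrable lborel (\<lambda>u. u\<^sup>2 * \<bar>K u\<bar>)"
  proof (rule Bochner_Integration.integrable_bound)
    show "integrable lborel (\<lambda>u. R\<^sup>2 * K u)" using K_int(1) by simp
    show "AE u in lborel. norm (u\<^sup>2 * \<bar>K u\<bar>) \<le> norm (R\<^sup>2 * K u)"
    proof (rule AE_I2)
      fix u
      show "norm (u\<^sup>2 * \<bar>K u\<bar>) \<le> norm (R\<^sup>2 * K u)"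
      proof (cases "\<bar>u\<bar> \<le> R")
        case True
        then have "u\<^sup>2 \<le> R\<^sup>2" by (subst abs_le_square_iff[symmetric]) auto
        then show ?thesis by (simp add: abs_mult mult_right_mono)
      qed (use R in auto)
    qed
  qed measurable
  define kk where "kk = G * (\<integral>u. u\<^sup>2 * \<bar>K u\<bar> \<partial>lborel)"
  have kk: "0 \<le> kk" unfolding kk_def using G0 by simp
  have bias: "\<bar>smoothing K (h n) f x - f x\<bar> \<le> kk * (h n)\<^sup>2" for n x
    unfolding kk_def by (rule smoothing_bias(2)[OF g1 g2 G K_int K2 K2i])
  define r where "r n = (ln (real n) / real n) powr (1/5)" for n :: nat
  have "\<forall>\<^sub>F n in sequentially. 0 < r n"
    using eventually_ge_at_top[of 3] by eventually_elim (simp add: r_def rate_facts(1))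
  then obtain c1 c2 where c: "0 < c1" "0 < c2" and hr: "\<forall>\<^sub>F n in sequentially. c1 * r n \<le> h n \<and> h n \<le> c2 * r n"
    using asymp_eqD[of h r] B1 unfolding r_def by blast
  have gam: "\<forall>\<^sub>F n in sequentially. \<gamma> n < 1" using order_tendstoD(2)[OF gamma_lim, of 1] by simp
  show ?thesis
    using kde_L2
  proof eventually_elim
    case (elim \<omega>)
    then obtain C where C: "0 \<le> C" and ev: "\<forall>\<^sub>F n in sequentially.
        (\<integral>\<^sup>+x. ennreal ((kde K h ?X n \<omega> x - smoothing K (h n) f x)\<^sup>2) \<partial>lborel)
        \<le> ennreal (C * (ln (real n) / (real n * h n) + real n powr (- (4/5))))" by blast
    \<comment> \<open>Since ln n / n = r^5 and h >= c1 r, the martingale rate is at most r^4 / c1;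
      the other rate is at most r^4.\<close>
    define e where "e = C * (1 / c1 + 1)"
    have e: "0 \<le> e" unfolding e_def using C c by simp
    define Cb where "Cb = kk * c2\<^sup>2"
    have Cb: "0 \<le> Cb" unfolding Cb_def using kk by simp
    define B' where "B' = B / \<bar>a k0\<bar>"
    have B': "0 \<le> B'" unfolding B'_def using B0 by simp
    define E where "E = 3 * e + (1 + Cb + 2 * Cb\<^sup>2) * kn"
    have E: "0 \<le> E" unfolding E_def using e Cb kn by simp
    have "\<forall>\<^sub>F n in sequentially. (real n * \<gamma> n ^ 5 / ln (real n)) powr (2/5) *
              \<bar>entropy_est K h ?X \<gamma> n \<omega> - (LINT x : trunc_set K h ?X \<gamma> n \<omega> | lborel. (- ln (f x)) * f x)\<bar>
              \<le> (2 + B') * E"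
      using ev hr gam eventually_ge_at_top[of 3]
    proof eventually_elim
      case (elim n)
      note r = rate_facts[OF elim(4), folded r_def]
      have r0: "0 < r n" by (rule r(1))
      let ?u = "kde K h ?X n \<omega>" and ?A = "trunc_set K h ?X \<gamma> n \<omega>"
      have um: "?u \<in> borel_measurable borel" unfolding kde_def by measurable
      have p: "(\<integral>\<^sup>+x. ennreal ((?u x - smoothing K (h n) f x)\<^sup>2) \<partial>lborel) \<le> ennreal (e * ((r n)\<^sup>2)\<^sup>2)"
      proof (rule order_trans[OF elim(1)], rule ennreal_leI)
        have "ln (real n) / (real n * h n) = r n ^ 5 / h n" by (simp add: r(3))
        also have "\<dots> \<le> r n ^ 5 / (c1 * r n)"
          using elim(2) r0 c h_pos[of n] by (intro divide_left_mono) auto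
        also have "\<dots> = 1 / c1 * r n ^ 4" using r0 c by (simp add: field_simps power_numeral_reduce)
        finally have "ln (real n) / (real n * h n) + real n powr (- (4/5)) \<le> (1 / c1 + 1) * r n ^ 4"
          using r(4) by (simp add: algebra_simps)
        then show "C * (ln (real n) / (real n * h n) + real n powr (- (4/5))) \<le> e * ((r n)\<^sup>2)\<^sup>2"
          unfolding e_def using C by (simp add: power_mult[symmetric] mult.assoc mult_left_mono)
      qed
      have bi: "\<bar>?u x - f x - (?u x - smoothing K (h n) f x)\<bar> \<le> Cb * (r n)\<^sup>2" for x
      proof -
        have "(h n)\<^sup>2 \<le> (c2 * r n)\<^sup>2" using elim(2) h_pos[of n] by (intro power_mono) auto
        then have "kk * (h n)\<^sup>2 \<le> kk * (c2 * r n)\<^sup>2" using kk by (rule mult_left_mono)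
        then show ?thesis using bias[of n x] unfolding Cb_def by (simp add: power_mult_distrib mult.assoc)
      qed
      have A: "?A = {x. \<gamma> n \<le> ?u x}" unfolding trunc_set_def using gamma_pos[of n] by auto
      have rr: "0 < (r n)\<^sup>2" "(r n)\<^sup>2 \<le> 1" using r0 r(2) by (auto simp: power_le_one)
      have sm: "(\<lambda>x. ?u x - smoothing K (h n) f x) \<in> borel_measurable borel" using um by measurable
      have "\<bar>(LINT x : ?A | lborel. ?u x * ln (?u x)) - (LINT x : ?A | lborel. f x * ln (f x))\<bar>
          \<le> (1 + B' + \<bar>ln (\<gamma> n)\<bar>) * E * ((r n)\<^sup>2 / \<gamma> n)"
        unfolding E_def
      \<comment> \<open>The scale \<open>d\<close> is (r n)^2: the squared L^2 error is at most
        \<open>e\<close> times d^2 and the bias at most \<open>Cb\<close> times d.\<close>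
      proof (rule truncated_entropy_diff[OF um fm sm A gamma_pos _ rr f_nonneg _ B' bi Cb p e _ kn entropy_fin])
        show "\<gamma> n \<le> 1" using elim(3) by simp
        show "AE x in lborel. f x \<le> B'" unfolding B'_def by (rule f_le)
        show "(\<integral>\<^sup>+x. ennreal \<bar>?u x\<bar> \<partial>lborel) \<le> ennreal kn"
          unfolding kn_def using elim(4) by (intro kde_L1 K_int h_pos) auto
      qed
      also have "\<bar>(LINT x : ?A | lborel. ?u x * ln (?u x)) - (LINT x : ?A | lborel. f x * ln (f x))\<bar>
          = \<bar>entropy_est K h ?X \<gamma> n \<omega> - (LINT x : ?A | lborel. (- ln (f x)) * f x)\<bar>"
      proof -
        have "(LINT x : ?A | lborel. (- ln (f x)) * f x) = - (LINT x : ?A | lborel. f x * ln (f x))"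
          unfolding set_lebesgue_integral_def by (simp add: mult.commute)
        then show ?thesis unfolding entropy_est_def by (simp add: abs_minus_commute)
      qed
      finally have "(\<gamma> n)\<^sup>2 / (r n)\<^sup>2 * \<bar>entropy_est K h ?X \<gamma> n \<omega> - (LINT x : ?A | lborel. (- ln (f x)) * f x)\<bar>
          \<le> (\<gamma> n)\<^sup>2 / (r n)\<^sup>2 * ((1 + B' + \<bar>ln (\<gamma> n)\<bar>) * E * ((r n)\<^sup>2 / \<gamma> n))"
        by (rule mult_left_mono) simp
      also have "\<dots> = (\<gamma> n * (1 + B' + \<bar>ln (\<gamma> n)\<bar>)) * E"
        using r0 gamma_pos[of n] by (simp add: field_simps power2_eq_square)
      also have "\<dots> \<le> (2 + B') * E"
      proof (rule mult_right_mono[OF _ E])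
        \<comment> \<open>On (0, 1) the product x |ln x| is at most 1, by ln y <= y - 1 at y = 1/x;
          the surviving factor \<open>\<gamma> n\<close> thus absorbs the logarithm.\<close>
        have "- ln (\<gamma> n) = ln (1 / \<gamma> n)" using gamma_pos[of n] by (simp add: ln_div)
        also have "\<dots> \<le> 1 / \<gamma> n - 1" using gamma_pos[of n] by (intro ln_le_minus_one) auto
        finally have "\<gamma> n * \<bar>ln (\<gamma> n)\<bar> \<le> \<gamma> n * (1 / \<gamma> n)"
          using gamma_pos[of n] elim(3) by (intro mult_left_mono) auto
        then have "\<gamma> n * \<bar>ln (\<gamma> n)\<bar> \<le> 1" using gamma_pos[of n] by simp
        moreover have "\<gamma> n * (1 + B') \<le> 1 * (1 + B')" using elim(3) B' by (intro mult_right_mono) auto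
        ultimately show "\<gamma> n * (1 + B' + \<bar>ln (\<gamma> n)\<bar>) \<le> 2 + B'" by (simp add: algebra_simps)
      qed
      finally show ?case unfolding r(5)[OF gamma_pos] .
    qed
    then have "limsup (\<lambda>n. ereal ((real n * \<gamma> n ^ 5 / ln (real n)) powr (2/5) *
              \<bar>entropy_est K h ?X \<gamma> n \<omega> - (LINT x : trunc_set K h ?X \<gamma> n \<omega> | lborel. (- ln (f x)) * f x)\<bar>))
              \<le> ereal ((2 + B') * E)"
      by (intro Limsup_bounded) (auto elim!: eventually_mono)
    then show ?case by (rule le_less_trans) simp
  qed
qed

end
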